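(* Let $E\to M$ be a Lie algebroid. For any $|\mu|\in\mathrm{Sec}(|\mathrm{Vol}|_E)$ the formula $$\mathcal L_a|\mu|=-\,i(\partial_{|\mu|}(a))\,|\mu|,\qquad a\in\mathcal A(E),$$ defines uniquely an operator $\partial_{|\mu|}$ on $\mathcal A(E)$ which belongs to $\mathrm{Gen}(E)$, i.e. $\partial_{|\mu|}$ is a generating operator for the Schouten bracket of $E$ with $\partial_{|\mu|}^2=0$.
   Context: All objects are smooth. $E\to M$ is a Lie algebroid over a manifold $M$. $\mathcal A^i(E)=\mathrm{Sec}(\bigwedge^iE)$ and $\mathcal A(E)=\bigoplus_i\mathcal A^i(E)$; $|a|$ is the degree of $a$. $[\cdot,\cdot]$ is the Schouten bracket on $\mathcal A(E)$: the graded bilinear bracket of degree $-1$ extending the Lie algebroid bracket on $\mathrm{Sec}(E)$ with $[X,f]=\rho(X)(f)$ ($\rho$ the anchor, $X\in\mathrm{Sec}(E)$, $f\in C^\infty(M)$), satisfying $[a,b]=-(-1)^{(|a|-1)(|b|-1)}[b,a]$, the graded Jacobi identity, and $[a,b\wedge c]=[a,b]\wedge c+(-1)^{(|a|-1)|b|}b\wedge[a,c]$. A generating operator is a linear operator $\partial$ of degree $-1$ on $\mathcal A(E)$ such that $$[a,b]=(-1)^{|a|}\bigl(\partial(a\wedge b)-\partial(a)\wedge b-(-1)^{|a|}a\wedge\partial(b)\bigr)$$ for all homogeneous $a,b$. $\mathrm{Gen}(E)$ is the set of generating operators with $\partial^2=0$. $d$ is the Lie algebroid de Rham differential on $\mathcal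 A(E^* )$. For $a\in\mathcal A(E)$, $i_a=i(a)$ is contraction on $\mathcal A(E^* )$, with $i_X$ the usual insertion for $X\in\mathrm{Sec}(E)$, $i_f$ multiplication by $f$ for functions $f$, and $i_{a\wedge b}=i_b\,i_a$. The Lie differential is $\mathcal L_a=i_a\,d-(-1)^{|a|}d\,i_a$. $|\mathrm{Vol}|_E=(\bigwedge^{\mathrm{top}}E^*\setminus 0)/\mathbb Z_2$, with $\mathbb Z_2$ acting by $\mu\mapsto-\mu$ on the line bundle with zero section removed. A section $|\mu|$ is given locally by unordered pairs $\{\mu_U,-\mu_U\}$ of nowhere-vanishing local sections of $\bigwedge^{\mathrm{top}}E^*$ agreeing on overlaps. An identity involving $|\mu|$, such as the displayed formula in the claim, means that over each such open set $U$ it holds with $|\mu|$ replaced by a local representative $\mu_U$; it is insensitive to replacing $\mu_U$ by $-\mu_U$. *)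

theory Defs
  imports "HOL-Analysis.Analysis" "HOL-Library.Function_Algebras"
begin

text \<open>
  Functions into a real vector space form a real vector space under the pointwise operations
  (addition comes from \<^theory>\<open>HOL-Library.Function_Algebras\<close>).
\<close>

instantiation "fun" :: (type, real_vector) real_vector
begin

definition scaleR_fun :: "real \<Rightarrow> ('a \<Rightarrow> 'b) \<Rightarrow> 'a \<Rightarrow> 'b" where
  "scaleR_fun c f = (\<lambda>x. c *\<^sub>R f x)"

instance
  by standard (auto simp: scaleR_fun_def fun_eq_iff algebra_simps)

end


section \<open>Smooth manifolds\<close>

text \<open>On an open subset of a finite-dimensional space this is the usual class \<open>C\<^sup>k\<close>.\<close>

primrec Ck_on :: "nat \<Rightarrow> 'b::real_normed_vector set \<Rightarrow> ('b \<Rightarrow> 'c::real_normed_vector) \<Rightarrow> bool" where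
  "Ck_on 0 S f \<longleftrightarrow> continuous_on S f"
| "Ck_on (Suc k) S f \<longleftrightarrow> (\<forall>x\<in>S. f differentiable (at x)) \<and>
     (\<forall>v. Ck_on k S (\<lambda>x. frechet_derivative f (at x) v))"

definition smooth_on :: "'b::real_normed_vector set \<Rightarrow> ('b \<Rightarrow> 'c::real_normed_vector) \<Rightarrow> bool" where
  "smooth_on S f \<longleftrightarrow> (\<forall>k. Ck_on k S f)"

text \<open>
  The manifold is the type \<open>'m\<close> with an atlas of charts \<open>(V, \<phi>)\<close>.  The model space \<open>'b\<close> is a
  finite-dimensional inner product space; in contrast to \<^class>\<open>euclidean_space\<close> this includes
  dimension 0.
\<close>

type_synonym ('m, 'b) atlas = "('m set \<times> ('m \<Rightarrow> 'b)) set"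

locale smooth_manifold =
  fixes A :: "('m::{t2_space, second_countable_topology}, 'b::real_inner) atlas"
  assumes finite_dim: "\<exists>B. finite B \<and> span B = (UNIV :: 'b set)"
    and cover: "(\<Union>(V, \<phi>)\<in>A. V) = UNIV"
    and chart: "(V, \<phi>) \<in> A \<Longrightarrow> open V \<and> open (\<phi> ` V) \<and> homeomorphism V (\<phi> ` V) \<phi> (inv_into V \<phi>)"
    and transition: "(V, \<phi>) \<in> A \<Longrightarrow> (W, \<psi>) \<in> A \<Longrightarrow>
      smooth_on (\<phi> ` (V \<inter> W)) (\<lambda>y. \<psi> (inv_into V \<phi> y))"

definition smooth_fun_on :: "('m, 'b::real_inner) atlas \<Rightarrow> 'm set \<Rightarrow> ('m \<Rightarrow> real) \<Rightarrow> bool" where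
  "smooth_fun_on A U f \<longleftrightarrow> (\<forall>(V, \<phi>)\<in>A. smooth_on (\<phi> ` (U \<inter> V)) (\<lambda>y. f (inv_into V \<phi> y)))"

abbreviation Cinf :: "('m, 'b::real_inner) atlas \<Rightarrow> ('m \<Rightarrow> real) set" where
  "Cinf A \<equiv> {f. smooth_fun_on A UNIV f}"

definition smooth_near :: "('m::topological_space, 'b::real_inner) atlas \<Rightarrow> 'm \<Rightarrow> ('m \<Rightarrow> real) set" where
  "smooth_near A x = {f. \<exists>U. open U \<and> x \<in> U \<and> smooth_fun_on A U f}"

text \<open>
  Tangent vectors are the derivations at \<open>x\<close> of germs of smooth functions.  A germ is given by any
  function \<open>'m \<Rightarrow> real\<close> that is smooth near \<open>x\<close>; on other functions a tangent vector is set to 0.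
\<close>

definition tangent_space :: "('m::topological_space, 'b::real_inner) atlas \<Rightarrow> 'm \<Rightarrow> (('m \<Rightarrow> real) \<Rightarrow> real) set" where
  "tangent_space A x = {D.
     (\<forall>f. f \<notin> smooth_near A x \<longrightarrow> D f = 0) \<and>
     (\<forall>f\<in>smooth_near A x. \<forall>g\<in>smooth_near A x.
        ((\<forall>\<^sub>F y in nhds x. f y = g y) \<longrightarrow> D f = D g) \<and>
        D (\<lambda>y. f y + g y) = D f + D g \<and>
        (\<forall>c. D (\<lambda>y. c * f y) = c * D f) \<and>
        D (\<lambda>y. f y * g y) = D f * g x + f x * D g)}"


section \<open>Vector bundles\<close>

text \<open>
  The fibres are finite-dimensional linear subspaces of a real vector space \<open>'v\<close>, which may be
  infinite-dimensional and serves only as a common carrier (e.g. the direct sum of all fibres).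
  The bundle structure is an atlas of local frames \<open>(U, e)\<close>, where \<open>e\<close> lists sections over \<open>U\<close>
  forming a basis of each fibre, with smooth transition functions.
\<close>

record ('m, 'v) vbundle =
  fibre :: "'m \<Rightarrow> 'v set"
  frames :: "('m set \<times> ('m \<Rightarrow> 'v) list) set"

definition basis_list :: "'v::real_vector set \<Rightarrow> 'v list \<Rightarrow> bool" where
  "basis_list F bs \<longleftrightarrow> distinct bs \<and> independent (set bs) \<and> span (set bs) = F"

abbreviation at_pt :: "('m \<Rightarrow> 'v) list \<Rightarrow> 'm \<Rightarrow> 'v list" where
  "at_pt e x \<equiv> map (\<lambda>s. s x) e"

text \<open>The dual basis; \<^const>\<open>representation\<close> is 0 outside the span of the basis.\<close>

definition dual_basis :: "'v::real_vector list \<Rightarrow> ('v \<Rightarrow> real) list" where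
  "dual_basis bs = map (\<lambda>b v. representation (set bs) v b) bs"

definition smooth_section :: "('m, 'b::real_inner) atlas \<Rightarrow> ('m, 'v::real_vector, 'z) vbundle_scheme
    \<Rightarrow> 'm set \<Rightarrow> ('m \<Rightarrow> 'v) \<Rightarrow> bool" where
  "smooth_section A E U s \<longleftrightarrow> (\<forall>x\<in>U. s x \<in> fibre E x) \<and>
     (\<forall>(V, e)\<in>frames E. \<forall>i<length e.
        smooth_fun_on A (U \<inter> V) (\<lambda>x. (dual_basis (at_pt e x) ! i) (s x)))"

abbreviation Sec :: "('m, 'b::real_inner) atlas \<Rightarrow> ('m, 'v::real_vector, 'z) vbundle_scheme
    \<Rightarrow> ('m \<Rightarrow> 'v) set" where
  "Sec A E \<equiv> {s. smooth_section A E UNIV s}"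

locale vector_bundle = smooth_manifold A
  for A :: "('m::{t2_space, second_countable_topology}, 'b::real_inner) atlas" +
  fixes E :: "('m, 'v::real_vector, 'z) vbundle_scheme"
  assumes frames_cover: "(\<Union>(U, e)\<in>frames E. U) = UNIV"
    and frame_open: "(U, e) \<in> frames E \<Longrightarrow> open U"
    and frame_basis: "(U, e) \<in> frames E \<Longrightarrow> x \<in> U \<Longrightarrow> basis_list (fibre E x) (at_pt e x)"
    and frame_smooth: "(U, e) \<in> frames E \<Longrightarrow> s \<in> set e \<Longrightarrow> smooth_section A E U s"
    and constant_rank: "\<exists>r. \<forall>(U, e)\<in>frames E. length e = r"

definition dual_space :: "'v::real_vector set \<Rightarrow> ('v \<Rightarrow> real) set" where
  "dual_space F = {\<xi>. (\<forall>v. v \<notin> F \<longrightarrow> \<xi> v = 0) \<and>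
     (\<forall>u\<in>F. \<forall>v\<in>F. \<xi> (u + v) = \<xi> u + \<xi> v) \<and> (\<forall>c. \<forall>v\<in>F. \<xi> (c *\<^sub>R v) = c * \<xi> v)}"

definition dual_bundle :: "('m, 'v::real_vector, 'z) vbundle_scheme \<Rightarrow> ('m, 'v \<Rightarrow> real) vbundle" where
  "dual_bundle E = \<lparr>fibre = (\<lambda>x. dual_space (fibre E x)),
     frames = (\<lambda>(U, e). (U, map (\<lambda>i x. dual_basis (at_pt e x) ! i) [0..<length e])) ` frames E\<rparr>"


section \<open>Exterior algebras\<close>

text \<open>
  \<open>alt_forms F\<close> is the exterior algebra \<open>\<Lambda> F\<^sup>* = \<Oplus>\<^sub>k \<Lambda>\<^sup>k F\<^sup>*\<close> of the dual of a
  finite-dimensional space \<open>F\<close>, realised as alternating multilinear forms.  An element of the direct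
  sum is a function on argument lists whose restriction to lists of length \<open>k\<close> is its component of
  degree \<open>k\<close>; it is extended by 0 to lists with an entry outside \<open>F\<close>.  The exterior algebra \<open>\<Lambda> F\<close>
  is \<open>alt_forms (dual_space F)\<close>.
\<close>

definition alt_forms :: "'v::real_vector set \<Rightarrow> ('v list \<Rightarrow> real) set" where
  "alt_forms F = {\<omega>.
     (\<forall>vs. \<not> set vs \<subseteq> F \<longrightarrow> \<omega> vs = 0) \<and>
     (\<forall>us ws. \<forall>u\<in>F. \<forall>v\<in>F. set us \<subseteq> F \<longrightarrow> set ws \<subseteq> F \<longrightarrow>
        \<omega> (us @ (u + v) # ws) = \<omega> (us @ u # ws) + \<omega> (us @ v # ws)) \<and>
     (\<forall>us ws. \<forall>v\<in>F. \<forall>c. set us \<subseteq> F \<longrightarrow> set ws \<subseteq> F \<longrightarrow>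
        \<omega> (us @ (c *\<^sub>R v) # ws) = c * \<omega> (us @ v # ws)) \<and>
     (\<forall>vs. set vs \<subseteq> F \<longrightarrow> \<not> distinct vs \<longrightarrow> \<omega> vs = 0)}"

text \<open>
  The wedge product as a sum over shuffles (determinant convention): \<open>I\<close> is the set of positions
  of the arguments passed to the first factor, and the exponent counts inversions.
\<close>

definition wedge :: "('v list \<Rightarrow> real) \<Rightarrow> ('v list \<Rightarrow> real) \<Rightarrow> 'v list \<Rightarrow> real" where
  "wedge \<alpha> \<beta> vs = (\<Sum>I\<in>Pow {..<length vs}.
     (-1) ^ card {(i, j). i \<in> I \<and> j \<notin> I \<and> j < i} * \<alpha> (nths vs I) * \<beta> (nths vs (- I)))"

text \<open>
  The contraction \<open>i(a) : \<Lambda> F\<^sup>* \<rightarrow> \<Lambda> F\<^sup>*\<close> for \<open>a \<in> \<Lambda> F\<close>.  Write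
  \<open>a = \<Sum>\<^sub>I a(\<epsilon>\<^sub>I) e\<^sub>I\<close> over the increasing multi-indices \<open>I = (i\<^sub>1 < \<dots> < i\<^sub>k)\<close>, where \<open>e\<close> is any
  basis of \<open>F\<close> and \<open>\<epsilon>\<close> its dual basis.  As \<open>i\<^sub>a\<^sub>\<and>\<^sub>b = i\<^sub>b i\<^sub>a\<close> and \<open>i\<^sub>v\<close> inserts \<open>v\<close> as first argument,
  \<open>i(e\<^sub>I) \<omega> = \<omega>(e\<^sub>i\<^sub>1, \<dots>, e\<^sub>i\<^sub>k, \<dots>)\<close>.
\<close>

definition contraction :: "'v::real_vector set \<Rightarrow> (('v \<Rightarrow> real) list \<Rightarrow> real) \<Rightarrow> ('v list \<Rightarrow> real)
    \<Rightarrow> 'v list \<Rightarrow> real" where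
  "contraction F a \<omega> vs = (let e = (SOME bs. basis_list F bs) in
     \<Sum>I\<in>Pow {..<length e}. a (nths (dual_basis e) I) * \<omega> (nths e I @ vs))"

definition smooth_forms :: "('m, 'b::real_inner) atlas \<Rightarrow> ('m, 'v::real_vector, 'z) vbundle_scheme
    \<Rightarrow> 'm set \<Rightarrow> ('m \<Rightarrow> 'v list \<Rightarrow> real) set" where
  "smooth_forms A E U = {\<omega>. (\<forall>x\<in>U. \<omega> x \<in> alt_forms (fibre E x)) \<and>
     (\<forall>(V, e)\<in>frames E. \<forall>s. set s \<subseteq> set e \<longrightarrow> smooth_fun_on A (U \<inter> V) (\<lambda>x. \<omega> x (at_pt s x)))}"

text \<open>\<open>\<A>(E)\<close>, its homogeneous parts (zero in negative degree), and the product on it.\<close>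

definition multivectors :: "('m, 'b::real_inner) atlas \<Rightarrow> ('m, 'v::real_vector, 'z) vbundle_scheme
    \<Rightarrow> ('m \<Rightarrow> ('v \<Rightarrow> real) list \<Rightarrow> real) set" where
  "multivectors A E = smooth_forms A (dual_bundle E) UNIV"

definition multivectors_deg :: "('m, 'b::real_inner) atlas \<Rightarrow> ('m, 'v::real_vector, 'z) vbundle_scheme
    \<Rightarrow> int \<Rightarrow> ('m \<Rightarrow> ('v \<Rightarrow> real) list \<Rightarrow> real) set" where
  "multivectors_deg A E p = {a \<in> multivectors A E. \<forall>x \<xi>s. int (length \<xi>s) \<noteq> p \<longrightarrow> a x \<xi>s = 0}"

definition wedge_sec :: "('m \<Rightarrow> 'w list \<Rightarrow> real) \<Rightarrow> ('m \<Rightarrow> 'w list \<Rightarrow> real) \<Rightarrow> 'm \<Rightarrow> 'w list \<Rightarrow> real"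
    (infixr "\<and>\<^sub>\<A>" 70) where
  "(a \<and>\<^sub>\<A> b) = (\<lambda>x. wedge (a x) (b x))"

text \<open>The inclusions of \<open>C\<^sup>\<infinity>(M)\<close> and \<open>Sec(E)\<close> as degree 0 and degree 1 parts of \<open>\<A>(E)\<close>.\<close>

definition of_fun :: "('m \<Rightarrow> real) \<Rightarrow> 'm \<Rightarrow> 'w list \<Rightarrow> real" where
  "of_fun f x \<xi>s = (if \<xi>s = [] then f x else 0)"

definition of_sec :: "('m, 'v::real_vector, 'z) vbundle_scheme \<Rightarrow> ('m \<Rightarrow> 'v)
    \<Rightarrow> 'm \<Rightarrow> ('v \<Rightarrow> real) list \<Rightarrow> real" where
  "of_sec E X x \<xi>s = (case \<xi>s of [\<xi>] \<Rightarrow> (if \<xi> \<in> dual_space (fibre E x) then \<xi> (X x) else 0) | _ \<Rightarrow> 0)"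


section \<open>Lie algebroids\<close>

record ('m, 'v) algebroid = "('m, 'v) vbundle" +
  lie :: "('m \<Rightarrow> 'v) \<Rightarrow> ('m \<Rightarrow> 'v) \<Rightarrow> 'm \<Rightarrow> 'v"
  anchor :: "'m \<Rightarrow> 'v \<Rightarrow> ('m \<Rightarrow> real) \<Rightarrow> real"

definition anchor_deriv :: "('m, 'v, 'z) algebroid_scheme \<Rightarrow> ('m \<Rightarrow> 'v) \<Rightarrow> ('m \<Rightarrow> real) \<Rightarrow> 'm \<Rightarrow> real" where
  "anchor_deriv E X f = (\<lambda>x. anchor E x (X x) f)"

locale lie_algebroid = vector_bundle A E
  for A :: "('m::{t2_space, second_countable_topology}, 'b::real_inner) atlas"
    and E :: "('m, 'v::real_vector) algebroid" +
  assumes anchor_tangent: "v \<in> fibre E x \<Longrightarrow> anchor E x v \<in> tangent_space A x"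
    and anchor_add: "u \<in> fibre E x \<Longrightarrow> v \<in> fibre E x \<Longrightarrow> anchor E x (u + v) = anchor E x u + anchor E x v"
    and anchor_scale: "v \<in> fibre E x \<Longrightarrow> anchor E x (c *\<^sub>R v) = c *\<^sub>R anchor E x v"
    and anchor_smooth: "X \<in> Sec A E \<Longrightarrow> f \<in> Cinf A \<Longrightarrow> anchor_deriv E X f \<in> Cinf A"
    and lie_closed: "X \<in> Sec A E \<Longrightarrow> Y \<in> Sec A E \<Longrightarrow> lie E X Y \<in> Sec A E"
    and lie_add: "X \<in> Sec A E \<Longrightarrow> Y \<in> Sec A E \<Longrightarrow> Z \<in> Sec A E \<Longrightarrow> lie E X (Y + Z) = lie E X Y + lie E X Z"
    and lie_scale: "X \<in> Sec A E \<Longrightarrow> Y \<in> Sec A E \<Longrightarrow> lie E X (c *\<^sub>R Y) = c *\<^sub>R lie E X Y"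
    and lie_skew: "X \<in> Sec A E \<Longrightarrow> Y \<in> Sec A E \<Longrightarrow> lie E X Y = - lie E Y X"
    and lie_jacobi: "X \<in> Sec A E \<Longrightarrow> Y \<in> Sec A E \<Longrightarrow> Z \<in> Sec A E \<Longrightarrow>
      lie E X (lie E Y Z) + lie E Y (lie E Z X) + lie E Z (lie E X Y) = 0"
    and lie_leibniz: "X \<in> Sec A E \<Longrightarrow> Y \<in> Sec A E \<Longrightarrow> f \<in> Cinf A \<Longrightarrow>
      lie E X (\<lambda>x. f x *\<^sub>R Y x) = (\<lambda>x. f x *\<^sub>R lie E X Y x + anchor_deriv E X f x *\<^sub>R Y x)"
    and anchor_lie: "X \<in> Sec A E \<Longrightarrow> Y \<in> Sec A E \<Longrightarrow> f \<in> Cinf A \<Longrightarrow>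
      anchor_deriv E (lie E X Y) f =
        anchor_deriv E X (anchor_deriv E Y f) - anchor_deriv E Y (anchor_deriv E X f)"

text \<open>The axioms of the Schouten bracket; they determine it uniquely on \<open>\<A>(E)\<close>.\<close>

definition schouten_bracket :: "('m::topological_space, 'b::real_inner) atlas \<Rightarrow> ('m, 'v::real_vector) algebroid
    \<Rightarrow> (('m \<Rightarrow> ('v \<Rightarrow> real) list \<Rightarrow> real) \<Rightarrow> ('m \<Rightarrow> ('v \<Rightarrow> real) list \<Rightarrow> real)
        \<Rightarrow> 'm \<Rightarrow> ('v \<Rightarrow> real) list \<Rightarrow> real) \<Rightarrow> bool" where
  "schouten_bracket A E br \<longleftrightarrow>
     (\<forall>a\<in>multivectors A E. \<forall>b\<in>multivectors A E. \<forall>c\<in>multivectors A E.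
        br (a + b) c = br a c + br b c \<and> br a (b + c) = br a b + br a c) \<and>
     (\<forall>a\<in>multivectors A E. \<forall>b\<in>multivectors A E. \<forall>t.
        br (t *\<^sub>R a) b = t *\<^sub>R br a b \<and> br a (t *\<^sub>R b) = t *\<^sub>R br a b) \<and>
     (\<forall>p q. \<forall>a\<in>multivectors_deg A E p. \<forall>b\<in>multivectors_deg A E q.
        br a b \<in> multivectors_deg A E (p + q - 1)) \<and>
     (\<forall>X\<in>Sec A E. \<forall>Y\<in>Sec A E. br (of_sec E X) (of_sec E Y) = of_sec E (lie E X Y)) \<and>
     (\<forall>X\<in>Sec A E. \<forall>f\<in>Cinf A. br (of_sec E X) (of_fun f) = of_fun (anchor_deriv E X f)) \<and>
     (\<forall>p q. \<forall>a\<in>multivectors_deg A E p. \<forall>b\<in>multivectors_deg A E q.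
        br a b = - ((-1) powi ((p - 1) * (q - 1)) *\<^sub>R br b a)) \<and>
     (\<forall>p q s. \<forall>a\<in>multivectors_deg A E p. \<forall>b\<in>multivectors_deg A E q. \<forall>c\<in>multivectors_deg A E s.
        br a (br b c) = br (br a b) c + (-1) powi ((p - 1) * (q - 1)) *\<^sub>R br b (br a c)) \<and>
     (\<forall>p q s. \<forall>a\<in>multivectors_deg A E p. \<forall>b\<in>multivectors_deg A E q. \<forall>c\<in>multivectors_deg A E s.
        br a (b \<and>\<^sub>\<A> c) = br a b \<and>\<^sub>\<A> c + (-1) powi ((p - 1) * q) *\<^sub>R (b \<and>\<^sub>\<A> br a c))"

text \<open>
  \<open>Gen(E)\<close>, relative to the Schouten bracket \<open>br\<close>.  Operators are extensional functions on \<open>\<A>(E)\<close>.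
\<close>

definition Gen :: "('m::topological_space, 'b::real_inner) atlas \<Rightarrow> ('m, 'v::real_vector) algebroid
    \<Rightarrow> (('m \<Rightarrow> ('v \<Rightarrow> real) list \<Rightarrow> real) \<Rightarrow> ('m \<Rightarrow> ('v \<Rightarrow> real) list \<Rightarrow> real)
        \<Rightarrow> 'm \<Rightarrow> ('v \<Rightarrow> real) list \<Rightarrow> real)
    \<Rightarrow> (('m \<Rightarrow> ('v \<Rightarrow> real) list \<Rightarrow> real) \<Rightarrow> 'm \<Rightarrow> ('v \<Rightarrow> real) list \<Rightarrow> real) set" where
  "Gen A E br = {D \<in> multivectors A E \<rightarrow>\<^sub>E multivectors A E.
     (\<forall>a\<in>multivectors A E. \<forall>b\<in>multivectors A E. D (a + b) = D a + D b) \<and>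
     (\<forall>a\<in>multivectors A E. \<forall>t. D (t *\<^sub>R a) = t *\<^sub>R D a) \<and>
     (\<forall>p. \<forall>a\<in>multivectors_deg A E p. D a \<in> multivectors_deg A E (p - 1)) \<and>
     (\<forall>p q. \<forall>a\<in>multivectors_deg A E p. \<forall>b\<in>multivectors_deg A E q.
        br a b = (-1) powi p *\<^sub>R (D (a \<and>\<^sub>\<A> b) - D a \<and>\<^sub>\<A> b - (-1) powi p *\<^sub>R (a \<and>\<^sub>\<A> D b))) \<and>
     (\<forall>a\<in>multivectors A E. D (D a) = 0)}"


section \<open>Lie algebroid differential, Lie differential, densities\<close>

text \<open>
  The Koszul formula at the point \<open>x\<close> on sections \<open>X\<^sub>0, \<dots>, X\<^sub>k\<close>; indices are removed with \<^const>\<open>nths\<close>.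
\<close>

definition koszul :: "('m, 'v::real_vector) algebroid \<Rightarrow> ('m \<Rightarrow> 'v list \<Rightarrow> real) \<Rightarrow> 'm \<Rightarrow> ('m \<Rightarrow> 'v) list \<Rightarrow> real" where
  "koszul E \<omega> x Xs =
     (\<Sum>i<length Xs. (-1) ^ i * anchor_deriv E (Xs ! i) (\<lambda>y. \<omega> y (at_pt (nths Xs (- {i})) y)) x) +
     (\<Sum>j<length Xs. \<Sum>i<j. (-1) ^ (i + j) *
        \<omega> x (at_pt (lie E (Xs ! i) (Xs ! j) # nths Xs (- {i, j})) x))"

text \<open>
  The value of \<open>d\<omega>\<close> on vectors of the fibre over \<open>x\<close> is found by extending them to global smooth
  sections.  Only the germ of \<open>\<omega>\<close> at \<open>x\<close> enters, so the same operator serves for \<open>\<A>(E\<^sup>*)\<close> and for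
  forms on an open set \<open>U\<close>, evaluated at points of \<open>U\<close>.
\<close>

definition differential :: "('m, 'b::real_inner) atlas \<Rightarrow> ('m, 'v::real_vector) algebroid
    \<Rightarrow> ('m \<Rightarrow> 'v list \<Rightarrow> real) \<Rightarrow> 'm \<Rightarrow> 'v list \<Rightarrow> real" where
  "differential A E \<omega> x vs = (if set vs \<subseteq> fibre E x
     then koszul E \<omega> x (SOME Xs. set Xs \<subseteq> Sec A E \<and> at_pt Xs x = vs) else 0)"

definition contraction_sec :: "('m, 'v::real_vector) algebroid \<Rightarrow> ('m \<Rightarrow> ('v \<Rightarrow> real) list \<Rightarrow> real)
    \<Rightarrow> ('m \<Rightarrow> 'v list \<Rightarrow> real) \<Rightarrow> 'm \<Rightarrow> 'v list \<Rightarrow> real" where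
  "contraction_sec E a \<omega> = (\<lambda>x. contraction (fibre E x) (a x) (\<omega> x))"

text \<open>
  \<open>parity a = (-1)\<^bsup>|a|\<^esup> a\<close> on homogeneous elements, extended linearly, so that \<open>lie_diff\<close> is the
  linear extension of \<open>\<L>\<^sub>a = i\<^sub>a d - (-1)\<^bsup>|a|\<^esup> d i\<^sub>a\<close> to all of \<open>\<A>(E)\<close>.
\<close>

definition parity :: "('m \<Rightarrow> 'w list \<Rightarrow> real) \<Rightarrow> 'm \<Rightarrow> 'w list \<Rightarrow> real" where
  "parity a x \<xi>s = (-1) ^ length \<xi>s * a x \<xi>s"

definition lie_diff :: "('m, 'b::real_inner) atlas \<Rightarrow> ('m, 'v::real_vector) algebroid
    \<Rightarrow> ('m \<Rightarrow> ('v \<Rightarrow> real) list \<Rightarrow> real) \<Rightarrow> ('m \<Rightarrow> 'v list \<Rightarrow> real) \<Rightarrow> 'm \<Rightarrow> 'v list \<Rightarrow> real" where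
  "lie_diff A E a \<omega> = contraction_sec E a (differential A E \<omega>) - differential A E (contraction_sec E (parity a) \<omega>)"

text \<open>
  An element of \<open>|Vol|\<^sub>E\<close> over \<open>x\<close> is an unordered pair \<open>{\<mu>, -\<mu>}\<close> of nonzero top-degree forms, so a
  section assigns such a pair to every point.  \<open>local_rep A E \<nu> U \<mu>\<close> says that \<open>\<mu>\<close> is a
  local representative over \<open>U\<close> of the section \<open>\<nu>\<close>.
\<close>

definition local_rep :: "('m::topological_space, 'b::real_inner) atlas \<Rightarrow> ('m, 'v::real_vector, 'z) vbundle_scheme
    \<Rightarrow> ('m \<Rightarrow> ('v list \<Rightarrow> real) set) \<Rightarrow> 'm set \<Rightarrow> ('m \<Rightarrow> 'v list \<Rightarrow> real) \<Rightarrow> bool" where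
  "local_rep A E \<nu> U \<mu> \<longleftrightarrow> open U \<and> \<mu> \<in> smooth_forms A E U \<and>
     (\<forall>x\<in>U. (\<forall>vs. length vs \<noteq> dim (fibre E x) \<longrightarrow> \<mu> x vs = 0) \<and> \<mu> x \<noteq> 0 \<and> \<nu> x = {\<mu> x, - \<mu> x})"

definition Sec_Vol :: "('m::topological_space, 'b::real_inner) atlas \<Rightarrow> ('m, 'v::real_vector, 'z) vbundle_scheme
    \<Rightarrow> ('m \<Rightarrow> ('v list \<Rightarrow> real) set) set" where
  "Sec_Vol A E = {\<nu>. \<forall>x. \<exists>U \<mu>. x \<in> U \<and> local_rep A E \<nu> U \<mu>}"

end

theory Submission
  imports Defs
begin

text \<open>
  On a local representative \<open>\<mu>\<close>, which is closed as a form of top degree, the defining formula reads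
  \<open>i(D a) \<mu> = (-1)\<^sup>|\<^sup>a\<^sup>| d i(a) \<mu>\<close>.  As \<open>a \<mapsto> i(a) \<mu>\<close> is an isomorphism from multivector fields onto
  forms, \<open>D\<close> exists, is unique, and squares to zero because \<open>d\<close> does; it does not see the sign of \<open>\<mu>\<close>,
  which is locally constant.

  For a section \<open>X\<close>, Cartan's formula and \<open>[L\<^sub>X, i(c)] = i([X, c])\<close> give
  \<open>D(X \<and> c) = D(X) c - X \<and> D(c) - [X, c]\<close>.  Hence the generating identity for \<open>(a, c)\<close> implies the one
  for \<open>(a, X \<and> c)\<close>.  Locally every multivector field is a sum of products of sections with a function,
  which reduces the identity to a pair of functions, where it holds for reasons of degree.
\<close>


section \<open>Differentiable maps and bump profiles\<close>

text \<open>\<open>differential\<close> evaluates the Koszul formula on arbitrarily chosen global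
  extensions, which hides that d is tensorial and squares to zero. Both are proved for a recursive
  Cartan calculus on lists of sections over a Lie-Rinehart algebra, and the Koszul formula is then
  recognised as that recursion. The price is that forms must be global, while a representative \<mu>
  lives on an open set: it is cut off by a bump function, and statements about \<open>D\<close> are
  read at a point near which the cut-off form is still a volume. Likewise the axioms of the bracket
  do not mention locality, yet the reduction to products of sections is local; locality is extracted
  from the Leibniz rule. The term D(X) in the formula for D(X \<and> c) is minus the divergence of
  X, as L_X \<mu> = - D(X) \<mu>. The reduction acts on the second argument only. It first settles
  pairs (f, b) with f a function; skew symmetry of the bracket turns these into pairs (a, f), which
  are the base case for arbitrary (a, b).\<close>

lemma frechet_derivative_cong_open:
  assumes "open S" "x \<in> S" "\<And>y. y \<in> S \<Longrightarrow> f y = g y"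
  shows "frechet_derivative f (at x) = frechet_derivative g (at x)"
    and "f differentiable (at x) \<longleftrightarrow> g differentiable (at x)"
proof -
  have "(f has_derivative D) (at x) \<longleftrightarrow> (g has_derivative D) (at x)" for D
    using assms has_derivative_transform_within_open[of f D x UNIV S g]
      has_derivative_transform_within_open[of g D x UNIV S f] by auto
  then show "frechet_derivative f (at x) = frechet_derivative g (at x)"
    and "f differentiable (at x) \<longleftrightarrow> g differentiable (at x)"
    by (auto simp: frechet_derivative_def differentiable_def)
qed

section \<open>Locality and closure properties of \<open>Ck_on\<close>\<close>

lemma Ck_on_cong:
  assumes "open S" "\<And>y. y \<in> S \<Longrightarrow> f y = g y"
  shows "Ck_on k S f \<longleftrightarrow> Ck_on k S g"
  using assms(2)
proof (induction k arbitrary: f g)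
  case 0
  then show ?case by (auto cong: continuous_on_cong)
next
  case (Suc k)
  have *: "Ck_on k S (\<lambda>x. frechet_derivative f (at x) v) \<longleftrightarrow> Ck_on k S (\<lambda>x. frechet_derivative g (at x) v)" for v
    by (rule Suc.IH) (simp add: frechet_derivative_cong_open(1)[OF assms(1) _ Suc.prems])
  show ?case
    using * frechet_derivative_cong_open(2)[OF assms(1) _ Suc.prems] by auto
qed

lemma Ck_on_subset: "Ck_on k S f \<Longrightarrow> T \<subseteq> S \<Longrightarrow> Ck_on k T f"
  by (induction k arbitrary: f) (auto intro: continuous_on_subset)

lemma Ck_on_local:
  assumes "\<And>x. x \<in> S \<Longrightarrow> \<exists>T. open T \<and> x \<in> T \<and> Ck_on k T f"
  shows "Ck_on k S f"
  using assms
proof (induction k arbitrary: f)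
  case 0
  have "isCont f x" if "x \<in> S" for x
    using 0[OF that] continuous_on_eq_continuous_at by fastforce
  then show ?case by (simp add: continuous_at_imp_continuous_on)
next
  case (Suc k)
  show ?case
  proof (simp, intro conjI ballI allI)
    fix x assume "x \<in> S" then show "f differentiable at x" using Suc.prems[of x] by auto
  next
    fix v
    show "Ck_on k S (\<lambda>x. frechet_derivative f (at x) v)"
    proof (rule Suc.IH)
      fix x assume "x \<in> S"
      from Suc.prems[OF this] show "\<exists>T. open T \<and> x \<in> T \<and> Ck_on k T (\<lambda>x. frechet_derivative f (at x) v)"
        by auto
    qed
  qed
qed

lemma Ck_on_Suc_imp: "Ck_on (Suc k) S f \<Longrightarrow> Ck_on k S f"
proof (induction k arbitrary: f)
  case 0
  then show ?case
    by (auto intro!: continuous_at_imp_continuous_on differentiable_imp_continuous_within)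
next
  case (Suc k)
  then show ?case by simp
qed

lemma Ck_on_const: "Ck_on k S (\<lambda>x. c)"
  by (induction k arbitrary: c) simp_all

text \<open>Lets a derivative \<open>D\<close> be supplied explicitly: on an open set it agrees with
  \<open>frechet_derivative\<close>, the one that \<open>Ck_on\<close> mentions.\<close>

lemma Ck_on_SucI:
  assumes "open S" and "\<And>x. x \<in> S \<Longrightarrow> (f has_derivative D x) (at x)"
    and "\<And>v. Ck_on k S (\<lambda>x. D x v)"
  shows "Ck_on (Suc k) S f"
proof -
  have "frechet_derivative f (at x) = D x" if "x \<in> S" for x
    using assms(2)[OF that] by (metis frechet_derivative_at)
  then have "Ck_on k S (\<lambda>x. frechet_derivative f (at x) v)" for v
    using assms(3)[of v] Ck_on_cong[OF assms(1), of "\<lambda>x. frechet_derivative f (at x) v" "\<lambda>x. D x v"] by simp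
  then show ?thesis using assms(2) by (auto simp: differentiable_def)
qed

lemma Ck_on_SucD:
  assumes "Ck_on (Suc k) S f" "x \<in> S"
  shows "(f has_derivative frechet_derivative f (at x)) (at x)"
  using assms by (simp add: frechet_derivative_works)

lemma Ck_on_add:
  fixes f g :: "'b::real_normed_vector \<Rightarrow> 'c::real_normed_vector"
  assumes "open S"
  shows "Ck_on k S f \<Longrightarrow> Ck_on k S g \<Longrightarrow> Ck_on k S (\<lambda>x. f x + g x)"
proof (induction k arbitrary: f g)
  case 0
  then show ?case by (simp add: continuous_on_add)
next
  case (Suc k)
  show ?case
    by (rule Ck_on_SucI[OF assms has_derivative_add[OF Ck_on_SucD Ck_on_SucD]])
      (use Suc in auto)
qed

lemma Ck_on_mult:
  fixes f g :: "'b::real_normed_vector \<Rightarrow> real"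
  assumes "open S"
  shows "Ck_on k S f \<Longrightarrow> Ck_on k S g \<Longrightarrow> Ck_on k S (\<lambda>x. f x * g x)"
proof (induction k arbitrary: f g)
  case 0
  then show ?case by (simp add: continuous_on_mult)
next
  case (Suc k)
  have "Ck_on k S (\<lambda>x. f x * frechet_derivative g (at x) v + frechet_derivative f (at x) v * g x)" for v
    by (rule Ck_on_add[OF assms Suc.IH Suc.IH])
      (use Suc.prems Ck_on_Suc_imp in auto)
  then show ?case
    by (intro Ck_on_SucI[OF assms has_derivative_mult[OF Ck_on_SucD Ck_on_SucD]])
      (use Suc.prems in auto)
qed

text \<open>The derivative - (1/f) f' (1/f) involves 1/f only to the order k that the induction
  already provides.\<close>

lemma Ck_on_inverse:
  fixes f :: "'b::real_normed_vector \<Rightarrow> real"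
  assumes "open S" and nz: "\<And>x. x \<in> S \<Longrightarrow> f x \<noteq> 0"
  shows "Ck_on k S f \<Longrightarrow> Ck_on k S (\<lambda>x. inverse (f x))"
proof (induction k)
  case 0
  then show ?case using nz by (simp add: continuous_on_inverse)
next
  case (Suc k)
  have k: "Ck_on k S (\<lambda>x. inverse (f x))" using Suc Ck_on_Suc_imp by blast
  have "Ck_on k S (\<lambda>x. - 1 * (inverse (f x) * frechet_derivative f (at x) v * inverse (f x)))" for v
    by (intro Ck_on_mult[OF assms(1)] Ck_on_const k) (use Suc.prems in auto)
  then show ?case
    by (intro Ck_on_SucI[OF assms(1) Deriv.has_derivative_inverse[OF _ Ck_on_SucD]])
      (use Suc.prems nz in auto)
qed

lemma Ck_on_inner:
  fixes f :: "'b::real_normed_vector \<Rightarrow> 'c::real_inner"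
  assumes "open S"
  shows "Ck_on k S f \<Longrightarrow> Ck_on k S (\<lambda>x. f x \<bullet> b)"
proof (induction k arbitrary: f)
  case 0
  then show ?case by (auto intro: continuous_intros)
next
  case (Suc k)
  show ?case
    by (rule Ck_on_SucI[OF assms has_derivative_inner_left[OF Ck_on_SucD]])
      (use Suc in auto)
qed

text \<open>The outer function comes with its whole sequence of derivatives, so the chain rule sends
  \<open>h n\<close> to \<open>h (Suc n)\<close> and an induction that is general in n
  closes.\<close>

lemma Ck_on_compose_derivatives:
  fixes f :: "'b::real_normed_vector \<Rightarrow> real" and h :: "nat \<Rightarrow> real \<Rightarrow> real"
  assumes "open S" and h: "\<And>n t. (h n has_real_derivative h (Suc n) t) (at t)"
  shows "Ck_on k S f \<Longrightarrow> Ck_on k S (\<lambda>x. h n (f x))"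
proof (induction k arbitrary: n)
  case 0
  have "continuous_on UNIV (h n)"
    using h by (meson DERIV_isCont continuous_at_imp_continuous_on)
  then show ?case using 0 by (auto intro: continuous_on_compose2)
next
  case (Suc k)
  have d: "((\<lambda>x. h n (f x)) has_derivative (\<lambda>v. frechet_derivative f (at x) v * h (Suc n) (f x))) (at x)"
    if "x \<in> S" for x
  proof -
    have "(h n has_derivative (\<lambda>u. u * h (Suc n) (f x))) (at (f x))"
      using h[of n "f x"] by (simp add: has_field_derivative_def mult_commute_abs)
    from has_derivative_compose[OF Ck_on_SucD[OF Suc.prems that] this] show ?thesis .
  qed
  have "Ck_on k S (\<lambda>x. h (Suc n) (f x))" using Suc Ck_on_Suc_imp by blast
  then show ?case
    by (intro Ck_on_SucI[OF assms(1) d] Ck_on_mult[OF assms(1)]) (use Suc.prems in auto)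
qed

section \<open>Functions that are flat at zero\<close>

definition flat_exp :: "real poly \<Rightarrow> real \<Rightarrow> real" where
  "flat_exp p t = (if t > 0 then poly p (inverse t) * exp (- inverse t) else 0)"

lemma poly_times_exp_neg_tendsto_0: "((\<lambda>u. poly p u * exp (- u)) \<longlongrightarrow> 0) (at_top :: real filter)"
proof -
  have *: "((\<lambda>u::real. coeff p i * (u ^ i / exp u)) \<longlongrightarrow> coeff p i * 0) at_top" for i
    by (intro tendsto_mult tendsto_const tendsto_power_div_exp_0)
  have "((\<lambda>u. \<Sum>i\<le>degree p. coeff p i * (u ^ i / exp u)) \<longlongrightarrow> (\<Sum>i\<le>degree p. coeff p i * 0)) at_top"
    by (intro tendsto_sum *)
  moreover have "(\<Sum>i\<le>degree p. coeff p i * (u ^ i / exp u)) = poly p u * exp (- u)" for u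
    by (simp add: poly_altdef sum_distrib_right exp_minus divide_inverse mult.assoc)
  ultimately show ?thesis by simp
qed

lemma flat_exp_tendsto_0: "(flat_exp p \<longlongrightarrow> 0) (at 0)"
proof (rule filterlim_split_at)
  show "(flat_exp p \<longlongrightarrow> 0) (at_left 0)"
    by (rule tendsto_eventually) (auto simp: flat_exp_def eventually_at_filter)
  have "((\<lambda>t. poly p (inverse t) * exp (- inverse t)) \<longlongrightarrow> 0) (at_right (0::real))"
    by (rule filterlim_compose[OF poly_times_exp_neg_tendsto_0 filterlim_inverse_at_top_right])
  then show "(flat_exp p \<longlongrightarrow> 0) (at_right 0)"
    by (rule Lim_transform_eventually) (auto simp: flat_exp_def eventually_at_filter)
qed

text \<open>For t > 0 the derivative of p(1/t) exp(-1/t) is t^-2 (p - p')(1/t) exp(-1/t). So the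
  family \<open>flat_exp\<close> is closed under differentiation, through p \<mapsto> X^2 (p -
  p').\<close>

lemma has_real_derivative_flat_exp:
  "(flat_exp p has_real_derivative flat_exp ([:0, 0, 1:] * (p - pderiv p)) t) (at t)"
proof (cases t "0::real" rule: linorder_cases)
  case less
  have "((\<lambda>t. 0) has_real_derivative 0) (at t)" by simp
  then have "(flat_exp p has_real_derivative 0) (at t)"
    by (rule DERIV_cong_ev[THEN iffD1, rotated -1])
      (use less in \<open>auto simp: flat_exp_def eventually_nhds intro!: exI[of _ "{..<0}"]\<close>)
  with less show ?thesis by (simp add: flat_exp_def)
next
  case greater
  have "((\<lambda>t. poly p (inverse t) * exp (- inverse t)) has_real_derivative
     poly ([:0, 0, 1:] * (p - pderiv p)) (inverse t) * exp (- inverse t)) (at t)"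
    using greater
    by (auto intro!: derivative_eq_intros DERIV_chain2[OF poly_DERIV] simp: field_simps power2_eq_square)
  then have "(flat_exp p has_real_derivative
     poly ([:0, 0, 1:] * (p - pderiv p)) (inverse t) * exp (- inverse t)) (at t)"
    by (rule DERIV_cong_ev[THEN iffD1, rotated -1])
      (use greater in \<open>auto simp: flat_exp_def eventually_nhds intro!: exI[of _ "{0<..}"]\<close>)
  with greater show ?thesis by (simp add: flat_exp_def)
next
  case equal
  have "((\<lambda>h. (flat_exp p (0 + h) - flat_exp p 0) / h) \<longlongrightarrow> 0) (at 0)"
  proof -
    \<comment> \<open>The difference quotient at 0 is again a member of the family, for the
      polynomial X p, and all members tend to 0.\<close>
    have "(flat_exp p (0 + h) - flat_exp p 0) / h = flat_exp ([:0, 1:] * p) h" for h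
      by (simp add: flat_exp_def divide_inverse)
    then show ?thesis using flat_exp_tendsto_0[of "[:0, 1:] * p"] by simp
  qed
  then show ?thesis using equal by (simp add: DERIV_def flat_exp_def)
qed

lemma Ck_on_flat_exp:
  fixes f :: "'b::real_normed_vector \<Rightarrow> real"
  assumes "open S" "Ck_on k S f"
  shows "Ck_on k S (\<lambda>x. flat_exp p (f x))"
proof -
  define h where "h n = flat_exp (((\<lambda>p. [:0, 0, 1:] * (p - pderiv p)) ^^ n) p)" for n
  have "(h n has_real_derivative h (Suc n) t) (at t)" for n t
    unfolding h_def using has_real_derivative_flat_exp by simp
  from Ck_on_compose_derivatives[where h = h and n = 0, OF assms(1) this assms(2)] show ?thesis
    by (simp add: h_def)
qed

section \<open>Orthonormal bases and compact balls of the model space\<close>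

lemma finite_orthonormal_spanning:
  fixes B :: "'b::real_inner set"
  assumes "finite B"
  shows "\<exists>C. finite C \<and> span C = span B \<and> (\<forall>b\<in>C. \<forall>c\<in>C. b \<bullet> c = (if b = c then 1 else 0))"
  using assms
proof (induction B)
  case empty
  show ?case by (intro exI[of _ "{}"]) simp
next
  case (insert a B)
  then obtain C where C: "finite C" "span C = span B" "\<And>b c. b \<in> C \<Longrightarrow> c \<in> C \<Longrightarrow> b \<bullet> c = (if b = c then 1 else 0)"
    by blast
  \<comment> \<open>Gram-Schmidt: \<open>p\<close> is the orthogonal projection of the new vector to
    the span of \<open>C\<close>. If it differs from \<open>a\<close>, the normalised residual is
    adjoined.\<close>
  define p where "p = (\<Sum>b\<in>C. (a \<bullet> b) *\<^sub>R b)"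
  have p: "p \<in> span C" unfolding p_def by (intro span_sum span_scale span_base)
  have o: "(a - p) \<bullet> c = 0" if "c \<in> C" for c
  proof -
    have "p \<bullet> c = (\<Sum>b\<in>C. if b = c then a \<bullet> c else 0)"
      unfolding p_def inner_sum_left using C(3) that by (intro sum.cong) auto
    also have "\<dots> = a \<bullet> c" using C(1) that by simp
    finally show ?thesis by (simp add: inner_diff_left)
  qed
  show ?case
  proof (cases "a = p")
    case True
    then have "span (insert a B) = span B" using p C(2) by (simp add: span_redundant)
    with C show ?thesis by metis
  next
    case False
    define u where "u = (1 / norm (a - p)) *\<^sub>R (a - p)"
    have n: "norm (a - p) \<noteq> 0" using False by simp
    have uu: "u \<bullet> u = 1" using n by (simp add: u_def dot_square_norm power2_eq_square)
    have uc: "u \<bullet> c = 0" "c \<bullet> u = 0" if "c \<in> C" for c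
      using o[OF that] by (simp_all add: u_def inner_commute[of c])
    have "u \<notin> C" using uu uc(1) by fastforce
    have a: "a = norm (a - p) *\<^sub>R u + p" using n by (simp add: u_def)
    have "span (insert u C) = span (insert a B)"
    proof (rule span_eq[THEN iffD2], intro conjI subsetI)
      fix x assume x: "x \<in> insert u C"
      have "C \<subseteq> span (insert a B)" "p \<in> span (insert a B)"
        using p C(2) span_superset[of C] span_mono[of B "insert a B"] by blast+
      moreover have "a \<in> span (insert a B)" by (simp add: span_base)
      ultimately show "x \<in> span (insert a B)"
        using x unfolding u_def by (auto intro: span_diff span_scale)
    next
      fix x assume x: "x \<in> insert a B"
      have "B \<subseteq> span (insert u C)" "p \<in> span (insert u C)"
        using p C(2) span_superset[of B] span_mono[of C "insert u C"] by blast+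
      moreover have "u \<in> span (insert u C)" by (simp add: span_base)
      ultimately show "x \<in> span (insert u C)"
        using x a by (auto intro: span_add span_scale) (metis span_add span_scale)
    qed
    then show ?thesis
      using C uu uc \<open>u \<notin> C\<close> by (intro exI[of _ "insert u C"]) auto
  qed
qed

lemma orthonormal_expansion:
  fixes C :: "'b::real_inner set"
  assumes "finite C" "x \<in> span C" "\<forall>b\<in>C. \<forall>c\<in>C. b \<bullet> c = (if b = c then 1 else 0)"
  shows "x = (\<Sum>b\<in>C. (x \<bullet> b) *\<^sub>R b)"
proof -
  from assms(1,2) obtain u where u: "x = (\<Sum>b\<in>C. u b *\<^sub>R b)"
    by (auto simp: span_finite)
  have "x \<bullet> c = u c" if "c \<in> C" for c
  proof -
    have "x \<bullet> c = (\<Sum>b\<in>C. if b = c then u c else 0)"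
      unfolding u inner_sum_left using assms(3) that by (intro sum.cong) auto
    also have "\<dots> = u c" using assms(1) that by simp
    finally show ?thesis .
  qed
  then show ?thesis by (simp add: u cong: sum.cong)
qed

text \<open>The type class of the model space carries no Heine-Borel property. Finite sums of
  compact segments are compact, and by Cauchy-Schwarz a ball about 0 is a closed subset of such a
  box in orthonormal coordinates.\<close>

lemma compact_cball_finite_dim:
  fixes p :: "'b::real_inner" and C :: "'b set"
  assumes "finite C" "span C = UNIV" "\<forall>b\<in>C. \<forall>c\<in>C. b \<bullet> c = (if b = c then 1 else (0::real))"
  shows "compact (cball p R)"
proof -
  have *: "finite D \<Longrightarrow> compact {\<Sum>b\<in>D. c b *\<^sub>R b | c. \<forall>b\<in>D. c b \<in> {- R..R}}" for D :: "'b set"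
  proof (induction D rule: finite_induct)
    case empty
    then show ?case by simp
  next
    case (insert a D)
    have "compact ((\<lambda>t. t *\<^sub>R a) ` {- R..R})"
      by (intro compact_continuous_image continuous_intros) simp
    from compact_sums[OF this insert.IH]
    have 1: "compact {x + y |x y. x \<in> (\<lambda>t. t *\<^sub>R a) ` {- R..R} \<and> y \<in> {\<Sum>b\<in>D. c b *\<^sub>R b | c. \<forall>b\<in>D. c b \<in> {- R..R}}}" .
    have "{x + y |x y. x \<in> (\<lambda>t. t *\<^sub>R a) ` {- R..R} \<and> y \<in> {\<Sum>b\<in>D. c b *\<^sub>R b | c. \<forall>b\<in>D. c b \<in> {- R..R}}}
      = {\<Sum>b\<in>insert a D. c b *\<^sub>R b | c. \<forall>b\<in>insert a D. c b \<in> {- R..R}}" (is "?L = ?R")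
    proof (intro equalityI subsetI)
      fix z assume "z \<in> ?L"
      then obtain t c where tc: "z = t *\<^sub>R a + (\<Sum>b\<in>D. c b *\<^sub>R b)" "t \<in> {-R..R}" "\<forall>b\<in>D. c b \<in> {- R..R}"
        by blast
      have "(\<Sum>b\<in>D. (c(a := t)) b *\<^sub>R b) = (\<Sum>b\<in>D. c b *\<^sub>R b)"
        using insert.hyps by (intro sum.cong) auto
      with tc insert.hyps have "z = (\<Sum>b\<in>insert a D. (c(a := t)) b *\<^sub>R b)" "\<forall>b\<in>insert a D. (c(a := t)) b \<in> {- R..R}"
        by auto
      then show "z \<in> ?R" by blast
    next
      fix z assume "z \<in> ?R"
      then obtain c where c: "z = (\<Sum>b\<in>insert a D. c b *\<^sub>R b)" "\<forall>b\<in>insert a D. c b \<in> {- R..R}" by blast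
      then have "z = c a *\<^sub>R a + (\<Sum>b\<in>D. c b *\<^sub>R b)" using insert.hyps by simp
      moreover have "c a *\<^sub>R a \<in> (\<lambda>t. t *\<^sub>R a) ` {- R..R}" using c by blast
      ultimately show "z \<in> ?L" using c(2) by blast
    qed
    with 1 show ?case by simp
  qed
  have n: "norm b = 1" if "b \<in> C" for b using assms(3) that by (simp add: norm_eq_1)
  have "cball 0 R \<subseteq> {\<Sum>b\<in>C. c b *\<^sub>R b | c. \<forall>b\<in>C. c b \<in> {- R..R}}"
  proof
    fix x :: 'b assume x: "x \<in> cball 0 R"
    have "x \<bullet> b \<in> {- R..R}" if "b \<in> C" for b
    proof -
      have "\<bar>x \<bullet> b\<bar> \<le> norm x * norm b" by (rule Cauchy_Schwarz_ineq2)
      with x n[OF that] show ?thesis by (auto simp: abs_le_iff)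
    qed
    moreover have "x = (\<Sum>b\<in>C. (x \<bullet> b) *\<^sub>R b)"
      using orthonormal_expansion[OF assms(1) _ assms(3)] assms(2) by blast
    ultimately show "x \<in> {\<Sum>b\<in>C. c b *\<^sub>R b | c. \<forall>b\<in>C. c b \<in> {- R..R}}" by blast
  qed
  then have "compact (cball (0::'b) R)"
    using compact_Int_closed[OF *[OF assms(1)] closed_cball[of 0 R]] by (simp add: Int_absorb1 inf.absorb2)
  from compact_translation[OF this, of p] show ?thesis
    by (simp add: cball_translation)
qed


section \<open>Alternating forms\<close>

text \<open>The interior product i_v. Together with \<open>par\<close> it turns identities between
  forms into inductions on the argument list.\<close>

definition hook :: "'v \<Rightarrow> ('v list \<Rightarrow> real) \<Rightarrow> 'v list \<Rightarrow> real" where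
  "hook v \<omega> = (\<lambda>vs. \<omega> (v # vs))"

text \<open>The grading involution, (-1)^k in degree k. It carries the signs, so that inhomogeneous
  forms can be treated directly.\<close>

definition par :: "('v list \<Rightarrow> real) \<Rightarrow> 'v list \<Rightarrow> real" where
  "par \<omega> = (\<lambda>vs. (-1) ^ length vs * \<omega> vs)"

definition scalar_form :: "real \<Rightarrow> 'v list \<Rightarrow> real" where
  "scalar_form c = (\<lambda>vs. if vs = [] then c else 0)"

lemma scaleR_fun_apply [simp]: "(c *\<^sub>R f) x = c *\<^sub>R f x"
  by (simp add: scaleR_fun_def)

lemma hook_apply: "hook v \<omega> vs = \<omega> (v # vs)"
  by (simp add: hook_def)

lemma par_apply: "par \<omega> vs = (-1) ^ length vs * \<omega> vs"
  by (simp add: par_def)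

lemma hook_linear [simp]:
  "hook v (\<omega> + \<eta>) = hook v \<omega> + hook v \<eta>" "hook v (c *\<^sub>R \<omega>) = c *\<^sub>R hook v \<omega>"
  "hook v (- \<omega>) = - hook v \<omega>" "hook v 0 = 0" "hook v (\<omega> - \<eta>) = hook v \<omega> - hook v \<eta>"
  by (auto simp: hook_def scaleR_fun_def)

lemma par_linear [simp]:
  "par (\<omega> + \<eta>) = par \<omega> + par \<eta>" "par (c *\<^sub>R \<omega>) = c *\<^sub>R par \<omega>" "par (- \<omega>) = - par \<omega>" "par 0 = 0"
  by (auto simp: par_def scaleR_fun_def algebra_simps)

lemma par_par [simp]: "par (par \<omega>) = \<omega>"
  by (auto simp: par_def fun_eq_iff simp flip: mult.assoc power_add mult_2)

lemma hook_par: "hook v (par \<omega>) = - par (hook v \<omega>)"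
  by (auto simp: par_def hook_def)

lemma hook_scalar_form [simp]: "hook v (scalar_form c) = 0"
  by (auto simp: hook_def scalar_form_def)

lemma par_scalar_form [simp]: "par (scalar_form c) = scalar_form c"
  by (auto simp: par_def scalar_form_def)


section \<open>The wedge product by recursion on the arguments\<close>

lemma sum_Pow_Suc:
  "(\<Sum>I\<in>Pow {..<Suc n}. g I) = (\<Sum>I\<in>Pow {..<n}. g (Suc ` I) + g (insert 0 (Suc ` I)))"
  for g :: "nat set \<Rightarrow> 'a::comm_monoid_add"
proof -
  have "Pow {..<Suc n} = image Suc ` Pow {..<n} \<union> (\<lambda>I. insert 0 (Suc ` I)) ` Pow {..<n}"
    unfolding lessThan_Suc_eq_insert_0 Pow_insert image_Pow_surj[OF refl, symmetric] by (auto simp: image_image)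
  moreover have "image Suc ` Pow {..<n} \<inter> (\<lambda>I. insert 0 (Suc ` I)) ` Pow {..<n} = {}" by auto
  moreover have "inj_on (image Suc) (Pow {..<n})" by (simp add: inj_on_def inj_image_eq_iff)
  moreover have "inj_on (\<lambda>I. insert 0 (Suc ` I)) (Pow {..<n})"
    by (rule inj_onI) (metis Suc_inject Zero_not_Suc image_iff inj_Suc inj_image_eq_iff insert_ident)
  ultimately show ?thesis
    by (simp add: sum.union_disjoint sum.reindex sum.distrib)
qed

lemma nths_Cons_Suc [simp]:
  "nths (x # xs) (Suc ` I) = nths xs I" "nths (x # xs) (insert 0 (Suc ` I)) = x # nths xs I"
  "nths (x # xs) (- (Suc ` I)) = x # nths xs (- I)" "nths (x # xs) (- insert 0 (Suc ` I)) = nths xs (- I)"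
  by (simp_all add: nths_Cons inj_image_mem_iff Compl_eq)

lemma wedge_Nil [simp]: "wedge \<alpha> \<beta> [] = \<alpha> [] * \<beta> []"
  by (simp add: wedge_def)

text \<open>Insertion is a graded derivation: the first argument goes to the first factor, or past
  it to the second at the cost of the sign of \<alpha>. This recursion replaces the shuffle sum in
  most of the later proofs.\<close>

lemma wedge_Cons: "wedge \<alpha> \<beta> (v # vs) = wedge (hook v \<alpha>) \<beta> vs + wedge (par \<alpha>) (hook v \<beta>) vs"
proof -
  define c where "c I = card {(i, j). i \<in> I \<and> j \<notin> I \<and> j < i}" for I :: "nat set"
  \<comment> \<open>If position 0 goes to the first factor it creates no inversion, since nothing
    precedes it.\<close>
  have c1: "c (insert 0 (Suc ` I)) = c I" for I
  proof -
    have "{(i, j). i \<in> insert 0 (Suc ` I) \<and> j \<notin> insert 0 (Suc ` I) \<and> j < i} = map_prod Suc Suc ` {(i, j). i \<in> I \<and> j \<notin> I \<and> j < i}"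
    proof (intro equalityI subsetI)
      fix p assume p: "p \<in> {(i, j). i \<in> insert 0 (Suc ` I) \<and> j \<notin> insert 0 (Suc ` I) \<and> j < i}"
      then obtain i j where ij: "p = (Suc i, j)" "i \<in> I" "j \<noteq> 0" "j \<notin> Suc ` I" "j < Suc i" by auto
      then obtain j' where "j = Suc j'" by (cases j) auto
      with ij show "p \<in> map_prod Suc Suc ` {(i, j). i \<in> I \<and> j \<notin> I \<and> j < i}"
        by (auto intro!: image_eqI[of _ _ "(i, j')"])
    qed auto
    then show ?thesis by (simp add: c_def card_image inj_on_def)
  qed
  \<comment> \<open>If position 0 goes to the second factor, each element of \<open>I\<close> gains
    exactly one inversion, namely with 0; this is the sign in \<open>par \<alpha>\<close>.\<close>
  have c2: "c (Suc ` I) = c I + card I" if "finite I" for I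
  proof -
    have e: "{(i, j). i \<in> Suc ` I \<and> j \<notin> Suc ` I \<and> j < i} =
      map_prod Suc Suc ` {(i, j). i \<in> I \<and> j \<notin> I \<and> j < i} \<union> (\<lambda>i. (Suc i, 0)) ` I" (is "?L = ?A \<union> ?B")
    proof (intro equalityI subsetI)
      fix p assume p: "p \<in> ?L"
      then obtain i j where ij: "p = (Suc i, j)" "i \<in> I" "j \<notin> Suc ` I" "j < Suc i" by auto
      then show "p \<in> ?A \<union> ?B"
        by (cases j) (auto intro!: image_eqI[of _ _ "(i, j - 1)"])
    qed auto
    have "{(i, j). i \<in> I \<and> j \<notin> I \<and> j < i} \<subseteq> (SIGMA i:I. {..<i})" by auto
    then have "finite {(i, j). i \<in> I \<and> j \<notin> I \<and> j < i}" using that by (auto intro: finite_subset)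
    then have "card (?A \<union> ?B) = card ?A + card ?B" using that by (intro card_Un_disjoint) auto
    then show ?thesis unfolding c_def e by (simp add: card_image inj_on_def)
  qed
  have len: "length (nths vs I) = card I" if "I \<in> Pow {..<length vs}" for I
  proof -
    have "{i. i < length vs \<and> i \<in> I} = I" using that by auto
    then show ?thesis by (simp add: length_nths)
  qed
  have fin: "finite I" if "I \<in> Pow {..<length vs}" for I using that by (auto intro: finite_subset)
  have "wedge \<alpha> \<beta> (v # vs) = (\<Sum>I\<in>Pow {..<Suc (length vs)}. (-1) ^ c I * \<alpha> (nths (v # vs) I) * \<beta> (nths (v # vs) (- I)))"
    by (simp add: wedge_def c_def)
  also have "\<dots> = (\<Sum>I\<in>Pow {..<length vs}. (-1) ^ c I * par \<alpha> (nths vs I) * hook v \<beta> (nths vs (- I))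
      + (-1) ^ c I * hook v \<alpha> (nths vs I) * \<beta> (nths vs (- I)))"
    unfolding sum_Pow_Suc
    by (intro sum.cong refl) (simp add: c1 c2 fin len power_add hook_def par_def mult_ac)
  finally show ?thesis
    by (simp add: wedge_def c_def sum.distrib add.commute)
qed

lemma hook_wedge: "hook v (wedge \<alpha> \<beta>) = wedge (hook v \<alpha>) \<beta> + wedge (par \<alpha>) (hook v \<beta>)"
  by (simp add: fun_eq_iff hook_apply wedge_Cons)

lemma wedge_linear [simp]:
  "wedge (\<alpha> + \<alpha>') \<beta> = wedge \<alpha> \<beta> + wedge \<alpha>' \<beta>" "wedge \<alpha> (\<beta> + \<beta>') = wedge \<alpha> \<beta> + wedge \<alpha> \<beta>'"
  "wedge (c *\<^sub>R \<alpha>) \<beta> = c *\<^sub>R wedge \<alpha> \<beta>" "wedge \<alpha> (c *\<^sub>R \<beta>) = c *\<^sub>R wedge \<alpha> \<beta>"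
  "wedge (- \<alpha>) \<beta> = - wedge \<alpha> \<beta>" "wedge \<alpha> (- \<beta>) = - wedge \<alpha> \<beta>"
  "wedge 0 \<beta> = 0" "wedge \<alpha> 0 = 0"
  "wedge (\<alpha> - \<alpha>') \<beta> = wedge \<alpha> \<beta> - wedge \<alpha>' \<beta>" "wedge \<alpha> (\<beta> - \<beta>') = wedge \<alpha> \<beta> - wedge \<alpha> \<beta>'"
  by (auto simp: fun_eq_iff wedge_def scaleR_fun_def algebra_simps sum.distrib sum_distrib_left sum_negf sum_subtractf)

lemma wedge_scalar_left [simp]: "wedge (scalar_form c) \<beta> = c *\<^sub>R \<beta>"
proof
  fix vs show "wedge (scalar_form c) \<beta> vs = (c *\<^sub>R \<beta>) vs"
    by (induction vs arbitrary: \<beta>) (auto simp: wedge_Cons scaleR_fun_def hook_apply, simp add: scalar_form_def)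
qed

lemma wedge_scalar_right [simp]: "wedge \<beta> (scalar_form c) = c *\<^sub>R \<beta>"
proof
  fix vs show "wedge \<beta> (scalar_form c) vs = (c *\<^sub>R \<beta>) vs"
    by (induction vs arbitrary: \<beta>) (auto simp: wedge_Cons scaleR_fun_def hook_apply, simp add: scalar_form_def)
qed

lemma par_wedge: "par (wedge \<alpha> \<beta>) = wedge (par \<alpha>) (par \<beta>)"
proof
  fix vs show "par (wedge \<alpha> \<beta>) vs = wedge (par \<alpha>) (par \<beta>) vs"
  proof (induction vs arbitrary: \<alpha> \<beta>)
    case (Cons v vs)
    have "par (wedge \<alpha> \<beta>) (v # vs) = - par (wedge (hook v \<alpha>) \<beta>) vs - par (wedge (par \<alpha>) (hook v \<beta>)) vs"
      by (simp add: par_apply wedge_Cons algebra_simps)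
    then show ?case by (simp add: Cons.IH wedge_Cons hook_par)
  qed (simp add: par_apply)
qed

lemma wedge_assoc: "wedge (wedge \<alpha> \<beta>) \<gamma> = wedge \<alpha> (wedge \<beta> \<gamma>)"
proof
  fix vs show "wedge (wedge \<alpha> \<beta>) \<gamma> vs = wedge \<alpha> (wedge \<beta> \<gamma>) vs"
    by (induction vs arbitrary: \<alpha> \<beta> \<gamma>) (simp_all add: wedge_Cons hook_wedge par_wedge)
qed

text \<open>Inserting a vector into \<alpha> leaves a scalar, so the induction on the arguments only
  ever changes \<beta>.\<close>

lemma wedge_degree_1_commute:
  assumes "\<And>vs. length vs \<noteq> 1 \<Longrightarrow> \<alpha> vs = 0"
  shows "wedge \<beta> \<alpha> = wedge \<alpha> (par \<beta>)"
proof
  have h: "hook v \<alpha> = scalar_form (\<alpha> [v])" for v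
    using assms by (auto simp: hook_def scalar_form_def fun_eq_iff)
  have p: "par \<alpha> = - \<alpha>"
  proof
    fix vs show "par \<alpha> vs = (- \<alpha>) vs" using assms[of vs] by (cases "length vs = 1") (auto simp: par_def)
  qed
  fix vs show "wedge \<beta> \<alpha> vs = wedge \<alpha> (par \<beta>) vs"
    by (induction vs arbitrary: \<beta>) (simp_all add: assms wedge_Cons h p hook_par)
qed


section \<open>Alternation, and determination by values on a spanning list\<close>

lemma alt_formsD:
  assumes "\<omega> \<in> alt_forms F"
  shows "\<not> set vs \<subseteq> F \<Longrightarrow> \<omega> vs = 0"
    and "set us \<subseteq> F \<Longrightarrow> set ws \<subseteq> F \<Longrightarrow> u \<in> F \<Longrightarrow> v \<in> F \<Longrightarrow> \<omega> (us @ (u + v) # ws) = \<omega> (us @ u # ws) + \<omega> (us @ v # ws)"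
    and "set us \<subseteq> F \<Longrightarrow> set ws \<subseteq> F \<Longrightarrow> v \<in> F \<Longrightarrow> \<omega> (us @ (c *\<^sub>R v) # ws) = c * \<omega> (us @ v # ws)"
    and "\<not> distinct vs \<Longrightarrow> \<omega> vs = 0"
  using assms unfolding alt_forms_def by blast+

text \<open>Polarisation: expand on the equal neighbours u + v, u + v. The assumptions are bare
  properties of \<omega> so that it applies before \<omega> is known to lie in
  \<open>alt_forms\<close>.\<close>

lemma adjacent_swap:
  assumes add: "\<And>us u v ws. set us \<subseteq> F \<Longrightarrow> set ws \<subseteq> F \<Longrightarrow> u \<in> F \<Longrightarrow> v \<in> F \<Longrightarrow> \<omega> (us @ (u + v) # ws) = \<omega> (us @ u # ws) + \<omega> (us @ v # ws)"
    and adj: "\<And>us v ws. set us \<subseteq> F \<Longrightarrow> set ws \<subseteq> F \<Longrightarrow> v \<in> F \<Longrightarrow> \<omega> (us @ v # v # ws) = 0"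
    and F: "\<And>u v. u \<in> F \<Longrightarrow> v \<in> F \<Longrightarrow> u + v \<in> F"
    and m: "set us \<subseteq> F" "set ws \<subseteq> F" "u \<in> F" "v \<in> F"
  shows "\<omega> (us @ u # v # ws) = - (\<omega> (us @ v # u # ws) :: 'c::ab_group_add)"
proof -
  have "0 = \<omega> (us @ (u + v) # (u + v) # ws)" using adj F m by simp
  also have "\<dots> = \<omega> (us @ u # (u + v) # ws) + \<omega> (us @ v # (u + v) # ws)"
    using F m by (intro add) auto
  also have "\<omega> (us @ u # (u + v) # ws) = \<omega> (us @ u # u # ws) + \<omega> (us @ u # v # ws)"
    using add[of "us @ [u]" ws u v] m by simp
  also have "\<omega> (us @ v # (u + v) # ws) = \<omega> (us @ v # u # ws) + \<omega> (us @ v # v # ws)"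
    using add[of "us @ [v]" ws u v] m by simp
  finally show ?thesis using adj m by (simp add: eq_neg_iff_add_eq_0)
qed

text \<open>Equal arguments at a distance are brought together by adjacent swaps, so alternation has
  to be checked on neighbours only.\<close>

lemma alt_formsI:
  assumes "subspace F"
    and off: "\<And>vs. \<not> set vs \<subseteq> F \<Longrightarrow> \<omega> vs = 0"
    and add: "\<And>us u v ws. set us \<subseteq> F \<Longrightarrow> set ws \<subseteq> F \<Longrightarrow> u \<in> F \<Longrightarrow> v \<in> F \<Longrightarrow> \<omega> (us @ (u + v) # ws) = \<omega> (us @ u # ws) + \<omega> (us @ v # ws)"
    and scale: "\<And>us v ws c. set us \<subseteq> F \<Longrightarrow> set ws \<subseteq> F \<Longrightarrow> v \<in> F \<Longrightarrow> \<omega> (us @ (c *\<^sub>R v) # ws) = c * \<omega> (us @ v # ws)"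
    and adj: "\<And>us v ws. set us \<subseteq> F \<Longrightarrow> set ws \<subseteq> F \<Longrightarrow> v \<in> F \<Longrightarrow> \<omega> (us @ v # v # ws) = 0"
  shows "\<omega> \<in> alt_forms F"
proof -
  have F: "u \<in> F \<Longrightarrow> v \<in> F \<Longrightarrow> u + v \<in> F" for u v using assms(1) by (simp add: subspace_add)
  have z: "\<omega> (xs @ y # ys @ y # zs) = 0" if "set xs \<subseteq> F" "set ys \<subseteq> F" "set zs \<subseteq> F" "y \<in> F" for xs y ys zs
    using that
  proof (induction ys arbitrary: xs)
    case (Cons z ys)
    have "\<omega> (xs @ y # z # (ys @ y # zs)) = - \<omega> (xs @ z # y # (ys @ y # zs))"
      using Cons.prems by (intro adjacent_swap[where F = F]) (use add adj F in auto)
    also have "\<omega> (xs @ z # y # (ys @ y # zs)) = 0" using Cons.IH[of "xs @ [z]"] Cons.prems by simp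
    finally show ?case by simp
  qed (use adj in simp)
  have "\<omega> vs = 0" if "set vs \<subseteq> F" "\<not> distinct vs" for vs
  proof -
    from not_distinct_decomp[OF that(2)] obtain xs ys zs y where "vs = xs @ [y] @ ys @ [y] @ zs" by blast
    then show ?thesis using z[of xs ys zs y] that(1) by simp
  qed
  then show ?thesis using off add scale unfolding alt_forms_def by blast
qed

lemma hook_alt_forms:
  assumes "\<omega> \<in> alt_forms F" "v \<in> F"
  shows "hook v \<omega> \<in> alt_forms F"
  unfolding alt_forms_def hook_def mem_Collect_eq
  using alt_formsD(1,4)[OF assms(1), of "v # _"] assms(2)
    alt_formsD(2,3)[OF assms(1), of "v # _"]
  by (intro conjI allI ballI impI) (simp_all)

lemma alt_forms_lin:
  "\<omega> \<in> alt_forms F \<Longrightarrow> \<eta> \<in> alt_forms F \<Longrightarrow> \<omega> + \<eta> \<in> alt_forms F"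
  "\<omega> \<in> alt_forms F \<Longrightarrow> c *\<^sub>R \<omega> \<in> alt_forms F" "0 \<in> alt_forms F"
  by (auto simp: alt_forms_def scaleR_fun_def algebra_simps)

lemma subspace_alt_forms: "subspace (alt_forms F)"
  by (auto simp: subspace_def intro: alt_forms_lin)

lemma par_alt_forms: "\<omega> \<in> alt_forms F \<Longrightarrow> par \<omega> \<in> alt_forms F"
  by (auto simp: alt_forms_def par_def algebra_simps)

lemma hook_vec_linear:
  assumes "\<omega> \<in> alt_forms F" "u \<in> F" "v \<in> F" "subspace F"
  shows "hook (u + v) \<omega> = hook u \<omega> + hook v \<omega>" "hook (c *\<^sub>R v) \<omega> = c *\<^sub>R hook v \<omega>"
    "hook v (hook v \<omega>) = 0" "hook u (hook v \<omega>) = - hook v (hook u \<omega>)"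
proof -
  have *: "u + v \<in> F" "c *\<^sub>R v \<in> F" using assms by (auto intro: subspace_add subspace_scale)
  show "hook (u + v) \<omega> = hook u \<omega> + hook v \<omega>"
  proof
    fix vs show "hook (u + v) \<omega> vs = (hook u \<omega> + hook v \<omega>) vs"
      using alt_formsD(1)[OF assms(1)] alt_formsD(2)[OF assms(1), of "[]" vs u v] assms(2,3) *
      by (cases "set vs \<subseteq> F") (auto simp: hook_def)
  qed
  show "hook (c *\<^sub>R v) \<omega> = c *\<^sub>R hook v \<omega>"
  proof
    fix vs show "hook (c *\<^sub>R v) \<omega> vs = (c *\<^sub>R hook v \<omega>) vs"
      using alt_formsD(1)[OF assms(1)] alt_formsD(3)[OF assms(1), of "[]" vs v c] assms(2,3) *
      by (cases "set vs \<subseteq> F") (auto simp: hook_def scaleR_fun_def)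
  qed
  show "hook v (hook v \<omega>) = 0"
    using alt_formsD(4)[OF assms(1)] by (auto simp: hook_def)
  show "hook u (hook v \<omega>) = - hook v (hook u \<omega>)"
  proof
    fix vs show "hook u (hook v \<omega>) vs = (- hook v (hook u \<omega>)) vs"
    proof (cases "set vs \<subseteq> F")
      case True
      have "\<omega> ([] @ v # u # vs) = - \<omega> ([] @ u # v # vs)"
        using alt_formsD[OF assms(1)] assms(2,3) True
        by (intro adjacent_swap[where F = F] subspace_add[OF assms(4)]) auto
      then show ?thesis by (simp add: hook_def)
    next
      case False
      then show ?thesis using alt_formsD(1)[OF assms(1)] by (auto simp: hook_def)
    qed
  qed
qed

lemma alt_move:
  assumes "\<omega> \<in> alt_forms F" "subspace F" "set us \<subseteq> F" "v \<in> F"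
  shows "\<omega> (us @ v # ws) = (-1) ^ length us * \<omega> (v # us @ ws)"
  using assms
proof (induction us arbitrary: \<omega>)
  case (Cons u us)
  have "\<omega> (u # us @ v # ws) = hook u \<omega> (us @ v # ws)" by (simp add: hook_def)
  also have "\<dots> = (-1) ^ length us * hook v (hook u \<omega>) (us @ ws)"
    using Cons.IH[OF hook_alt_forms[of \<omega> F u]] Cons.prems by (simp add: hook_apply)
  also have "hook v (hook u \<omega>) = - hook u (hook v \<omega>)"
    by (rule hook_vec_linear(4)) (use Cons.prems in auto)
  finally show ?case by (simp add: hook_apply)
qed simp

text \<open>With the prefix \<open>us\<close> peeled off by \<open>wedge_Cons\<close>, each property
  reduces to the corresponding rule for \<open>hook\<close> at the distinguished slot.\<close>

lemma wedge_alt_forms: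
  assumes F: "subspace F" and "\<alpha> \<in> alt_forms F" "\<beta> \<in> alt_forms F"
  shows "wedge \<alpha> \<beta> \<in> alt_forms F"
proof (rule alt_formsI[OF F])
  fix vs assume "\<not> set vs \<subseteq> F"
  have "\<alpha> (nths vs I) * \<beta> (nths vs (- I)) = 0" for I
  proof -
    have "set vs = set (nths vs I) \<union> set (nths vs (- I))"
      by (auto simp: set_nths in_set_conv_nth) blast
    then have "\<not> set (nths vs I) \<subseteq> F \<or> \<not> set (nths vs (- I)) \<subseteq> F" using \<open>\<not> set vs \<subseteq> F\<close> by auto
    then show ?thesis using alt_formsD(1) assms(2,3) by fastforce
  qed
  then show "wedge \<alpha> \<beta> vs = 0" unfolding wedge_def by (intro sum.neutral) (simp add: mult.assoc)
next
  fix us u v ws assume "set us \<subseteq> F" "set ws \<subseteq> F" "u \<in> F" "v \<in> F"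
  then show "wedge \<alpha> \<beta> (us @ (u + v) # ws) = wedge \<alpha> \<beta> (us @ u # ws) + wedge \<alpha> \<beta> (us @ v # ws)"
    using assms(2,3)
    by (induction us arbitrary: \<alpha> \<beta>) (simp_all add: wedge_Cons hook_vec_linear[OF _ _ _ F] par_alt_forms hook_alt_forms)
next
  fix us v ws c assume "set us \<subseteq> F" "set ws \<subseteq> F" "v \<in> F"
  then show "wedge \<alpha> \<beta> (us @ (c *\<^sub>R v) # ws) = c * wedge \<alpha> \<beta> (us @ v # ws)"
    using assms(2,3)
    by (induction us arbitrary: \<alpha> \<beta>)
      (simp_all add: wedge_Cons hook_vec_linear(2)[OF _ _ _ F] par_alt_forms hook_alt_forms algebra_simps)
next
  fix us v ws assume "set us \<subseteq> F" "set ws \<subseteq> F" "v \<in> F"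
  then show "wedge \<alpha> \<beta> (us @ v # v # ws) = 0"
    using assms(2,3)
    by (induction us arbitrary: \<alpha> \<beta>)
      (simp_all add: wedge_Cons hook_vec_linear(3)[OF _ _ _ F] par_alt_forms hook_alt_forms hook_par)
qed

lemma scalar_form_alt_forms: "scalar_form c \<in> alt_forms F"
  by (auto simp: alt_forms_def scalar_form_def)

text \<open>One spanning vector g is adjoined. The arguments are reduced modulo g in turn: the
  multiple of g contributes nothing, and the rest joins the prefix \<open>us\<close>, which stays in
  the smaller span.\<close>

lemma alt_forms_vanish_step:
  assumes \<omega>: "\<omega> \<in> alt_forms F" and F: "subspace F" "g \<in> F" "set gs \<subseteq> F"
    and 0: "\<And>vs. set vs \<subseteq> span (set gs) \<Longrightarrow> \<omega> vs = 0"
    and g: "\<And>us ws. set us \<subseteq> F \<Longrightarrow> set ws \<subseteq> F \<Longrightarrow> \<omega> (us @ g # ws) = 0"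
    and "set us \<subseteq> span (set gs)" "set vs \<subseteq> span (set (g # gs))"
  shows "\<omega> (us @ vs) = 0"
  using assms(7,8)
proof (induction vs arbitrary: us)
  case (Cons v vs)
  have sub: "span (set gs) \<subseteq> F" "span (set (g # gs)) \<subseteq> F" using F by (simp_all add: span_minimal)
  from Cons.prems(2) obtain c where c: "v - c *\<^sub>R g \<in> span (set gs)" by (auto simp: span_breakdown_eq)
  define w where "w = v - c *\<^sub>R g"
  have m: "set us \<subseteq> F" "set vs \<subseteq> F" "w \<in> F" "c *\<^sub>R g \<in> F"
    using Cons.prems sub c F by (auto simp: w_def subspace_scale)
  have "\<omega> (us @ v # vs) = \<omega> (us @ (c *\<^sub>R g + w) # vs)" by (simp add: w_def)
  also have "\<dots> = c * \<omega> (us @ g # vs) + \<omega> (us @ w # vs)"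
    using alt_formsD(2,3)[OF \<omega>] m F by simp
  also have "\<dots> = \<omega> ((us @ [w]) @ vs)" using g m by simp
  also have "\<dots> = 0" using Cons.prems c by (intro Cons.IH) (auto simp: w_def)
  finally show ?case .
qed (use 0 in simp)

text \<open>By multilinearity and alternation only arguments taken from \<open>g\<close> in order,
  each at most once, matter. In the induction, lists avoiding \<open>g0\<close> are covered by
  \<omega>, and those containing it by \<open>hook g0 \<omega>\<close> after moving
  \<open>g0\<close> to the front.\<close>

lemma alt_forms_eq_0I:
  assumes \<omega>: "\<omega> \<in> alt_forms F" and F: "subspace F" "set g \<subseteq> F"
    and 0: "\<And>I. \<omega> (nths g I) = 0" and "set vs \<subseteq> span (set g)"
  shows "\<omega> vs = 0"
  using assms
proof (induction g arbitrary: \<omega> vs)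
  case Nil
  \<comment> \<open>The span of the empty list is {0}, so any argument that occurs is 0.\<close>
  then have "vs = [] \<or> (\<exists>ws. vs = 0 # ws)" by (cases vs) auto
  moreover have "\<omega> (0 # ws) = 0" if "set ws \<subseteq> F" for ws
    using alt_formsD(3)[OF Nil(1), of "[]" ws 0 0] that Nil(2) by (simp add: subspace_0)
  moreover have "set vs \<subseteq> F" using Nil by (auto simp: subspace_0)
  ultimately show ?case using Nil(4)[of "{}"] by auto
next
  case (Cons g0 g)
  have sp: "span (set (g0 # g)) \<subseteq> F" using Cons.prems by (simp add: span_minimal)
  have A: "\<omega> vs = 0" if "set vs \<subseteq> span (set g)" for vs
    by (rule Cons.IH) (use Cons.prems that in \<open>auto, metis nths_Cons_Suc(1)\<close>)
  have h: "hook g0 \<omega> \<in> alt_forms F" using Cons.prems by (simp add: hook_alt_forms)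
  have B: "hook g0 \<omega> vs = 0" if "set vs \<subseteq> span (set g)" for vs
    by (rule Cons.IH[OF h]) (use Cons.prems that in \<open>auto simp: hook_apply, metis nths_Cons_Suc(2)\<close>)
  have "hook g0 \<omega> (us @ g0 # ws) = 0" for us ws
    using alt_formsD(4)[OF Cons.prems(1), of "g0 # us @ g0 # ws"] by (simp add: hook_apply)
  then have C: "hook g0 \<omega> vs = 0" if "set vs \<subseteq> span (set (g0 # g))" for vs
    using alt_forms_vanish_step[of "hook g0 \<omega>" F g0 g "[]" vs] h B that Cons.prems(2,3) by simp
  have D: "\<omega> (us @ g0 # ws) = 0" if "set us \<subseteq> span (set (g0 # g))" "set ws \<subseteq> span (set (g0 # g))" for us ws
  proof -
    have "\<omega> (us @ g0 # ws) = (-1) ^ length us * hook g0 \<omega> (us @ ws)"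
      using Cons.prems that sp by (subst alt_move[where F = F]) (auto simp: hook_apply)
    then show ?thesis using C[of "us @ ws"] that by simp
  qed
  text \<open>restrict to the span so that the hypothesis on \<open>g0\<close> is available\<close>
  define \<omega>' where "\<omega>' vs = (if set vs \<subseteq> span (set (g0 # g)) then \<omega> vs else 0)" for vs
  have S: "subspace (span (set (g0 # g)))" by (rule subspace_span)
  have "\<omega>' \<in> alt_forms (span (set (g0 # g)))"
  proof (rule alt_formsI[OF S])
    fix us u v ws
    assume *: "set us \<subseteq> span (set (g0 # g))" "set ws \<subseteq> span (set (g0 # g))" "u \<in> span (set (g0 # g))" "v \<in> span (set (g0 # g))"
    then have **: "u + v \<in> span (set (g0 # g))" by (metis subspace_add S)
    have "set us \<subseteq> F" "set ws \<subseteq> F" "u \<in> F" "v \<in> F" using * sp by auto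
    from alt_formsD(2)[OF Cons.prems(1) this] * **
    show "\<omega>' (us @ (u + v) # ws) = \<omega>' (us @ u # ws) + \<omega>' (us @ v # ws)"
      by (simp add: \<omega>'_def del: span_insert)
  next
    fix us v ws c
    assume *: "set us \<subseteq> span (set (g0 # g))" "set ws \<subseteq> span (set (g0 # g))" "v \<in> span (set (g0 # g))"
    then have **: "c *\<^sub>R v \<in> span (set (g0 # g))" by (metis subspace_scale S)
    have "set us \<subseteq> F" "set ws \<subseteq> F" "v \<in> F" using * sp by auto
    from alt_formsD(3)[OF Cons.prems(1) this] * **
    show "\<omega>' (us @ (c *\<^sub>R v) # ws) = c * \<omega>' (us @ v # ws)"
      by (simp add: \<omega>'_def del: span_insert)
  qed (simp_all add: \<omega>'_def alt_formsD(4)[OF Cons.prems(1)])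
  moreover have "\<omega>' ws = 0" if "set ws \<subseteq> span (set g)" for ws
    using A[OF that] by (simp add: \<omega>'_def)
  moreover have "\<omega>' (us @ g0 # ws) = 0" if "set us \<subseteq> span (set (g0 # g))" "set ws \<subseteq> span (set (g0 # g))" for us ws
    using D[OF that] by (simp add: \<omega>'_def)
  moreover have "g0 \<in> span (set (g0 # g))" "set g \<subseteq> span (set (g0 # g))"
    using span_superset[of "set (g0 # g)"] by auto
  ultimately have "\<omega>' ([] @ vs) = 0"
    using alt_forms_vanish_step[of \<omega>' "span (set (g0 # g))" g0 g "[]" vs] S Cons.prems(5) by simp
  then show ?case using Cons.prems(5) by (simp add: \<omega>'_def)
qed

lemma alt_forms_eqI:
  assumes \<omega>: "\<omega> \<in> alt_forms F" "\<eta> \<in> alt_forms F" and F: "subspace F" "set g \<subseteq> F" "F \<subseteq> span (set g)"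
    and eq: "\<And>I. \<omega> (nths g I) = \<eta> (nths g I)"
  shows "\<omega> = \<eta>"
proof
  fix vs
  have d: "\<omega> - \<eta> \<in> alt_forms F" using subspace_diff[OF subspace_alt_forms \<omega>] .
  show "\<omega> vs = \<eta> vs"
  proof (cases "set vs \<subseteq> F")
    case True
    then have "(\<omega> - \<eta>) vs = 0" using alt_forms_eq_0I[OF d F(1,2), of vs] F(3) eq by auto
    then show ?thesis by simp
  next
    case False
    then show ?thesis using alt_formsD(1)[OF \<omega>(1)] alt_formsD(1)[OF \<omega>(2)] by simp
  qed
qed


section \<open>Contraction\<close>

text \<open>The contraction sum as a recursion over the basis: each vector \<open>e\<close> is
  either skipped or inserted, the covector \<open>f e\<close> being fed to \<open>a\<close> in the
  second case. Duality of \<open>f\<close> and the list is not built in, so the sign rules can be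
  proved without it.\<close>

primrec contr :: "('v \<Rightarrow> 'w) \<Rightarrow> 'v list \<Rightarrow> ('w list \<Rightarrow> real) \<Rightarrow> ('v list \<Rightarrow> real) \<Rightarrow> 'v list \<Rightarrow> real" where
  "contr f [] a \<omega> = a [] *\<^sub>R \<omega>"
| "contr f (e # es) a \<omega> = contr f es a \<omega> + contr f es (hook (f e) a) (hook e \<omega>)"

lemma contr_eq_sum:
  "contr f es a \<omega> vs = (\<Sum>I\<in>Pow {..<length es}. a (nths (map f es) I) * \<omega> (nths es I @ vs))"
proof (induction es arbitrary: a \<omega> vs)
  case (Cons e es)
  show ?case by (simp del: lessThan_Suc add: sum_Pow_Suc Cons.IH hook_apply sum.distrib)
qed simp

lemma contr_linear [simp]:
  "contr f es (a + b) \<omega> = contr f es a \<omega> + contr f es b \<omega>"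
  "contr f es (c *\<^sub>R a) \<omega> = c *\<^sub>R contr f es a \<omega>"
  "contr f es (- a) \<omega> = - contr f es a \<omega>"
  "contr f es (a - b) \<omega> = contr f es a \<omega> - contr f es b \<omega>"
  "contr f es 0 \<omega> = 0"
  "contr f es a (\<omega> + \<eta>) = contr f es a \<omega> + contr f es a \<eta>"
  "contr f es a (c *\<^sub>R \<omega>) = c *\<^sub>R contr f es a \<omega>"
  "contr f es a (- \<omega>) = - contr f es a \<omega>"
  "contr f es a (\<omega> - \<eta>) = contr f es a \<omega> - contr f es a \<eta>"
  "contr f es a 0 = 0"
  by (auto simp: fun_eq_iff contr_eq_sum algebra_simps sum.distrib sum_distrib_left sum_negf sum_subtractf)

lemma par_hook: "par (hook v \<omega>) = - hook v (par \<omega>)"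
  by (simp add: hook_par)

lemma par_contr: "par (contr f es a \<omega>) = contr f es (par a) (par \<omega>)"
proof
  fix vs show "par (contr f es a \<omega>) vs = contr f es (par a) (par \<omega>) vs"
    by (induction es arbitrary: a \<omega>) (simp_all add: par_hook, simp add: par_apply)
qed

lemmas fun_app = plus_fun_apply zero_fun_apply scaleR_fun_apply uminus_apply minus_apply

text \<open>The insertion of v anticommutes with each basis insertion, so it passes a contraction by
  \<open>a\<close> with the sign of the degree of \<open>a\<close>.\<close>

lemma hook_contr:
  assumes "\<omega> \<in> alt_forms F" "subspace F" "set es \<subseteq> F" "v \<in> F"
  shows "hook v (contr f es a \<omega>) = contr f es (par a) (hook v \<omega>)"
  using assms
proof (induction es arbitrary: a \<omega>)
  case (Cons e es)
  have "hook v (hook e \<omega>) = - hook e (hook v \<omega>)"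
    by (rule hook_vec_linear(4)) (use Cons.prems in auto)
  then show ?case
    using Cons.IH[of \<omega> a] Cons.IH[of "hook e \<omega>" "hook (f e) a"] Cons.prems
    by (simp add: hook_alt_forms par_hook del: fun_app)
qed (simp add: par_apply)

lemma contr_scalar_form [simp]: "contr f es (scalar_form c) \<omega> = c *\<^sub>R \<omega>"
proof
  fix vs show "contr f es (scalar_form c) \<omega> vs = (c *\<^sub>R \<omega>) vs"
    by (induction es arbitrary: \<omega>) (simp_all, simp add: scalar_form_def)
qed

lemma contr_alt_forms:
  "\<omega> \<in> alt_forms F \<Longrightarrow> set es \<subseteq> F \<Longrightarrow> contr f es a \<omega> \<in> alt_forms F"
  by (induction es arbitrary: a \<omega>) (auto intro!: alt_forms_lin hook_alt_forms)

section \<open>Vectors as multivectors of degree one\<close>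

definition ev :: "'v::real_vector set \<Rightarrow> 'v \<Rightarrow> ('v \<Rightarrow> real) list \<Rightarrow> real" where
  "ev F v \<xi>s = (case \<xi>s of [\<xi>] \<Rightarrow> (if \<xi> \<in> dual_space F then \<xi> v else 0) | _ \<Rightarrow> 0)"

lemma ev_degree_1: "length \<xi>s \<noteq> 1 \<Longrightarrow> ev F v \<xi>s = 0"
  by (auto simp: ev_def split: list.split)

lemma par_ev [simp]: "par (ev F v) = - ev F v"
  by (auto simp: ev_def par_def fun_eq_iff split: list.split)

lemma hook_ev [simp]: "\<xi> \<in> dual_space F \<Longrightarrow> hook \<xi> (ev F v) = scalar_form (\<xi> v)"
  by (auto simp: ev_def hook_def scalar_form_def fun_eq_iff split: list.split)

lemma hook_wedge_ev:
  "\<xi> \<in> dual_space F \<Longrightarrow> hook \<xi> (wedge (ev F v) a) = \<xi> v *\<^sub>R a - wedge (ev F v) (hook \<xi> a)"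
  by (simp add: hook_wedge)

lemma wedge_ev_commute: "wedge \<beta> (ev F v) = wedge (ev F v) (par \<beta>)"
  by (rule wedge_degree_1_commute) (simp add: ev_degree_1)

lemma dual_spaceD:
  "\<xi> \<in> dual_space F \<Longrightarrow> v \<notin> F \<Longrightarrow> \<xi> v = 0"
  "\<xi> \<in> dual_space F \<Longrightarrow> u \<in> F \<Longrightarrow> v \<in> F \<Longrightarrow> \<xi> (u + v) = \<xi> u + \<xi> v"
  "\<xi> \<in> dual_space F \<Longrightarrow> v \<in> F \<Longrightarrow> \<xi> (c *\<^sub>R v) = c * \<xi> v"
  by (auto simp: dual_space_def)

lemma subspace_dual_space: "subspace (dual_space F)"
  by (auto simp: subspace_def dual_space_def algebra_simps)

lemma ev_alt_forms:
  assumes "v \<in> F"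
  shows "ev F v \<in> alt_forms (dual_space (F :: 'a::real_vector set))"
proof (rule alt_formsI[OF subspace_dual_space])
  note D = subspace_add[OF subspace_dual_space, of _ F] subspace_scale[OF subspace_dual_space, of _ F]
  fix us ws and \<xi> \<eta> :: "'a \<Rightarrow> real"
  assume "\<xi> \<in> dual_space F" "\<eta> \<in> dual_space F"
  with D show "ev F v (us @ (\<xi> + \<eta>) # ws) = ev F v (us @ \<xi> # ws) + ev F v (us @ \<eta> # ws)"
    by (cases us; cases ws) (auto simp: ev_def split: list.splits)
next
  note D = subspace_scale[OF subspace_dual_space, of _ F]
  fix us ws and \<xi> :: "'a \<Rightarrow> real" and c
  assume "\<xi> \<in> dual_space F"
  with D show "ev F v (us @ (c *\<^sub>R \<xi>) # ws) = c * ev F v (us @ \<xi> # ws)"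
    by (cases us; cases ws) (auto simp: ev_def split: list.splits)
next
  fix \<xi>s assume "\<not> set \<xi>s \<subseteq> dual_space F"
  then show "ev F v \<xi>s = 0" by (auto simp: ev_def split: list.split)
qed (simp add: ev_degree_1)

text \<open>Once \<open>f\<close> is dual to \<open>es\<close> this is i(v \<and> a) = i_a i_v with
  v expanded in the basis. In the induction the double insertion of \<open>e\<close> vanishes, and
  the cross terms match because insertions anticommute.\<close>

lemma contr_wedge_ev:
  assumes "\<omega> \<in> alt_forms F" "subspace F" "set es \<subseteq> F" "f ` set es \<subseteq> dual_space F"
  shows "contr f es (wedge (ev F v) a) \<omega> vs = (\<Sum>e\<leftarrow>es. f e v * contr f es a (hook e \<omega>) vs)"
  using assms
proof (induction es arbitrary: a \<omega>)
  case Nil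
  then show ?case by (simp add: ev_degree_1)
next
  case (Cons e es)
  have e: "e \<in> F" "f e \<in> dual_space F" and \<omega>: "\<omega> \<in> alt_forms F" "hook e \<omega> \<in> alt_forms F"
    using Cons.prems by (auto intro: hook_alt_forms)
  have sw: "hook e (hook e' \<omega>) = - hook e' (hook e \<omega>)" if "e' \<in> set es" for e'
    by (rule hook_vec_linear(4)) (use Cons.prems e that in auto)
  have z: "hook e (hook e \<omega>) = 0" using hook_vec_linear(3) \<omega> e Cons.prems by blast
  have "contr f (e # es) (wedge (ev F v) a) \<omega> vs
    = contr f es (wedge (ev F v) a) \<omega> vs + f e v * contr f es a (hook e \<omega>) vs
      - contr f es (wedge (ev F v) (hook (f e) a)) (hook e \<omega>) vs"
    using e by (simp add: hook_wedge_ev)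
  also have "contr f es (wedge (ev F v) a) \<omega> vs = (\<Sum>e'\<leftarrow>es. f e' v * contr f es a (hook e' \<omega>) vs)"
    using Cons.prems by (intro Cons.IH) auto
  also have "contr f es (wedge (ev F v) (hook (f e) a)) (hook e \<omega>) vs
     = (\<Sum>e'\<leftarrow>es. f e' v * contr f es (hook (f e) a) (hook e' (hook e \<omega>)) vs)"
    using Cons.prems \<omega> by (intro Cons.IH) auto
  also have "\<dots> = (\<Sum>e'\<leftarrow>es. - (f e' v * contr f es (hook (f e) a) (hook e (hook e' \<omega>)) vs))"
    by (intro arg_cong[of _ _ sum_list] map_cong refl) (simp add: sw)
  also have "\<dots> = - (\<Sum>e'\<leftarrow>es. f e' v * contr f es (hook (f e) a) (hook e (hook e' \<omega>)) vs)"
    by (simp add: uminus_sum_list_map o_def)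
  finally show ?case by (simp add: sum_list_addf z algebra_simps)
qed

lemma hook_sum_list:
  assumes "\<omega> \<in> alt_forms F" "subspace F" "set es \<subseteq> F"
  shows "hook (\<Sum>e\<leftarrow>es. c e *\<^sub>R e) \<omega> = (\<Sum>e\<leftarrow>es. c e *\<^sub>R hook e \<omega>)"
proof
  fix vs show "hook (\<Sum>e\<leftarrow>es. c e *\<^sub>R e) \<omega> vs = (\<Sum>e\<leftarrow>es. c e *\<^sub>R hook e \<omega>) vs"
    using assms(3)
  proof (induction es)
    case Nil
    have "0 \<in> F" using assms(2) by (rule subspace_0)
    from hook_vec_linear(2)[OF assms(1) this this assms(2), of 0] show ?case by simp
  next
    case (Cons e es)
    have "(\<Sum>e\<leftarrow>es. c e *\<^sub>R e) \<in> F" "c e *\<^sub>R e \<in> F" "e \<in> F"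
      using Cons.prems assms(2) by (induction es) (auto intro: subspace_0 subspace_add subspace_scale)
    then show ?case using Cons hook_vec_linear(1,2)[OF assms(1) _ _ assms(2)] by simp
  qed
qed

lemma contr_sum_list_right: "contr f es a (\<Sum>x\<leftarrow>xs. h x) vs = (\<Sum>x\<leftarrow>xs. contr f es a (h x) vs)"
  by (induction xs) (simp_all del: fun_app, simp_all)

text \<open>The members of \<open>dual_basis\<close>, indexed by basis vectors instead of positions.
  They depend only on the set of \<open>bs\<close>, so reordering a basis leaves them
  unchanged.\<close>

definition coord :: "'v::real_vector list \<Rightarrow> 'v \<Rightarrow> 'v \<Rightarrow> real" where
  "coord bs b = (\<lambda>v. representation (set bs) v b)"

lemma dual_basis_eq: "dual_basis bs = map (coord bs) bs"
  by (simp add: dual_basis_def coord_def)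

lemma basis_list_subspace: "basis_list F bs \<Longrightarrow> subspace F"
  by (auto simp: basis_list_def)

lemma basis_list_subset: "basis_list F bs \<Longrightarrow> set bs \<subseteq> F"
  by (auto simp: basis_list_def span_base)

lemma coord_dual_space:
  assumes "basis_list F bs"
  shows "coord bs b \<in> dual_space F"
  using assms representation_add[of "set bs"] representation_scale[of "set bs"]
  by (auto simp: dual_space_def coord_def basis_list_def representation_def)

lemma coord_basis:
  assumes "basis_list F bs" "b' \<in> set bs"
  shows "coord bs b b' = (if b = b' then 1 else 0)"
  using assms by (simp add: coord_def basis_list_def representation_basis)

lemma coord_expansion:
  assumes "basis_list F bs" "v \<in> F"
  shows "(\<Sum>b\<leftarrow>bs. coord bs b v *\<^sub>R b) = v"
proof -
  have "(\<Sum>b\<leftarrow>bs. coord bs b v *\<^sub>R b) = (\<Sum>b\<in>set bs. representation (set bs) v b *\<^sub>R b)"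
    using assms by (simp add: coord_def basis_list_def sum_list_distinct_conv_sum_set)
  also have "\<dots> = v"
    using assms by (intro sum_representation_eq) (auto simp: basis_list_def)
  finally show ?thesis .
qed

lemma dual_space_sum_list:
  assumes "subspace F" "\<xi> \<in> dual_space F" "set es \<subseteq> F"
  shows "\<xi> (\<Sum>e\<leftarrow>es. c e *\<^sub>R e) = (\<Sum>e\<leftarrow>es. c e * \<xi> e)"
  using assms(3)
proof (induction es)
  case Nil
  then show ?case using dual_spaceD(3)[OF assms(2) subspace_0[OF assms(1)], of 0] by simp
next
  case (Cons e es)
  have "(\<Sum>e\<leftarrow>es. c e *\<^sub>R e) \<in> F" "c e *\<^sub>R e \<in> F"
    using Cons.prems assms(1) by (induction es) (auto intro: subspace_0 subspace_add subspace_scale)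
  then show ?case using Cons dual_spaceD[OF assms(2)] by simp
qed

lemma sum_list_apply: "(\<Sum>x\<leftarrow>xs. h x) y = (\<Sum>x\<leftarrow>xs. h x y)" for h :: "'a \<Rightarrow> 'b \<Rightarrow> 'c::monoid_add"
  by (induction xs) simp_all

lemma dual_space_subset_span:
  assumes "basis_list F bs"
  shows "dual_space F \<subseteq> span (set (map (coord bs) bs))"
proof
  fix \<xi> assume \<xi>: "\<xi> \<in> dual_space F"
  have "\<xi> = (\<Sum>b\<leftarrow>bs. \<xi> b *\<^sub>R coord bs b)"
  proof
    fix v show "\<xi> v = (\<Sum>b\<leftarrow>bs. \<xi> b *\<^sub>R coord bs b) v"
    proof (cases "v \<in> F")
      case True
      have "\<xi> v = \<xi> (\<Sum>b\<leftarrow>bs. coord bs b v *\<^sub>R b)" using coord_expansion[OF assms True] by simp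
      also have "\<dots> = (\<Sum>b\<leftarrow>bs. coord bs b v * \<xi> b)"
        using basis_list_subspace[OF assms] basis_list_subset[OF assms] \<xi> by (intro dual_space_sum_list)
      finally show ?thesis by (simp add: sum_list_apply mult.commute)
    next
      case False
      then show ?thesis using dual_spaceD(1)[OF \<xi>] dual_spaceD(1)[OF coord_dual_space[OF assms]]
        by (simp add: sum_list_apply)
    qed
  qed
  also have "\<dots> \<in> span (set (map (coord bs) bs))"
  proof -
    have "(\<Sum>b\<leftarrow>cs. \<xi> b *\<^sub>R coord bs b) \<in> span (set (map (coord bs) bs))" if "set cs \<subseteq> set bs" for cs
      using that by (induction cs) (auto intro: span_add span_scale span_base span_zero)
    then show ?thesis by simp
  qed
  finally show "\<xi> \<in> span (set (map (coord bs) bs))" .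
qed

section \<open>The basis of the exterior algebra induced by a basis\<close>

definition wedge_list :: "'v::real_vector set \<Rightarrow> 'v list \<Rightarrow> ('v \<Rightarrow> real) list \<Rightarrow> real" where
  "wedge_list F s = foldr (\<lambda>v a. wedge (ev F v) a) s (scalar_form 1)"

lemma wedge_list_simps [simp]:
  "wedge_list F [] = scalar_form 1" "wedge_list F (v # s) = wedge (ev F v) (wedge_list F s)"
  by (simp_all add: wedge_list_def)

lemma wedge_list_alt_forms: "set s \<subseteq> F \<Longrightarrow> wedge_list F s \<in> alt_forms (dual_space F)"
  by (induction s) (auto intro!: scalar_form_alt_forms wedge_alt_forms subspace_dual_space ev_alt_forms)

lemma wedge_degree:
  assumes "\<And>vs. length vs \<noteq> p \<Longrightarrow> \<alpha> vs = 0" "\<And>vs. length vs \<noteq> q \<Longrightarrow> \<beta> vs = 0" "length vs \<noteq> p + q"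
  shows "wedge \<alpha> \<beta> vs = 0"
proof -
  have "\<alpha> (nths vs I) = 0 \<or> \<beta> (nths vs (- I)) = 0" for I
  proof -
    have "{i. i < length vs \<and> i \<in> I} \<union> {i. i < length vs \<and> i \<in> - I} = {..<length vs}" by auto
    moreover have "card ({i. i < length vs \<and> i \<in> I} \<union> {i. i < length vs \<and> i \<in> - I})
       = card {i. i < length vs \<and> i \<in> I} + card {i. i < length vs \<and> i \<in> - I}"
      by (intro card_Un_disjoint) auto
    ultimately have "length (nths vs I) + length (nths vs (- I)) = length vs"
      by (simp add: length_nths)
    then show ?thesis using assms by (metis)
  qed
  then show ?thesis by (auto simp: wedge_def intro!: sum.neutral)
qed

lemma wedge_list_degree: "length \<xi>s \<noteq> length s \<Longrightarrow> wedge_list F s \<xi>s = 0"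
proof (induction s arbitrary: \<xi>s)
  case (Cons v s)
  show ?case unfolding wedge_list_simps
    by (rule wedge_degree[where p = 1 and q = "length s"]) (use Cons ev_degree_1 in auto)
qed (simp add: scalar_form_def)

lemma hook_wedge_list_0:
  assumes "\<xi> \<in> dual_space F" "\<And>v. v \<in> set s \<Longrightarrow> \<xi> v = 0"
  shows "hook \<xi> (wedge_list F s) = 0"
proof -
  have "\<forall>v\<in>set s. \<xi> v = 0 \<Longrightarrow> hook \<xi> (wedge_list F s) \<in> {0}"
    by (induction s) (simp_all add: hook_wedge_ev[OF assms(1)])
  then show ?thesis using assms(2) by simp
qed

lemma wedge_ev_0:
  assumes "\<And>\<xi>. \<xi> \<in> set \<xi>s \<Longrightarrow> \<xi> v = 0"
  shows "wedge (ev F v) a \<xi>s = 0"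
proof -
  have "ev F v (nths \<xi>s I) = 0" for I
    using set_nths_subset[of \<xi>s I] assms by (auto simp: ev_def split: list.split)
  then show ?thesis by (simp add: wedge_def)
qed

lemma nths_Cons_if: "nths (x # xs) I = (if 0 \<in> I then [x] else []) @ nths xs {j. Suc j \<in> I}"
  by (simp add: nths_Cons)

text \<open>The head covector annihilates all later vectors and the head vector is annihilated by
  all later covectors. So \<open>I\<close> and \<open>J\<close> must agree about position 0, and the
  tails are compared by induction.\<close>

lemma wedge_list_nths_dual:
  assumes "distinct es" "\<And>e e'. e \<in> set es \<Longrightarrow> e' \<in> set es \<Longrightarrow> f e e' = (if e = e' then 1 else 0)"
    "f ` set es \<subseteq> dual_space F" "I \<subseteq> {..<length es}" "J \<subseteq> {..<length es}"
  shows "wedge_list F (nths es I) (map f (nths es J)) = (if I = J then 1 else 0)"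
  using assms
proof (induction es arbitrary: I J)
  case Nil
  then show ?case by (simp add: scalar_form_def)
next
  case (Cons e es)
  define I' J' where "I' = {j. Suc j \<in> I}" and "J' = {j. Suc j \<in> J}"
  have sub: "I' \<subseteq> {..<length es}" "J' \<subseteq> {..<length es}" using Cons.prems by (auto simp: I'_def J'_def)
  have eq: "I = J \<longleftrightarrow> (0 \<in> I \<longleftrightarrow> 0 \<in> J) \<and> I' = J'"
    unfolding I'_def J'_def set_eq_iff by (auto, (metis not0_implies_Suc)+)
  have IH: "wedge_list F (nths es I') (map f (nths es J')) = (if I' = J' then 1 else 0)"
    using Cons.prems sub by (intro Cons.IH) auto
  have inI: "set (nths es K) \<subseteq> set es" for K by (rule set_nths_subset)
  have 1: "hook (f e) (wedge_list F (nths es I')) = 0"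
    using Cons.prems inI[of I'] by (intro hook_wedge_list_0) auto
  have 2: "wedge (ev F e) a (map f (nths es J')) = 0" for a
    using Cons.prems inI[of J'] by (intro wedge_ev_0) auto
  have fe: "f e \<in> dual_space F" "f e e = 1" using Cons.prems by auto
  show ?case
    unfolding nths_Cons_if I'_def[symmetric] J'_def[symmetric] eq
    using IH 1 2 fe hook_wedge_ev[OF fe(1), of e "wedge_list F (nths es I')"]
    by (auto simp flip: hook_apply)
qed

lemma nths_Int_lessThan: "nths xs I = nths xs (I \<inter> {..<length xs})"
proof -
  have "filter (\<lambda>p. snd p \<in> I) (zip xs [0..<length xs]) = filter (\<lambda>p. snd p \<in> I \<inter> {..<length xs}) (zip xs [0..<length xs])"
    by (rule filter_cong) (auto dest: set_zip_rightD)
  then show ?thesis by (simp add: nths_def)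
qed

lemma sum_fun_apply: "sum h S y = (\<Sum>x\<in>S. h x y)" for h :: "'a \<Rightarrow> 'b \<Rightarrow> 'c::comm_monoid_add"
  by (induction S rule: infinite_finite_induct) simp_all

lemma sum_alt_forms: "(\<And>x. x \<in> S \<Longrightarrow> h x \<in> alt_forms F) \<Longrightarrow> sum h S \<in> alt_forms F"
  by (rule subspace_sum[OF subspace_alt_forms])

lemma wedge_list_sum_nths:
  assumes "basis_list F bs" "J \<subseteq> {..<length bs}"
  shows "(\<Sum>I\<in>Pow {..<length bs}. c I *\<^sub>R wedge_list F (nths bs I)) (nths (map (coord bs) bs) J) = c J"
proof -
  have basis: "distinct bs" using assms(1) by (simp add: basis_list_def)
  have "(\<Sum>I\<in>Pow {..<length bs}. c I *\<^sub>R wedge_list F (nths bs I)) (nths (map (coord bs) bs) J)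
     = (\<Sum>I\<in>Pow {..<length bs}. c I * (if I = J then 1 else 0))"
    unfolding sum_fun_apply nths_map
    using assms(2) basis coord_basis[OF assms(1)] coord_dual_space[OF assms(1)]
    by (intro sum.cong refl) (simp add: wedge_list_nths_dual image_subset_iff)
  also have "\<dots> = (\<Sum>I\<in>Pow {..<length bs}. if J = I then c I else 0)"
    by (intro sum.cong) auto
  also have "\<dots> = c J" by (subst sum.delta') (use assms(2) in auto)
  finally show ?thesis .
qed

lemma multivector_eqI:
  assumes "basis_list F bs" "a \<in> alt_forms (dual_space F)" "b \<in> alt_forms (dual_space F)"
    "\<And>J. J \<subseteq> {..<length bs} \<Longrightarrow> a (nths (map (coord bs) bs) J) = b (nths (map (coord bs) bs) J)"
  shows "a = b"
proof (rule alt_forms_eqI[OF assms(2,3) subspace_dual_space _ dual_space_subset_span[OF assms(1)]])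
  show "set (map (coord bs) bs) \<subseteq> dual_space F" using coord_dual_space[OF assms(1)] by auto
  fix I show "a (nths (map (coord bs) bs) I) = b (nths (map (coord bs) bs) I)"
    using assms(4)[of "I \<inter> {..<length (map (coord bs) bs)}", unfolded nths_Int_lessThan[symmetric]]
    by (metis inf_le2 length_map)
qed

lemma form_eqI:
  assumes "basis_list F bs" "a \<in> alt_forms F" "b \<in> alt_forms F"
    "\<And>J. J \<subseteq> {..<length bs} \<Longrightarrow> a (nths bs J) = b (nths bs J)"
  shows "a = b"
proof (rule alt_forms_eqI[OF assms(2,3) basis_list_subspace[OF assms(1)] basis_list_subset[OF assms(1)]])
  show "F \<subseteq> span (set bs)" using assms(1) by (simp add: basis_list_def)
  fix I show "a (nths bs I) = b (nths bs I)"
    using assms(4)[of "I \<inter> {..<length bs}", unfolded nths_Int_lessThan[symmetric]] by (metis inf_le2)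
qed

text \<open>Both sides agree on increasing lists of dual basis vectors, by
  \<open>wedge_list_sum_nths\<close>, and these determine a multivector.\<close>

lemma multivector_expansion:
  assumes "basis_list F bs" "a \<in> alt_forms (dual_space F)"
  shows "(\<Sum>I\<in>Pow {..<length bs}. a (nths (map (coord bs) bs) I) *\<^sub>R wedge_list F (nths bs I)) = a"
proof (rule multivector_eqI[OF assms(1) _ assms(2)])
  have "set (nths bs I) \<subseteq> F" for I by (rule order_trans[OF set_nths_subset basis_list_subset[OF assms(1)]])
  then show "(\<Sum>I\<in>Pow {..<length bs}. a (nths (map (coord bs) bs) I) *\<^sub>R wedge_list F (nths bs I)) \<in> alt_forms (dual_space F)"
    by (intro sum_alt_forms alt_forms_lin wedge_list_alt_forms)
qed (rule wedge_list_sum_nths[OF assms(1)])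

lemma contr_wedge_ev_basis:
  assumes "basis_list F bs" "\<omega> \<in> alt_forms F" "v \<in> F"
  shows "contr (coord bs) bs (wedge (ev F v) a) \<omega> = contr (coord bs) bs a (hook v \<omega>)"
proof
  fix vs
  note F = basis_list_subspace[OF assms(1)] basis_list_subset[OF assms(1)]
  have "contr (coord bs) bs (wedge (ev F v) a) \<omega> vs = (\<Sum>e\<leftarrow>bs. coord bs e v * contr (coord bs) bs a (hook e \<omega>) vs)"
    using F assms coord_dual_space[OF assms(1)] by (intro contr_wedge_ev) auto
  also have "\<dots> = contr (coord bs) bs a (hook (\<Sum>e\<leftarrow>bs. coord bs e v *\<^sub>R e) \<omega>) vs"
    by (simp add: hook_sum_list[OF assms(2) F] contr_sum_list_right)
  finally show "contr (coord bs) bs (wedge (ev F v) a) \<omega> vs = contr (coord bs) bs a (hook v \<omega>) vs"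
    by (simp add: coord_expansion[OF assms(1,3)])
qed

lemma contr_wedge_list:
  assumes "basis_list F bs" "\<omega> \<in> alt_forms F" "set s \<subseteq> F"
  shows "contr (coord bs) bs (wedge_list F s) \<omega> vs = \<omega> (s @ vs)"
  using assms(2,3)
  by (induction s arbitrary: \<omega>) (simp_all add: contr_wedge_ev_basis[OF assms(1)] hook_alt_forms hook_apply)

lemma contr_sum_left: "contr f es (sum h S) \<omega> vs = (\<Sum>x\<in>S. contr f es (h x) \<omega> vs)"
  by (induction S rule: infinite_finite_induct) (simp_all del: fun_app, simp_all)

text \<open>Contraction by a product of vectors just inserts them, whichever basis computes it.
  Expanding \<open>a\<close> in the second basis therefore turns the sum for the first basis into
  the sum for the second.\<close>

lemma contr_basis_independent:
  assumes "basis_list F bs" "basis_list F cs" "\<omega> \<in> alt_forms F" "a \<in> alt_forms (dual_space F)"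
  shows "contr (coord bs) bs a \<omega> = contr (coord cs) cs a \<omega>"
proof
  fix vs
  have s: "set (nths cs I) \<subseteq> F" for I by (rule order_trans[OF set_nths_subset basis_list_subset[OF assms(2)]])
  have "contr (coord bs) bs a \<omega> vs = contr (coord bs) bs
     (\<Sum>I\<in>Pow {..<length cs}. a (nths (map (coord cs) cs) I) *\<^sub>R wedge_list F (nths cs I)) \<omega> vs"
    using multivector_expansion[OF assms(2,4)] by simp
  also have "\<dots> = (\<Sum>I\<in>Pow {..<length cs}. a (nths (map (coord cs) cs) I) * \<omega> (nths cs I @ vs))"
    by (simp add: contr_sum_left contr_wedge_list[OF assms(1,3) s])
  also have "\<dots> = contr (coord cs) cs a \<omega> vs" by (simp add: contr_eq_sum)
  finally show "contr (coord bs) bs a \<omega> vs = contr (coord cs) cs a \<omega> vs" .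
qed

text \<open>Frees \<open>contraction\<close> from the basis picked in its definition, so that a
  local frame can be used in every fibre.\<close>

lemma contraction_eq_contr:
  assumes "basis_list F bs" "\<omega> \<in> alt_forms F" "a \<in> alt_forms (dual_space F)"
  shows "contraction F a \<omega> = contr (coord bs) bs a \<omega>"
proof -
  have "basis_list F (SOME bs. basis_list F bs)" using assms(1) by (rule someI)
  moreover have "contraction F a \<omega> = contr (coord (SOME bs. basis_list F bs)) (SOME bs. basis_list F bs) a \<omega>"
    by (simp add: fun_eq_iff contraction_def Let_def contr_eq_sum dual_basis_eq)
  ultimately show ?thesis using contr_basis_independent assms by metis
qed

section \<open>Contraction into a top form\<close>

lemma basis_list_length: "basis_list F bs \<Longrightarrow> length bs = dim F"
  by (metis basis_list_def dim_span_eq_card_independent distinct_card)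

lemma nths_perm_basis:
  assumes "basis_list F bs"
  shows "basis_list F (nths bs I @ nths bs (- I))" "coord (nths bs I @ nths bs (- I)) = coord bs"
proof -
  have s: "set (nths bs I @ nths bs (- I)) = set bs"
    by (auto simp: set_nths in_set_conv_nth) blast
  have d: "distinct (nths bs I @ nths bs (- I))"
    using assms by (auto simp: basis_list_def distinct_nthsI set_nths nth_eq_iff_index_eq)
  show "basis_list F (nths bs I @ nths bs (- I))" using assms s d by (simp add: basis_list_def)
  show "coord (nths bs I @ nths bs (- I)) = coord bs" using s by (simp add: coord_def fun_eq_iff)
qed

text \<open>Only the index set of all positions of \<open>s\<close> survives: a proper subset of it
  gives a list too short for \<mu>, and any position belonging to \<open>t\<close> repeats one of
  the arguments \<open>t\<close>.\<close>

lemma contr_top: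
  assumes "\<mu> \<in> alt_forms F" "\<And>vs. length vs \<noteq> n \<Longrightarrow> \<mu> vs = 0" "length s + length t = n"
  shows "contr f (s @ t) a \<mu> t = a (map f s) * \<mu> (s @ t)"
proof -
  have "contr f (s @ t) a \<mu> t = (\<Sum>I\<in>{{..<length s}}. a (nths (map f (s @ t)) I) * \<mu> (nths (s @ t) I @ t))"
    unfolding contr_eq_sum
  proof (rule sum.mono_neutral_right)
    show "\<forall>I\<in>Pow {..<length (s @ t)} - {{..<length s}}. a (nths (map f (s @ t)) I) * \<mu> (nths (s @ t) I @ t) = 0"
    proof
      fix I assume I: "I \<in> Pow {..<length (s @ t)} - {{..<length s}}"
      have "\<mu> (nths (s @ t) I @ t) = 0"
      proof (cases "I \<subseteq> {..<length s}")
        case True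
        with I have "card I < length s"
          using psubset_card_mono[of "{..<length s}" I] by auto
        moreover have "{i. i < length (s @ t) \<and> i \<in> I} = I" using I by auto
        ultimately have "length (nths (s @ t) I @ t) \<noteq> n" using assms(3) by (simp add: length_nths)
        then show ?thesis by (rule assms(2))
      next
        case False
        then obtain i where "i \<in> I" "\<not> i < length s" by blast
        then have i: "i \<in> I" "length s \<le> i" "i < length (s @ t)" using I by auto
        have "(s @ t) ! i \<in> set (nths (s @ t) I)" using i unfolding set_nths by blast
        moreover have "(s @ t) ! i = t ! (i - length s)" "i - length s < length t" using i by (auto simp: nth_append)
        ultimately have "\<not> distinct (nths (s @ t) I @ t)"
          by (metis IntI distinct_append empty_iff nth_mem)
        then show ?thesis by (rule alt_formsD(4)[OF assms(1)])
      qed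
      then show "a (nths (map f (s @ t)) I) * \<mu> (nths (s @ t) I @ t) = 0" by simp
    qed
  qed auto
  then show ?thesis by simp
qed

definition top_form :: "'v::real_vector set \<Rightarrow> ('v list \<Rightarrow> real) \<Rightarrow> bool" where
  "top_form F \<mu> \<longleftrightarrow> \<mu> \<in> alt_forms F \<and> (\<forall>vs. length vs \<noteq> dim F \<longrightarrow> \<mu> vs = 0) \<and> \<mu> \<noteq> 0"

lemma top_form_basis_nonzero:
  assumes "basis_list F bs" "top_form F \<mu>"
  shows "\<mu> bs \<noteq> 0"
proof
  assume 0: "\<mu> bs = 0"
  have "\<mu> = 0"
  proof (rule form_eqI[OF assms(1)])
    fix J assume J: "J \<subseteq> {..<length bs}"
    show "\<mu> (nths bs J) = 0 (nths bs J)"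
    proof (cases "J = {..<length bs}")
      case True then show ?thesis using 0 by simp
    next
      case False
      then have "card J < length bs" using J psubset_card_mono[of "{..<length bs}" J] by auto
      moreover have "{i. i < length bs \<and> i \<in> J} = J" using J by auto
      ultimately have "length (nths bs J) \<noteq> dim F" using basis_list_length[OF assms(1)] by (simp add: length_nths)
      then show ?thesis using assms(2) by (simp add: top_form_def)
    qed
  qed (use assms(2) in \<open>auto simp: top_form_def alt_forms_lin\<close>)
  then show False using assms(2) by (simp add: top_form_def)
qed

lemma contraction_top:
  assumes "basis_list F (s @ t)" "top_form F \<mu>" "a \<in> alt_forms (dual_space F)"
  shows "contraction F a \<mu> t = a (map (coord (s @ t)) s) * \<mu> (s @ t)"
  using assms basis_list_length[OF assms(1)]
  by (simp add: contraction_eq_contr[OF assms(1)] top_form_def) (rule contr_top, auto)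

text \<open>In a basis the map a \<mapsto> i_a \<mu> is diagonal: the coefficient on
  \<open>I\<close> becomes, up to a nonzero factor, the value on the complementary basis vectors.
  Injectivity and surjectivity are read off from this.\<close>

lemma contraction_top_nths:
  assumes "basis_list F bs" "top_form F \<mu>" "a \<in> alt_forms (dual_space F)"
  shows "contraction F a \<mu> (nths bs (- I)) = a (nths (map (coord bs) bs) I) * \<mu> (nths bs I @ nths bs (- I))"
  using contraction_top[OF nths_perm_basis(1)[OF assms(1)] assms(2,3)]
  by (simp add: nths_perm_basis(2)[OF assms(1)] nths_map)

lemma contraction_top_inject:
  assumes "basis_list F bs" "top_form F \<mu>" "a \<in> alt_forms (dual_space F)" "b \<in> alt_forms (dual_space F)"
    and eq: "contraction F a \<mu> = contraction F b \<mu>"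
  shows "a = b"
proof (rule multivector_eqI[OF assms(1,3,4)])
  fix I
  have "a (nths (map (coord bs) bs) I) * \<mu> (nths bs I @ nths bs (- I))
    = b (nths (map (coord bs) bs) I) * \<mu> (nths bs I @ nths bs (- I))"
    using contraction_top_nths[OF assms(1,2)] assms(3,4) eq by metis
  then show "a (nths (map (coord bs) bs) I) = b (nths (map (coord bs) bs) I)"
    using top_form_basis_nonzero[OF nths_perm_basis(1)[OF assms(1)] assms(2)] by simp
qed

lemma contraction_alt_forms:
  assumes "basis_list F bs" "\<omega> \<in> alt_forms F" "a \<in> alt_forms (dual_space F)"
  shows "contraction F a \<omega> \<in> alt_forms F"
  unfolding contraction_eq_contr[OF assms] using assms basis_list_subset by (intro contr_alt_forms) auto

lemma contraction_top_surj:
  assumes "basis_list F bs" "top_form F \<mu>" "\<eta> \<in> alt_forms F"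
  shows "\<exists>a\<in>alt_forms (dual_space F). contraction F a \<mu> = \<eta>"
proof -
  \<comment> \<open>The solution of the diagonal system: divide by the value of \<mu> on the
    reordered basis.\<close>
  define a where "a = (\<Sum>I\<in>Pow {..<length bs}.
    (\<eta> (nths bs (- I)) / \<mu> (nths bs I @ nths bs (- I))) *\<^sub>R wedge_list F (nths bs I))"
  have "set (nths bs I) \<subseteq> F" for I by (rule order_trans[OF set_nths_subset basis_list_subset[OF assms(1)]])
  then have a: "a \<in> alt_forms (dual_space F)"
    unfolding a_def by (intro sum_alt_forms alt_forms_lin wedge_list_alt_forms)
  have "contraction F a \<mu> = \<eta>"
  proof (rule form_eqI[OF assms(1) _ assms(3)])
    show "contraction F a \<mu> \<in> alt_forms F"
      using assms(2) a by (intro contraction_alt_forms[OF assms(1)]) (auto simp: top_form_def)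
    fix J assume J: "J \<subseteq> {..<length bs}"
    define I where "I = {..<length bs} - J"
    have I: "nths bs (- I) = nths bs J"
    proof -
      have "- I \<inter> {..<length bs} = J" using J by (auto simp: I_def)
      then show ?thesis using nths_Int_lessThan[of bs "- I"] by metis
    qed
    have "a (nths (map (coord bs) bs) I) = \<eta> (nths bs (- I)) / \<mu> (nths bs I @ nths bs (- I))"
      unfolding a_def by (rule wedge_list_sum_nths[OF assms(1)]) (auto simp: I_def)
    then have "contraction F a \<mu> (nths bs (- I)) = \<eta> (nths bs (- I))"
      using contraction_top_nths[OF assms(1,2) a, of I] top_form_basis_nonzero[OF nths_perm_basis(1)[OF assms(1)] assms(2), of I]
      by simp
    then show "contraction F a \<mu> (nths bs J) = \<eta> (nths bs J)" by (simp add: I)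
  qed
  with a show ?thesis by blast
qed


section \<open>Cartan calculus over a Lie--Rinehart algebra\<close>

text \<open>The algebra of a Lie algebroid without the manifold. Functions and sections are subsets
  \<open>C\<close> and \<open>S\<close> of larger types, as smoothness is a predicate;
  \<open>lb_self\<close> is listed beside \<open>lb_skew\<close> because 2 [X, X] = 0 need not give
  [X, X] = 0 in an abstract group.\<close>

locale lie_rinehart =
  fixes S :: "'s::ab_group_add set" and C :: "'c::comm_ring_1 set"
    and smul :: "'c \<Rightarrow> 's \<Rightarrow> 's" and lb :: "'s \<Rightarrow> 's \<Rightarrow> 's" and rho :: "'s \<Rightarrow> 'c \<Rightarrow> 'c"
  assumes C_add: "f \<in> C \<Longrightarrow> g \<in> C \<Longrightarrow> f + g \<in> C" and C_mult: "f \<in> C \<Longrightarrow> g \<in> C \<Longrightarrow> f * g \<in> C"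
    and C_0: "0 \<in> C" and C_uminus: "f \<in> C \<Longrightarrow> - f \<in> C"
    and S_add: "X \<in> S \<Longrightarrow> Y \<in> S \<Longrightarrow> X + Y \<in> S" and S_0: "0 \<in> S" and S_uminus: "X \<in> S \<Longrightarrow> - X \<in> S"
    and S_smul: "f \<in> C \<Longrightarrow> X \<in> S \<Longrightarrow> smul f X \<in> S"
    and rho_C: "X \<in> S \<Longrightarrow> f \<in> C \<Longrightarrow> rho X f \<in> C"
    and rho_add: "X \<in> S \<Longrightarrow> f \<in> C \<Longrightarrow> g \<in> C \<Longrightarrow> rho X (f + g) = rho X f + rho X g"
    and rho_mult: "X \<in> S \<Longrightarrow> f \<in> C \<Longrightarrow> g \<in> C \<Longrightarrow> rho X (f * g) = rho X f * g + f * rho X g"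
    and rho_vec_add: "X \<in> S \<Longrightarrow> Y \<in> S \<Longrightarrow> f \<in> C \<Longrightarrow> rho (X + Y) f = rho X f + rho Y f"
    and rho_smul: "X \<in> S \<Longrightarrow> f \<in> C \<Longrightarrow> g \<in> C \<Longrightarrow> rho (smul g X) f = g * rho X f"
    and lb_S: "X \<in> S \<Longrightarrow> Y \<in> S \<Longrightarrow> lb X Y \<in> S"
    and lb_add: "X \<in> S \<Longrightarrow> Y \<in> S \<Longrightarrow> Z \<in> S \<Longrightarrow> lb X (Y + Z) = lb X Y + lb X Z"
    and lb_skew: "X \<in> S \<Longrightarrow> Y \<in> S \<Longrightarrow> lb X Y = - lb Y X"
    and lb_self: "X \<in> S \<Longrightarrow> lb X X = 0"
    and lb_jacobi: "X \<in> S \<Longrightarrow> Y \<in> S \<Longrightarrow> Z \<in> S \<Longrightarrow> lb X (lb Y Z) + lb Y (lb Z X) + lb Z (lb X Y) = 0"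
    and lb_leibniz: "X \<in> S \<Longrightarrow> Y \<in> S \<Longrightarrow> f \<in> C \<Longrightarrow> lb X (smul f Y) = smul f (lb X Y) + smul (rho X f) Y"
    and rho_lb: "X \<in> S \<Longrightarrow> Y \<in> S \<Longrightarrow> f \<in> C \<Longrightarrow> rho (lb X Y) f = rho X (rho Y f) - rho Y (rho X f)"
begin

lemma C_diff: "f \<in> C \<Longrightarrow> g \<in> C \<Longrightarrow> f - g \<in> C"
  using C_add[of f "- g"] C_uminus by simp

lemma rho_0: "X \<in> S \<Longrightarrow> rho X 0 = 0"
  using rho_add[of X 0 0] C_0 by simp

lemma rho_uminus: "X \<in> S \<Longrightarrow> f \<in> C \<Longrightarrow> rho X (- f) = - rho X f"
  using rho_add[of X f "- f"] C_uminus rho_0 by (simp add: eq_neg_iff_add_eq_0 add.commute)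

lemma rho_diff: "X \<in> S \<Longrightarrow> f \<in> C \<Longrightarrow> g \<in> C \<Longrightarrow> rho X (f - g) = rho X f - rho X g"
  using rho_add[of X f "- g"] C_uminus rho_uminus by simp

lemma lb_add_left: "X \<in> S \<Longrightarrow> Y \<in> S \<Longrightarrow> Z \<in> S \<Longrightarrow> lb (X + Y) Z = lb X Z + lb Y Z"
  using lb_skew[of "X + Y" Z] lb_skew[of X Z] lb_skew[of Y Z] lb_add[of Z X Y] S_add by simp

lemma lb_0: "X \<in> S \<Longrightarrow> lb X 0 = 0"
  using lb_add[of X 0 0] S_0 by simp

lemma lb_uminus: "X \<in> S \<Longrightarrow> Y \<in> S \<Longrightarrow> lb X (- Y) = - lb X Y"
  using lb_add[of X Y "- Y"] S_uminus lb_0 by (simp add: eq_neg_iff_add_eq_0 add.commute)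

lemma lb_lb: "X \<in> S \<Longrightarrow> Y \<in> S \<Longrightarrow> Z \<in> S \<Longrightarrow> lb X (lb Y Z) = lb (lb X Y) Z + lb Y (lb X Z)"
  using lb_jacobi[of X Y Z] lb_skew[of Z "lb X Y"] lb_skew[of Z X] lb_uminus[of Y "lb X Z"] lb_S
  by (simp add: algebra_simps eq_neg_iff_add_eq_0)

text \<open>
  A form is a function on lists of sections.  The Lie derivative and the differential are defined by
  recursion on the arguments: \<open>i\<^sub>Z L\<^sub>X = L\<^sub>X i\<^sub>Z - i\<^sub>[\<^sub>X\<^sub>,\<^sub>Z\<^sub>]\<close> and \<open>i\<^sub>X d = L\<^sub>X - d i\<^sub>X\<close>.
\<close>

primrec LX :: "'s \<Rightarrow> 's list \<Rightarrow> ('s list \<Rightarrow> 'c) \<Rightarrow> 'c" where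
  "LX X [] W = rho X (W [])"
| "LX X (Z # Zs) W = LX X Zs (\<lambda>ws. W (Z # ws)) - W (lb X Z # Zs)"

primrec dd :: "'s list \<Rightarrow> ('s list \<Rightarrow> 'c) \<Rightarrow> 'c" where
  "dd [] W = 0"
| "dd (X # Zs) W = LX X Zs W - dd Zs (\<lambda>ws. W (X # ws))"

text \<open>Tests the first slot only, and the first two for alternation; \<open>alt_map\<close>
  demands this behind every prefix. The recursions act on the head of the list, so properties
  propagate in this form.\<close>

definition hd_ok :: "('s list \<Rightarrow> 'c) \<Rightarrow> bool" where
  "hd_ok V \<longleftrightarrow> (\<forall>ws. set ws \<subseteq> S \<longrightarrow> V ws \<in> C \<and>
     (\<forall>u\<in>S. \<forall>v\<in>S. V ((u + v) # ws) = V (u # ws) + V (v # ws)) \<and>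
     (\<forall>f\<in>C. \<forall>v\<in>S. V (smul f v # ws) = f * V (v # ws)) \<and>
     (\<forall>v\<in>S. V (v # v # ws) = 0))"

definition alt_map :: "('s list \<Rightarrow> 'c) \<Rightarrow> bool" where
  "alt_map W \<longleftrightarrow> (\<forall>us. set us \<subseteq> S \<longrightarrow> hd_ok (\<lambda>ws. W (us @ ws)))"

lemma alt_map_hd: "alt_map W \<Longrightarrow> hd_ok W"
  unfolding alt_map_def by (drule spec[of _ "[]"]) simp

lemma alt_map_ins: "alt_map W \<Longrightarrow> v \<in> S \<Longrightarrow> alt_map (\<lambda>ws. W (v # ws))"
  unfolding alt_map_def
proof (intro allI impI)
  fix us assume W: "\<forall>us. set us \<subseteq> S \<longrightarrow> hd_ok (\<lambda>ws. W (us @ ws))" and "v \<in> S" "set us \<subseteq> S"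
  then show "hd_ok (\<lambda>ws. W (v # us @ ws))" using W[rule_format, of "v # us"] by simp
qed

lemma alt_mapD:
  assumes "alt_map W" "set ws \<subseteq> S"
  shows "W ws \<in> C" "u \<in> S \<Longrightarrow> v \<in> S \<Longrightarrow> W ((u + v) # ws) = W (u # ws) + W (v # ws)"
    "f \<in> C \<Longrightarrow> v \<in> S \<Longrightarrow> W (smul f v # ws) = f * W (v # ws)" "v \<in> S \<Longrightarrow> W (v # v # ws) = 0"
  using alt_map_hd[OF assms(1)] assms(2) by (auto simp: hd_ok_def)

lemma alt_map_0: "alt_map W \<Longrightarrow> set ws \<subseteq> S \<Longrightarrow> W (0 # ws) = 0"
  using alt_mapD(2)[of W ws 0 0] S_0 by simp

lemma alt_map_uminus: "alt_map W \<Longrightarrow> set ws \<subseteq> S \<Longrightarrow> v \<in> S \<Longrightarrow> W (- v # ws) = - W (v # ws)"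
  using alt_mapD(2)[of W ws v "- v"] alt_map_0[of W ws] S_uminus by (simp add: eq_neg_iff_add_eq_0 add.commute)

lemma alt_map_swap:
  assumes "alt_map W" "set ws \<subseteq> S" "u \<in> S" "v \<in> S"
  shows "W (u # v # ws) = - W (v # u # ws)"
proof -
  have "0 = W ((u + v) # (u + v) # ws)" using alt_mapD(4)[OF assms(1,2)] assms S_add by simp
  also have "\<dots> = W (u # (u + v) # ws) + W (v # (u + v) # ws)"
    using alt_mapD(2)[OF assms(1), of "(u + v) # ws"] assms S_add by simp
  also have "\<dots> = W (u # u # ws) + W (u # v # ws) + (W (v # u # ws) + W (v # v # ws))"
    using alt_mapD(2)[OF alt_map_ins[OF assms(1)] assms(2)] assms by simp
  also have "\<dots> = W (u # v # ws) + W (v # u # ws)"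
    using alt_mapD(4)[OF assms(1,2)] assms by simp
  finally show ?thesis by (simp add: eq_neg_iff_add_eq_0)
qed

lemma hd_ok_diff: "hd_ok V \<Longrightarrow> hd_ok V' \<Longrightarrow> hd_ok (\<lambda>ws. V ws - V' ws)"
  unfolding hd_ok_def by (auto simp: C_diff algebra_simps)

definition C_valued :: "('s list \<Rightarrow> 'c) \<Rightarrow> bool" where
  "C_valued W \<longleftrightarrow> (\<forall>ws. set ws \<subseteq> S \<longrightarrow> W ws \<in> C)"

lemma C_valued_ins: "C_valued W \<Longrightarrow> Z \<in> S \<Longrightarrow> C_valued (\<lambda>ws. W (Z # ws))"
  by (simp add: C_valued_def)

lemma C_valued_Nil: "C_valued W \<Longrightarrow> W [] \<in> C"
  by (simp add: C_valued_def)

lemma alt_map_C_valued: "alt_map W \<Longrightarrow> C_valued W"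
  by (simp add: C_valued_def alt_mapD(1))

lemma LX_cong:
  "X \<in> S \<Longrightarrow> set Zs \<subseteq> S \<Longrightarrow> (\<And>ws. set ws \<subseteq> S \<Longrightarrow> W ws = W' ws) \<Longrightarrow> LX X Zs W = LX X Zs W'"
proof (induction Zs arbitrary: W W')
  case (Cons Z Zs)
  have "LX X Zs (\<lambda>ws. W (Z # ws)) = LX X Zs (\<lambda>ws. W' (Z # ws))" using Cons.prems by (intro Cons.IH) auto
  then show ?case using Cons.prems by (simp add: lb_S)
qed simp

lemma dd_cong:
  "set Zs \<subseteq> S \<Longrightarrow> (\<And>ws. set ws \<subseteq> S \<Longrightarrow> W ws = W' ws) \<Longrightarrow> dd Zs W = dd Zs W'"
proof (induction Zs arbitrary: W W')
  case (Cons Z Zs)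
  have "dd Zs (\<lambda>ws. W (Z # ws)) = dd Zs (\<lambda>ws. W' (Z # ws))" using Cons.prems by (intro Cons.IH) auto
  moreover have "LX Z Zs W = LX Z Zs W'" using Cons.prems by (intro LX_cong) auto
  ultimately show ?case by simp
qed simp

lemma LX_C_valued: "X \<in> S \<Longrightarrow> set Zs \<subseteq> S \<Longrightarrow> C_valued W \<Longrightarrow> LX X Zs W \<in> C"
  by (induction Zs arbitrary: W) (auto simp: C_valued_Nil rho_C C_valued_ins C_valued_def lb_S intro!: C_diff)

lemma dd_C_valued: "set Zs \<subseteq> S \<Longrightarrow> C_valued W \<Longrightarrow> dd Zs W \<in> C"
  by (induction Zs arbitrary: W) (auto simp: C_0 C_valued_ins LX_C_valued intro!: C_diff)

lemma LX_add:
  "X \<in> S \<Longrightarrow> set Zs \<subseteq> S \<Longrightarrow> C_valued W \<Longrightarrow> C_valued W' \<Longrightarrow> LX X Zs (\<lambda>ws. W ws + W' ws) = LX X Zs W + LX X Zs W'"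
  by (induction Zs arbitrary: W W') (simp_all add: C_valued_Nil rho_add C_valued_ins)

lemma LX_diff:
  "X \<in> S \<Longrightarrow> set Zs \<subseteq> S \<Longrightarrow> C_valued W \<Longrightarrow> C_valued W' \<Longrightarrow> LX X Zs (\<lambda>ws. W ws - W' ws) = LX X Zs W - LX X Zs W'"
  by (induction Zs arbitrary: W W') (simp_all add: C_valued_Nil rho_diff C_valued_ins)

lemma LX_uminus:
  "X \<in> S \<Longrightarrow> set Zs \<subseteq> S \<Longrightarrow> C_valued W \<Longrightarrow> LX X Zs (\<lambda>ws. - W ws) = - LX X Zs W"
  by (induction Zs arbitrary: W) (simp_all add: C_valued_Nil rho_uminus C_valued_ins)

lemma LX_0: "X \<in> S \<Longrightarrow> LX X Zs (\<lambda>ws. 0) = 0"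
  by (induction Zs) (simp_all add: rho_0)

lemma LX_mult:
  "X \<in> S \<Longrightarrow> set Zs \<subseteq> S \<Longrightarrow> C_valued W \<Longrightarrow> f \<in> C \<Longrightarrow>
    LX X Zs (\<lambda>ws. f * W ws) = f * LX X Zs W + rho X f * W Zs"
  by (induction Zs arbitrary: W) (simp_all add: C_valued_Nil rho_mult C_valued_ins algebra_simps)

lemma dd_add:
  "set Zs \<subseteq> S \<Longrightarrow> C_valued W \<Longrightarrow> C_valued W' \<Longrightarrow> dd Zs (\<lambda>ws. W ws + W' ws) = dd Zs W + dd Zs W'"
  by (induction Zs arbitrary: W W') (simp_all add: LX_add C_valued_ins)

lemma dd_diff:
  "set Zs \<subseteq> S \<Longrightarrow> C_valued W \<Longrightarrow> C_valued W' \<Longrightarrow> dd Zs (\<lambda>ws. W ws - W' ws) = dd Zs W - dd Zs W'"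
  by (induction Zs arbitrary: W W') (simp_all add: LX_diff C_valued_ins)

lemma dd_uminus: "set Zs \<subseteq> S \<Longrightarrow> C_valued W \<Longrightarrow> dd Zs (\<lambda>ws. - W ws) = - dd Zs W"
  by (induction Zs arbitrary: W) (simp_all add: LX_uminus C_valued_ins)

lemma dd_0: "set Zs \<subseteq> S \<Longrightarrow> dd Zs (\<lambda>ws. 0) = 0"
  by (induction Zs) (simp_all add: LX_0)

lemma LX_vec_add:
  "X \<in> S \<Longrightarrow> Y \<in> S \<Longrightarrow> set Zs \<subseteq> S \<Longrightarrow> alt_map W \<Longrightarrow> LX (X + Y) Zs W = LX X Zs W + LX Y Zs W"
proof (induction Zs arbitrary: W)
  case Nil
  then show ?case using alt_mapD(1)[of W "[]"] by (simp add: rho_vec_add)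
next
  case (Cons Z Zs)
  then show ?case using alt_mapD(2)[OF Cons.prems(4), of Zs "lb X Z" "lb Y Z"]
    by (simp add: alt_map_ins lb_add_left lb_S)
qed

text \<open>In a slot f v, the derivative of f produced by L_X is cancelled by the Leibniz term of
  [X, f v]. For equal arguments v, v the two terms containing [X, v] cancel by antisymmetry.\<close>

lemma LX_hd_ok:
  assumes X: "X \<in> S" and W: "alt_map W"
  shows "hd_ok (\<lambda>ws. LX X ws W)"
  unfolding hd_ok_def
proof (intro allI impI conjI ballI)
  fix ws assume ws: "set ws \<subseteq> S"
  show "LX X ws W \<in> C" using X W ws by (simp add: LX_C_valued alt_map_C_valued)
  show "LX X ((u + v) # ws) W = LX X (u # ws) W + LX X (v # ws) W" if "u \<in> S" "v \<in> S" for u v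
  proof -
    have "LX X ws (\<lambda>zs. W ((u + v) # zs)) = LX X ws (\<lambda>zs. W (u # zs) + W (v # zs))"
      using X W ws that by (intro LX_cong) (auto simp: alt_mapD)
    then show ?thesis using X W ws that
      by (simp add: LX_add alt_map_C_valued alt_map_ins lb_add alt_mapD(2) lb_S)
  qed
  show "LX X (smul f v # ws) W = f * LX X (v # ws) W" if "f \<in> C" "v \<in> S" for f v
  proof -
    have "LX X ws (\<lambda>zs. W (smul f v # zs)) = LX X ws (\<lambda>zs. f * W (v # zs))"
      using X W ws that by (intro LX_cong) (auto simp: alt_mapD)
    then show ?thesis using X W ws that
      by (simp add: LX_mult alt_map_C_valued alt_map_ins lb_leibniz alt_mapD(2,3) lb_S S_smul rho_C algebra_simps)
  qed
  show "LX X (v # v # ws) W = 0" if "v \<in> S" for v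
  proof -
    have "LX X ws (\<lambda>zs. W (v # v # zs)) = LX X ws (\<lambda>zs. 0)"
      using X W ws that by (intro LX_cong) (auto simp: alt_mapD)
    then show ?thesis using X W ws that alt_map_swap[OF W ws, of v "lb X v"]
      by (simp add: LX_0 lb_S)
  qed
qed

lemma LX_alt_map:
  assumes "X \<in> S" "alt_map W"
  shows "alt_map (\<lambda>ws. LX X ws W)"
  unfolding alt_map_def
proof (intro allI impI)
  fix us assume "set us \<subseteq> S"
  then show "hd_ok (\<lambda>ws. LX X (us @ ws) W)" using assms(2)
  proof (induction us arbitrary: W)
    case Nil
    then show ?case using LX_hd_ok[OF assms(1)] by simp
  next
    case (Cons u us)
    have "hd_ok (\<lambda>ws. W ((lb X u # us) @ ws))"
      using Cons.prems assms(1) lb_S unfolding alt_map_def by (metis insert_subset list.simps(15))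
    moreover have "hd_ok (\<lambda>ws. LX X (us @ ws) (\<lambda>ws. W (u # ws)))"
      using Cons.prems by (intro Cons.IH alt_map_ins) auto
    ultimately show ?case using hd_ok_diff by simp
  qed
qed

lemma dd_swap:
  assumes W: "alt_map W" and m: "set ws \<subseteq> S" "u \<in> S" "v \<in> S"
  shows "dd (u # v # ws) W = - dd (v # u # ws) W"
proof -
  have "dd ws (\<lambda>zs. W (u # v # zs)) = dd ws (\<lambda>zs. - W (v # u # zs))"
    using m W alt_map_swap by (intro dd_cong) auto
  also have "\<dots> = - dd ws (\<lambda>zs. W (v # u # zs))"
    using m W by (intro dd_uminus alt_map_C_valued alt_map_ins) auto
  finally have 1: "dd ws (\<lambda>zs. W (u # v # zs)) = - dd ws (\<lambda>zs. W (v # u # zs))" .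
  have "W (lb u v # ws) = - W (lb v u # ws)"
    using lb_skew[of u v] alt_map_uminus[OF W m(1), of "lb v u"] m lb_S by simp
  with 1 show ?thesis by (simp add: algebra_simps)
qed

text \<open>The first argument of \<open>dd\<close> becomes the direction of a Lie derivative, which
  is not linear over functions. A swap with the second argument puts f v where the tensoriality of
  L_y W and the induction hypothesis for i_y W apply.\<close>

lemma dd_smul:
  assumes "alt_map W" "set ws \<subseteq> S" "f \<in> C" "v \<in> S"
  shows "dd (smul f v # ws) W = f * dd (v # ws) W"
  using assms
proof (induction ws arbitrary: W)
  case Nil
  then show ?case by (simp add: rho_smul alt_mapD(1)[of W "[]"])
next
  case (Cons y ws)
  have m: "y \<in> S" "set ws \<subseteq> S" "smul f v \<in> S" using Cons.prems by (auto simp: S_smul)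
  have "dd (smul f v # y # ws) W = - dd (y # smul f v # ws) W"
    using m Cons.prems by (intro dd_swap) auto
  also have "dd (y # smul f v # ws) W = LX y (smul f v # ws) W - dd (smul f v # ws) (\<lambda>ws. W (y # ws))" by simp
  also have "LX y (smul f v # ws) W = f * LX y (v # ws) W"
    using alt_mapD(3)[OF LX_alt_map[OF m(1) Cons.prems(1)] m(2) Cons.prems(3,4)] .
  also have "dd (smul f v # ws) (\<lambda>ws. W (y # ws)) = f * dd (v # ws) (\<lambda>ws. W (y # ws))"
    using Cons.prems m by (intro Cons.IH alt_map_ins) auto
  also have "f * LX y (v # ws) W - f * dd (v # ws) (\<lambda>ws. W (y # ws)) = f * dd (y # v # ws) W"
    by (simp add: algebra_simps)
  also have "dd (y # v # ws) W = - dd (v # y # ws) W"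
    using m Cons.prems by (intro dd_swap) auto
  finally show ?case by (simp only: mult_minus_right minus_minus)
qed

lemma dd_hd_ok:
  assumes W: "alt_map W"
  shows "hd_ok (\<lambda>ws. dd ws W)"
  unfolding hd_ok_def
proof (intro allI impI conjI ballI)
  fix ws assume ws: "set ws \<subseteq> S"
  show "dd ws W \<in> C" using W ws by (simp add: dd_C_valued alt_map_C_valued)
  show "dd ((u + v) # ws) W = dd (u # ws) W + dd (v # ws) W" if "u \<in> S" "v \<in> S" for u v
  proof -
    have "dd ws (\<lambda>zs. W ((u + v) # zs)) = dd ws (\<lambda>zs. W (u # zs) + W (v # zs))"
      using W ws that by (intro dd_cong) (auto simp: alt_mapD)
    then show ?thesis using W ws that
      by (simp add: dd_add alt_map_C_valued alt_map_ins LX_vec_add)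
  qed
  show "dd (smul f v # ws) W = f * dd (v # ws) W" if "f \<in> C" "v \<in> S" for f v
    using dd_smul[OF W ws that] .
  show "dd (v # v # ws) W = 0" if "v \<in> S" for v
  proof -
    have "dd ws (\<lambda>zs. W (v # v # zs)) = dd ws (\<lambda>zs. 0)"
      using W ws that by (intro dd_cong) (auto simp: alt_mapD)
    then show ?thesis using W ws that by (simp add: dd_0 lb_self alt_map_0)
  qed
qed

lemma dd_alt_map:
  assumes "alt_map W"
  shows "alt_map (\<lambda>ws. dd ws W)"
  unfolding alt_map_def
proof (intro allI impI)
  fix us assume "set us \<subseteq> S"
  then show "hd_ok (\<lambda>ws. dd (us @ ws) W)" using assms
  proof (induction us arbitrary: W)
    case Nil
    then show ?case using dd_hd_ok by simp
  next
    case (Cons u us)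
    have "alt_map (\<lambda>ws. LX u ws W)" using Cons.prems by (intro LX_alt_map) auto
    then have "hd_ok (\<lambda>ws. LX u (us @ ws) W)" using Cons.prems(1) by (simp add: alt_map_def)
    moreover have "hd_ok (\<lambda>ws. dd (us @ ws) (\<lambda>ws. W (u # ws)))"
      using Cons.prems by (intro Cons.IH alt_map_ins) auto
    ultimately show ?case using hd_ok_diff by simp
  qed
qed

text \<open>On functions this is the compatibility of the anchor with brackets; each further
  argument contributes the Jacobi identity in derivation form.\<close>

lemma LX_lb:
  assumes "X \<in> S" "Y \<in> S" "set Zs \<subseteq> S" "alt_map W"
  shows "LX X Zs (\<lambda>ws. LX Y ws W) - LX Y Zs (\<lambda>ws. LX X ws W) = LX (lb X Y) Zs W"
  using assms(3,4)
proof (induction Zs arbitrary: W)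
  case Nil
  then show ?case using assms(1,2) by (simp add: rho_lb alt_mapD(1)[of W "[]"])
next
  case (Cons Z Zs)
  have m: "Z \<in> S" "set Zs \<subseteq> S" using Cons.prems by auto
  have a: "alt_map (\<lambda>ws. W (Z # ws))" "alt_map (\<lambda>ws. W (lb X Z # ws))" "alt_map (\<lambda>ws. W (lb Y Z # ws))"
    using Cons.prems m assms(1,2) by (auto intro!: alt_map_ins lb_S)
  note c = alt_map_C_valued[OF a(1)] alt_map_C_valued[OF a(2)] alt_map_C_valued[OF a(3)]
    alt_map_C_valued[OF LX_alt_map[OF assms(1) a(1)]] alt_map_C_valued[OF LX_alt_map[OF assms(2) a(1)]]
  have IH: "LX X Zs (\<lambda>ws. LX Y ws (\<lambda>ws. W (Z # ws))) - LX Y Zs (\<lambda>ws. LX X ws (\<lambda>ws. W (Z # ws)))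
    = LX (lb X Y) Zs (\<lambda>ws. W (Z # ws))"
    by (rule Cons.IH[OF m(2) a(1)])
  have J: "W (lb X (lb Y Z) # Zs) = W (lb (lb X Y) Z # Zs) + W (lb Y (lb X Z) # Zs)"
    using lb_lb[OF assms(1,2) m(1)] alt_mapD(2)[OF Cons.prems(2) m(2)] assms(1,2) m by (simp add: lb_S)
  show ?case using IH J assms(1,2) m
    by (simp add: LX_diff c algebra_simps)
qed

text \<open>After insertion of Y the two sides differ by L_X L_Y - L_Y L_X - L_[X,Y], which
  vanishes, and by the same difference for i_Y W, which the induction handles.\<close>

lemma LX_dd:
  assumes "X \<in> S" "set Zs \<subseteq> S" "alt_map W"
  shows "LX X Zs (\<lambda>ws. dd ws W) = dd Zs (\<lambda>ws. LX X ws W)"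
  using assms(2,3)
proof (induction Zs arbitrary: W)
  case Nil
  then show ?case using assms(1) by (simp add: rho_0)
next
  case (Cons Y Zs)
  have m: "Y \<in> S" "set Zs \<subseteq> S" "lb X Y \<in> S" using Cons.prems assms(1) by (auto intro: lb_S)
  have a: "alt_map (\<lambda>ws. W (Y # ws))" "alt_map (\<lambda>ws. W (lb X Y # ws))"
    using Cons.prems m by (auto intro!: alt_map_ins)
  note c = alt_map_C_valued[OF LX_alt_map[OF m(1) Cons.prems(2)]] alt_map_C_valued[OF dd_alt_map[OF a(1)]]
    alt_map_C_valued[OF LX_alt_map[OF assms(1) a(1)]] alt_map_C_valued[OF a(2)]
  have IH: "LX X Zs (\<lambda>ws. dd ws (\<lambda>ws. W (Y # ws))) = dd Zs (\<lambda>ws. LX X ws (\<lambda>ws. W (Y # ws)))"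
    by (rule Cons.IH[OF m(2) a(1)])
  show ?case
    using IH LX_lb[OF assms(1) m(1,2) Cons.prems(2)] assms(1) m
    by (simp add: LX_diff dd_diff c algebra_simps)
qed

text \<open>i_X d d = L_X d - d i_X d = L_X d - d L_X + d d i_X, where L_X commutes with d and the
  last term has one argument fewer.\<close>

lemma dd_dd:
  assumes "set Zs \<subseteq> S" "alt_map W"
  shows "dd Zs (\<lambda>ws. dd ws W) = 0"
  using assms
proof (induction Zs arbitrary: W)
  case Nil
  then show ?case by simp
next
  case (Cons X Zs)
  have m: "X \<in> S" "set Zs \<subseteq> S" using Cons.prems by auto
  have a: "alt_map (\<lambda>ws. W (X # ws))" using Cons.prems m by (auto intro!: alt_map_ins)
  note c = alt_map_C_valued[OF LX_alt_map[OF m(1) Cons.prems(2)]] alt_map_C_valued[OF dd_alt_map[OF a(1)]]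
  show ?case using Cons.IH[OF m(2) a] LX_dd[OF m Cons.prems(2)] m
    by (simp add: dd_diff c)
qed

section \<open>Comparison of the recursion with the Koszul formula\<close>

lemma alt_map_insert_nth:
  assumes "alt_map W" "set Zs \<subseteq> S" "v \<in> S" "j < length Zs"
  shows "W (v # nths Zs (- {j})) = (-1) ^ j * W (Zs[j := v])"
  using assms
proof (induction Zs arbitrary: W j)
  case (Cons Z Zs)
  show ?case
  proof (cases j)
    case 0
    have "{i. i \<noteq> (0::nat)} = - {0}" "{j. Suc j \<in> - {0}} = UNIV" by auto
    then show ?thesis using 0 by (simp add: nths_Cons nths_all)
  next
    case (Suc i)
    have s: "set (nths Zs (- {i})) \<subseteq> S" using Cons.prems(2) set_nths_subset[of Zs "- {i}"] by auto
    have "{k. Suc k \<in> - {Suc i}} = - {i}" by auto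
    then have "W (v # nths (Z # Zs) (- {j})) = W (v # Z # nths Zs (- {i}))"
      by (simp add: nths_Cons Suc)
    also have "\<dots> = - W (Z # v # nths Zs (- {i}))" using Cons.prems s by (intro alt_map_swap) auto
    also have "W (Z # v # nths Zs (- {i})) = (-1) ^ i * W (Z # Zs[i := v])"
      using Cons.prems Suc by (intro Cons.IH[of "\<lambda>ws. W (Z # ws)" i] alt_map_ins) auto
    finally show ?thesis by (simp add: Suc)
  qed
qed simp

lemma LX_eq_sum:
  "LX X Zs W = rho X (W Zs) - (\<Sum>j<length Zs. W (Zs[j := lb X (Zs ! j)]))"
proof (induction Zs arbitrary: W)
  case (Cons Z Zs)
  show ?case by (simp add: Cons.IH sum.lessThan_Suc_shift del: sum.lessThan_Suc)
qed simp

text \<open>Split off index 0 from both sums. The terms containing it assemble to L_X W once each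
  bracket with X is moved from the front back to its position; all others have X as an argument and
  form minus the Koszul expression of i_X W.\<close>

lemma dd_eq_koszul:
  assumes "alt_map W" "set Xs \<subseteq> S"
  shows "dd Xs W = (\<Sum>i<length Xs. (-1) ^ i * rho (Xs ! i) (W (nths Xs (- {i})))) +
     (\<Sum>j<length Xs. \<Sum>i<j. (-1) ^ (i + j) * W (lb (Xs ! i) (Xs ! j) # nths Xs (- {i, j})))"
  using assms
proof (induction Xs arbitrary: W)
  case (Cons X Zs)
  have m: "X \<in> S" "set Zs \<subseteq> S" and W: "alt_map W" using Cons.prems by auto
  have nm: "set (nths Zs A) \<subseteq> S" for A using m(2) set_nths_subset[of Zs A] by auto
  have e: "{k. Suc k \<in> - {0}} = UNIV" "{k. Suc k \<in> - {Suc i}} = - {i}"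
    "{k. Suc k \<in> - {0, Suc i}} = - {i}" "{k. Suc k \<in> - {Suc i, Suc j}} = - {i, j}" for i j :: nat by auto
  have n: "nths (X # Zs) (- {0}) = Zs" "nths (X # Zs) (- {Suc i}) = X # nths Zs (- {i})"
    "nths (X # Zs) (- {0, Suc i}) = nths Zs (- {i})" "nths (X # Zs) (- {Suc i, Suc j}) = X # nths Zs (- {i, j})" for i j
    unfolding nths_Cons e by (auto simp: nths_all)
  have 1: "(\<Sum>i<length (X # Zs). (-1) ^ i * rho ((X # Zs) ! i) (W (nths (X # Zs) (- {i}))))
    = rho X (W Zs) - (\<Sum>i<length Zs. (-1) ^ i * rho (Zs ! i) (W (X # nths Zs (- {i}))))"
    by (simp add: sum.lessThan_Suc_shift n sum_negf del: sum.lessThan_Suc)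
  have A: "W (lb X (Zs ! j) # nths Zs (- {j})) = (-1) ^ j * W (Zs[j := lb X (Zs ! j)])" if "j < length Zs" for j
    using that m W by (intro alt_map_insert_nth lb_S) auto
  have B: "W (lb (Zs ! i) (Zs ! j) # X # nths Zs (- {i, j})) = - W (X # lb (Zs ! i) (Zs ! j) # nths Zs (- {i, j}))"
    if "i < length Zs" "j < length Zs" for i j
    using that m W nm nth_mem[of _ Zs] by (intro alt_map_swap lb_S) (auto simp: subset_iff)
  have "(\<Sum>j<length (X # Zs). \<Sum>i<j. (-1) ^ (i + j) * W (lb ((X # Zs) ! i) ((X # Zs) ! j) # nths (X # Zs) (- {i, j})))
    = (\<Sum>j<length Zs. - ((-1) ^ j * W (lb X (Zs ! j) # nths Zs (- {j}))) +
        (\<Sum>i<j. (-1) ^ (i + j) * W (lb (Zs ! i) (Zs ! j) # X # nths Zs (- {i, j}))))"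
    by (simp add: sum.lessThan_Suc_shift n del: sum.lessThan_Suc)
  also have "\<dots> = (\<Sum>j<length Zs. - W (Zs[j := lb X (Zs ! j)]) -
        (\<Sum>i<j. (-1) ^ (i + j) * W (X # lb (Zs ! i) (Zs ! j) # nths Zs (- {i, j}))))"
    by (intro sum.cong refl) (simp add: A B sum_negf flip: mult.assoc power_add mult_2)
  finally have 2: "(\<Sum>j<length (X # Zs). \<Sum>i<j. (-1) ^ (i + j) * W (lb ((X # Zs) ! i) ((X # Zs) ! j) # nths (X # Zs) (- {i, j})))
    = - (\<Sum>j<length Zs. W (Zs[j := lb X (Zs ! j)])) -
       (\<Sum>j<length Zs. \<Sum>i<j. (-1) ^ (i + j) * W (X # lb (Zs ! i) (Zs ! j) # nths Zs (- {i, j})))"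
    by (simp add: sum_subtractf sum_negf)
  show ?case
    unfolding 1 2 dd.simps LX_eq_sum Cons.IH[OF alt_map_ins[OF W m(1)] m(2)] by simp
qed simp

end


section \<open>Smooth functions and sections\<close>

context smooth_manifold
begin

lemma chart_open: "(V, \<phi>) \<in> A \<Longrightarrow> open V"
  using chart by blast

lemma chart_inv: "(V, \<phi>) \<in> A \<Longrightarrow> x \<in> V \<Longrightarrow> inv_into V \<phi> (\<phi> x) = x"
  using chart unfolding homeomorphism_def by blast

lemma chart_image_open:
  assumes "(V, \<phi>) \<in> A" "open U"
  shows "open (\<phi> ` (U \<inter> V))"
proof -
  from chart[OF assms(1)] have V: "open V" "open (\<phi> ` V)" "homeomorphism V (\<phi> ` V) \<phi> (inv_into V \<phi>)" by auto
  have "openin (top_of_set (\<phi> ` V)) (\<phi> ` (U \<inter> V))"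
    using openin_open_Int[OF assms(2), of V] by (intro homeomorphism_imp_open_map[OF V(3)]) (simp add: Int_commute)
  then show ?thesis using V(2) by (rule openin_open_trans)
qed

lemma obtain_chart: obtains V \<phi> where "(V, \<phi>) \<in> A" "x \<in> V"
proof -
  have "x \<in> (\<Union>(V, \<phi>)\<in>A. V)" using cover by simp
  then show ?thesis using that by auto
qed

lemma smooth_fun_on_def': "smooth_fun_on A U f \<longleftrightarrow>
  (\<forall>V \<phi> k. (V, \<phi>) \<in> A \<longrightarrow> Ck_on k (\<phi> ` (U \<inter> V)) (\<lambda>y. f (inv_into V \<phi> y)))"
  unfolding smooth_fun_on_def smooth_on_def by blast

lemma smooth_fun_onI:
  "(\<And>V \<phi> k. (V, \<phi>) \<in> A \<Longrightarrow> Ck_on k (\<phi> ` (U \<inter> V)) (\<lambda>y. f (inv_into V \<phi> y))) \<Longrightarrow> smooth_fun_on A U f"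
  unfolding smooth_fun_on_def' by blast

lemma smooth_fun_onD:
  "smooth_fun_on A U f \<Longrightarrow> (V, \<phi>) \<in> A \<Longrightarrow> Ck_on k (\<phi> ` (U \<inter> V)) (\<lambda>y. f (inv_into V \<phi> y))"
  unfolding smooth_fun_on_def' by blast

lemma smooth_fun_subset: "smooth_fun_on A U f \<Longrightarrow> U' \<subseteq> U \<Longrightarrow> smooth_fun_on A U' f"
  by (rule smooth_fun_onI, erule (1) Ck_on_subset[OF smooth_fun_onD]) auto

lemma smooth_fun_cong:
  assumes "open U" "\<And>x. x \<in> U \<Longrightarrow> f x = g x" "smooth_fun_on A U f"
  shows "smooth_fun_on A U g"
proof (rule smooth_fun_onI)
  fix V \<phi> k assume V: "(V, \<phi>) \<in> A"
  have "f (inv_into V \<phi> y) = g (inv_into V \<phi> y)" if "y \<in> \<phi> ` (U \<inter> V)" for y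
    using that assms(2) chart_inv[OF V] by auto
  then show "Ck_on k (\<phi> ` (U \<inter> V)) (\<lambda>y. g (inv_into V \<phi> y))"
    using Ck_on_cong[OF chart_image_open[OF V assms(1)], of "\<lambda>y. f (inv_into V \<phi> y)" "\<lambda>y. g (inv_into V \<phi> y)"]
      smooth_fun_onD[OF assms(3) V] by blast
qed

lemma smooth_fun_local:
  assumes "\<And>x. x \<in> U \<Longrightarrow> \<exists>T. open T \<and> x \<in> T \<and> smooth_fun_on A T f"
  shows "smooth_fun_on A U f"
proof (rule smooth_fun_onI, rule Ck_on_local)
  fix V \<phi> k y assume V: "(V, \<phi>) \<in> A" and "y \<in> \<phi> ` (U \<inter> V)"
  then obtain x where x: "x \<in> U" "x \<in> V" "y = \<phi> x" by blast
  from assms[OF x(1)] obtain T where T: "open T" "x \<in> T" "smooth_fun_on A T f" by blast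
  then show "\<exists>T. open T \<and> y \<in> T \<and> Ck_on k T (\<lambda>y. f (inv_into V \<phi> y))"
    using chart_image_open[OF V T(1)] smooth_fun_onD[OF T(3) V] x by blast
qed

lemma smooth_fun_const: "smooth_fun_on A U (\<lambda>x. c)"
  by (rule smooth_fun_onI) (rule Ck_on_const)

lemma smooth_fun_add: "open U \<Longrightarrow> smooth_fun_on A U f \<Longrightarrow> smooth_fun_on A U g \<Longrightarrow> smooth_fun_on A U (\<lambda>x. f x + g x)"
  by (rule smooth_fun_onI) (intro Ck_on_add chart_image_open smooth_fun_onD)

lemma smooth_fun_mult: "open U \<Longrightarrow> smooth_fun_on A U f \<Longrightarrow> smooth_fun_on A U g \<Longrightarrow> smooth_fun_on A U (\<lambda>x. f x * g x)"
  by (rule smooth_fun_onI) (intro Ck_on_mult chart_image_open smooth_fun_onD)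

lemma smooth_fun_inverse:
  assumes "open U" "smooth_fun_on A U f" "\<And>x. x \<in> U \<Longrightarrow> f x \<noteq> 0"
  shows "smooth_fun_on A U (\<lambda>x. inverse (f x))"
proof (rule smooth_fun_onI)
  fix V \<phi> k assume V: "(V, \<phi>) \<in> A"
  show "Ck_on k (\<phi> ` (U \<inter> V)) (\<lambda>y. inverse (f (inv_into V \<phi> y)))"
    using assms V by (intro Ck_on_inverse chart_image_open smooth_fun_onD) (auto simp: chart_inv)
qed

lemma smooth_fun_flat_exp: "open U \<Longrightarrow> smooth_fun_on A U f \<Longrightarrow> smooth_fun_on A U (\<lambda>x. flat_exp p (f x))"
  by (rule smooth_fun_onI) (intro Ck_on_flat_exp chart_image_open smooth_fun_onD)

lemma smooth_fun_uminus: "open U \<Longrightarrow> smooth_fun_on A U f \<Longrightarrow> smooth_fun_on A U (\<lambda>x. - f x)"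
  using smooth_fun_mult[OF _ smooth_fun_const[of U "-1"], of f] by simp

lemma smooth_fun_diff: "open U \<Longrightarrow> smooth_fun_on A U f \<Longrightarrow> smooth_fun_on A U g \<Longrightarrow> smooth_fun_on A U (\<lambda>x. f x - g x)"
  using smooth_fun_add[OF _ _ smooth_fun_uminus, of U f g] by simp

lemma smooth_fun_sum:
  "open U \<Longrightarrow> (\<And>i. i \<in> I \<Longrightarrow> smooth_fun_on A U (f i)) \<Longrightarrow> smooth_fun_on A U (\<lambda>x. \<Sum>i\<in>I. f i x)"
  by (induction I rule: infinite_finite_induct) (auto intro: smooth_fun_const smooth_fun_add)

lemma smooth_fun_sum_list:
  "open U \<Longrightarrow> (\<And>i. i \<in> set is \<Longrightarrow> smooth_fun_on A U (f i)) \<Longrightarrow> smooth_fun_on A U (\<lambda>x. \<Sum>i\<leftarrow>is. f i x)"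
  by (induction "is") (auto intro: smooth_fun_const smooth_fun_add)

text \<open>In another chart the coordinate is a component of a transition map.\<close>

lemma smooth_fun_coordinate:
  assumes V: "(V, \<phi>) \<in> A"
  shows "smooth_fun_on A V (\<lambda>x. \<phi> x \<bullet> b)"
proof (rule smooth_fun_onI)
  fix W \<psi> k assume W: "(W, \<psi>) \<in> A"
  have "smooth_on (\<psi> ` (W \<inter> V)) (\<lambda>y. \<phi> (inv_into W \<psi> y))" by (rule transition[OF W V])
  then show "Ck_on k (\<psi> ` (V \<inter> W)) (\<lambda>y. \<phi> (inv_into W \<psi> y) \<bullet> b)"
    by (intro Ck_on_inner chart_image_open W chart_open[OF V]) (simp add: smooth_on_def Int_commute)
qed

lemma smooth_fun_continuous:
  assumes "open U" "smooth_fun_on A U f"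
  shows "continuous_on U f"
proof (rule continuous_at_imp_continuous_on, rule ballI)
  fix x assume x: "x \<in> U"
  obtain V \<phi> where V: "(V, \<phi>) \<in> A" "x \<in> V" by (rule obtain_chart)
  have "continuous_on (\<phi> ` (U \<inter> V)) (\<lambda>y. f (inv_into V \<phi> y))"
    using smooth_fun_onD[OF assms(2) V(1), of 0] by simp
  moreover have "continuous_on (U \<inter> V) \<phi>"
    using chart[OF V(1)] unfolding homeomorphism_def by (metis continuous_on_subset inf_le2)
  ultimately have "continuous_on (U \<inter> V) (\<lambda>z. f (inv_into V \<phi> (\<phi> z)))"
    by (rule continuous_on_compose2) simp
  then have "continuous_on (U \<inter> V) f"
    by (rule continuous_on_eq) (simp add: chart_inv[OF V(1)])
  moreover have "open (U \<inter> V)" using assms(1) chart_open[OF V(1)] by blast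
  ultimately show "isCont f x" using x V(2) by (simp add: continuous_on_eq_continuous_at)
qed

text \<open>The function is smooth on \<open>U\<close> and zero on the complement of
  \<open>K\<close>, and these two open sets cover the manifold because \<open>K\<close> lies in
  \<open>U\<close>.\<close>

lemma smooth_fun_extend_0:
  assumes "open U" "smooth_fun_on A U f" "closed K" "K \<subseteq> U" "\<And>x. x \<in> U \<Longrightarrow> x \<notin> K \<Longrightarrow> f x = 0"
  shows "(\<lambda>x. if x \<in> U then f x else 0) \<in> Cinf A"
proof (simp, rule smooth_fun_local)
  fix x :: 'm
  show "\<exists>T. open T \<and> x \<in> T \<and> smooth_fun_on A T (\<lambda>x. if x \<in> U then f x else 0)"
  proof (cases "x \<in> U")
    case True
    then show ?thesis using assms(1,2) by (intro exI[of _ U]) (auto intro: smooth_fun_cong)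
  next
    case False
    have "open (- K)" using assms(3) by auto
    then show ?thesis using False assms(4,5)
      by (intro exI[of _ "- K"]) (auto intro: smooth_fun_cong[OF _ _ smooth_fun_const[of _ 0]])
  qed
qed

section \<open>Bump functions\<close>

definition bump :: "'m set \<Rightarrow> 'm \<Rightarrow> ('m \<Rightarrow> real) \<Rightarrow> bool" where
  "bump U x \<theta> \<longleftrightarrow> \<theta> \<in> Cinf A \<and> (\<exists>N. open N \<and> x \<in> N \<and> N \<subseteq> U \<and> (\<forall>y\<in>N. \<theta> y = 1)) \<and>
     (\<exists>K. closed K \<and> K \<subseteq> U \<and> (\<forall>y. y \<notin> K \<longrightarrow> \<theta> y = 0))"

text \<open>The usual quotient a / (a + b) of flat functions of the squared chart distance: a lives
  inside radius r, b outside radius r/2, and at every point one of them is positive.\<close>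

lemma bump_exists:
  assumes "open U" "x \<in> U"
  shows "\<exists>\<theta>. bump U x \<theta>"
proof -
  obtain V \<phi> where V: "(V, \<phi>) \<in> A" "x \<in> V" by (rule obtain_chart)
  obtain B :: "'b set" where B: "finite B" "span B = UNIV" using finite_dim by blast
  obtain C :: "'b set" where C: "finite C" "span C = UNIV" "\<forall>b\<in>C. \<forall>c\<in>C. b \<bullet> c = (if b = c then 1 else 0)"
    using finite_orthonormal_spanning[OF B(1)] B(2) by metis
  have oV: "open V" and oUV: "open (U \<inter> V)" using chart_open[OF V(1)] assms(1) by auto
  have hom: "continuous_on V \<phi>" "continuous_on (\<phi> ` V) (inv_into V \<phi>)"
    using chart[OF V(1)] unfolding homeomorphism_def by blast+
  have "open (\<phi> ` (U \<inter> V))" by (rule chart_image_open[OF V(1) assms(1)])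
  then obtain r where r: "r > 0" "cball (\<phi> x) r \<subseteq> \<phi> ` (U \<inter> V)"
    using assms(2) V(2) open_contains_cball by (metis IntI imageI)
  \<comment> \<open>The squared distance in orthonormal coordinates, written so that it is visibly a
    polynomial in smooth functions.\<close>
  define q where "q y = (\<Sum>b\<in>C. (\<phi> y \<bullet> b - \<phi> x \<bullet> b) * (\<phi> y \<bullet> b - \<phi> x \<bullet> b))" for y
  have q: "q y = (dist (\<phi> x) (\<phi> y))\<^sup>2" for y
  proof -
    define z where "z = \<phi> y - \<phi> x"
    have "z \<bullet> z = z \<bullet> (\<Sum>b\<in>C. (z \<bullet> b) *\<^sub>R b)"
      using orthonormal_expansion[OF C(1) _ C(3), of z] C(2) by simp
    also have "\<dots> = q y" by (simp add: q_def z_def inner_sum_right inner_diff_left)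
    finally show ?thesis by (simp add: z_def dist_norm norm_minus_commute[of "\<phi> x"] dot_square_norm)
  qed
  have sq: "smooth_fun_on A (U \<inter> V) q"
    unfolding q_def by (intro smooth_fun_sum smooth_fun_mult smooth_fun_diff smooth_fun_const oUV
      smooth_fun_subset[OF smooth_fun_coordinate[OF V(1)]]) auto
  define a where "a y = flat_exp 1 (r\<^sup>2 - q y)" for y
  define b where "b y = flat_exp 1 (q y - (r / 2)\<^sup>2)" for y
  have pos: "a y + b y > 0" for y
  proof -
    have "(r / 2)\<^sup>2 < r\<^sup>2" using r(1) by (simp add: power_divide)
    then have "0 < r\<^sup>2 - q y \<or> 0 < q y - (r / 2)\<^sup>2" by linarith
    then show ?thesis unfolding a_def b_def flat_exp_def by (auto intro: add_pos_pos)
  qed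
  define f where "f y = a y * inverse (a y + b y)" for y
  have sf: "smooth_fun_on A (U \<inter> V) f"
    unfolding f_def using pos
    by (intro smooth_fun_mult smooth_fun_inverse smooth_fun_add oUV)
      (auto simp: a_def b_def less_imp_neq[symmetric] intro!: smooth_fun_flat_exp smooth_fun_diff smooth_fun_const oUV sq)
  define K where "K = inv_into V \<phi> ` cball (\<phi> x) r"
  \<comment> \<open>Compactness of the ball is what makes \<open>K\<close> closed in the Hausdorff
    manifold, and hence extension by zero smooth.\<close>
  have "compact K"
    unfolding K_def using compact_cball_finite_dim[OF C] r(2)
    by (intro compact_continuous_image continuous_on_subset[OF hom(2)]) auto
  then have clK: "closed K" by (rule compact_imp_closed)
  have KU: "K \<subseteq> U \<inter> V"
  proof
    fix y assume "y \<in> K"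
    then obtain z where "z \<in> cball (\<phi> x) r" "y = inv_into V \<phi> z" by (auto simp: K_def)
    then obtain w where "w \<in> U \<inter> V" "y = inv_into V \<phi> (\<phi> w)" using r(2) by blast
    then show "y \<in> U \<inter> V" using chart_inv[OF V(1)] by simp
  qed
  have f0: "f y = 0" if "y \<in> U \<inter> V" "y \<notin> K" for y
  proof -
    have "\<not> dist (\<phi> x) (\<phi> y) \<le> r"
    proof
      assume "dist (\<phi> x) (\<phi> y) \<le> r"
      then have "inv_into V \<phi> (\<phi> y) \<in> K" unfolding K_def by auto
      then show False using that chart_inv[OF V(1)] by simp
    qed
    then have "r\<^sup>2 \<le> q y" unfolding q using r(1) by (intro power_mono) auto
    then show ?thesis by (simp add: f_def a_def flat_exp_def)
  qed
  define \<theta> where "\<theta> y = (if y \<in> U \<inter> V then f y else 0)" for y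
  have "\<theta> \<in> Cinf A"
    unfolding \<theta>_def by (rule smooth_fun_extend_0[OF oUV sf clK KU f0])
  moreover
  define N where "N = V \<inter> \<phi> -` ball (\<phi> x) (r / 2)"
  have "open N" unfolding N_def using hom(1) oV by (simp add: continuous_on_open_vimage Int_commute)
  moreover have "x \<in> N" using V(2) r(1) by (simp add: N_def)
  moreover have N1: "y \<in> U \<inter> V \<and> q y < (r / 2)\<^sup>2" if "y \<in> N" for y
  proof -
    have y: "y \<in> V" "dist (\<phi> x) (\<phi> y) < r / 2" using that by (auto simp: N_def)
    then have "\<phi> y \<in> \<phi> ` (U \<inter> V)" using r by (intro subsetD[OF r(2)]) auto
    then obtain w where "w \<in> U \<inter> V" "\<phi> y = \<phi> w" by auto
    then have "y = w" using chart_inv[OF V(1)] y(1) by (metis IntD2)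
    moreover have "q y < (r / 2)\<^sup>2" unfolding q using y(2) by (intro power_strict_mono) auto
    ultimately show ?thesis using \<open>w \<in> U \<inter> V\<close> by simp
  qed
  moreover have "\<theta> y = 1" if "y \<in> N" for y
  proof -
    have "b y = 0" using N1[OF that] by (simp add: b_def flat_exp_def)
    then show ?thesis using N1[OF that] pos[of y] by (simp add: \<theta>_def f_def)
  qed
  moreover have "\<theta> y = 0" if "y \<notin> K" for y using f0 that by (simp add: \<theta>_def)
  ultimately show ?thesis using clK KU unfolding bump_def by blast
qed

lemma bump_mult_smooth:
  assumes "bump U x \<theta>" "open U" "smooth_fun_on A U f"
  shows "(\<lambda>y. if y \<in> U then \<theta> y * f y else 0) \<in> Cinf A"
proof -
  obtain K where K: "closed K" "K \<subseteq> U" "\<forall>y. y \<notin> K \<longrightarrow> \<theta> y = 0" and \<theta>: "smooth_fun_on A UNIV \<theta>"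
    using assms(1) by (auto simp: bump_def)
  show ?thesis
    by (rule smooth_fun_extend_0[OF assms(2) smooth_fun_mult[OF assms(2) smooth_fun_subset[OF \<theta>] assms(3)] K(1,2)])
      (use K(3) in auto)
qed

lemma Cinf_ring:
  "f \<in> Cinf A \<Longrightarrow> g \<in> Cinf A \<Longrightarrow> f + g \<in> Cinf A" "f \<in> Cinf A \<Longrightarrow> g \<in> Cinf A \<Longrightarrow> f * g \<in> Cinf A"
  "f \<in> Cinf A \<Longrightarrow> - f \<in> Cinf A" "0 \<in> Cinf A" "1 \<in> Cinf A" "f \<in> Cinf A \<Longrightarrow> c *\<^sub>R f \<in> Cinf A"
  "f \<in> Cinf A \<Longrightarrow> g \<in> Cinf A \<Longrightarrow> f - g \<in> Cinf A"
  unfolding plus_fun_def times_fun_def zero_fun_def one_fun_def scaleR_fun_def fun_Compl_def fun_diff_def mem_Collect_eq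
  by (auto intro: smooth_fun_add smooth_fun_mult smooth_fun_uminus smooth_fun_const smooth_fun_diff)

end

lemma alt_sum_list:
  assumes "\<omega> \<in> alt_forms F" "subspace F" "set us \<subseteq> F" "set ws \<subseteq> F" "\<And>x. x \<in> set xs \<Longrightarrow> g x \<in> F"
  shows "\<omega> (us @ (\<Sum>x\<leftarrow>xs. c x *\<^sub>R g x) # ws) = (\<Sum>x\<leftarrow>xs. c x * \<omega> (us @ g x # ws))"
  using assms(5)
proof (induction xs)
  case Nil
  have "\<omega> (us @ (0 *\<^sub>R 0) # ws) = 0 * \<omega> (us @ 0 # ws)"
    using assms by (intro alt_formsD(3)[OF assms(1)]) (auto intro: subspace_0)
  then show ?case by simp
next
  case (Cons y ys)
  have *: "(\<Sum>x\<leftarrow>ys. c x *\<^sub>R g x) \<in> F" "c y *\<^sub>R g y \<in> F" "g y \<in> F"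
    using Cons.prems assms(2) by (induction ys) (auto intro: subspace_0 subspace_add subspace_scale)
  show ?case
    using Cons alt_formsD(2)[OF assms(1,3,4) *(2,1)] alt_formsD(3)[OF assms(1,3,4) *(3)] by simp
qed

section \<open>Sections, frames and smooth forms of a vector bundle\<close>

context vector_bundle
begin

lemma obtain_frame: obtains V e where "(V, e) \<in> frames E" "x \<in> V"
proof -
  have "x \<in> (\<Union>(U, e)\<in>frames E. U)" using frames_cover by simp
  then show ?thesis using that by auto
qed

lemma fibre_subspace: "subspace (fibre E x)"
proof -
  obtain V e where "(V, e) \<in> frames E" "x \<in> V" by (rule obtain_frame)
  then show ?thesis using frame_basis basis_list_subspace by blast
qed

definition coef :: "('m \<Rightarrow> 'v) list \<Rightarrow> ('m \<Rightarrow> 'v) \<Rightarrow> ('m \<Rightarrow> 'v) \<Rightarrow> 'm \<Rightarrow> real" where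
  "coef e \<sigma> s x = coord (at_pt e x) (\<sigma> x) (s x)"

lemma smooth_section_iff: "smooth_section A E U s \<longleftrightarrow> (\<forall>x\<in>U. s x \<in> fibre E x) \<and>
     (\<forall>V e. (V, e) \<in> frames E \<longrightarrow> (\<forall>\<sigma>\<in>set e. smooth_fun_on A (U \<inter> V) (coef e \<sigma> s)))"
  unfolding smooth_section_def coef_def dual_basis_eq by (fastforce simp: in_set_conv_nth)

lemma smooth_section_coef:
  "smooth_section A E U s \<Longrightarrow> (V, e) \<in> frames E \<Longrightarrow> \<sigma> \<in> set e \<Longrightarrow> smooth_fun_on A (U \<inter> V) (coef e \<sigma> s)"
  unfolding smooth_section_iff by blast

lemma smooth_section_fibre: "smooth_section A E U s \<Longrightarrow> x \<in> U \<Longrightarrow> s x \<in> fibre E x"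
  by (simp add: smooth_section_def)

lemma coef_expansion:
  assumes "(V, e) \<in> frames E" "x \<in> V" "s x \<in> fibre E x"
  shows "(\<Sum>\<sigma>\<leftarrow>e. coef e \<sigma> s x *\<^sub>R \<sigma> x) = s x"
  using coord_expansion[OF frame_basis[OF assms(1,2)] assms(3)] by (simp add: coef_def o_def)

lemma frame_fibre: "(V, e) \<in> frames E \<Longrightarrow> x \<in> V \<Longrightarrow> \<sigma> \<in> set e \<Longrightarrow> \<sigma> x \<in> fibre E x"
  using frame_smooth smooth_section_fibre by blast

lemma coef_linear:
  assumes "(V, e) \<in> frames E" "x \<in> V"
  shows "s x \<in> fibre E x \<Longrightarrow> t x \<in> fibre E x \<Longrightarrow> coef e \<sigma> (\<lambda>x. s x + t x) x = coef e \<sigma> s x + coef e \<sigma> t x"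
    "s x \<in> fibre E x \<Longrightarrow> coef e \<sigma> (\<lambda>x. f x *\<^sub>R s x) x = f x * coef e \<sigma> s x"
  using dual_spaceD(2,3)[OF coord_dual_space[OF frame_basis[OF assms]]] by (auto simp: coef_def)

lemma smooth_section_subset: "smooth_section A E U s \<Longrightarrow> U' \<subseteq> U \<Longrightarrow> smooth_section A E U' s"
  unfolding smooth_section_iff by (meson Int_mono order_refl smooth_fun_subset subsetD)

lemma smooth_section_cong:
  assumes "open U" "\<And>x. x \<in> U \<Longrightarrow> s x = t x" "smooth_section A E U s"
  shows "smooth_section A E U t"
  unfolding smooth_section_iff
proof (intro conjI ballI allI impI)
  fix x assume "x \<in> U" then show "t x \<in> fibre E x" using assms smooth_section_fibre by metis
next
  fix V e \<sigma> assume V: "(V, e) \<in> frames E" "\<sigma> \<in> set e"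
  show "smooth_fun_on A (U \<inter> V) (coef e \<sigma> t)"
    by (rule smooth_fun_cong[OF _ _ smooth_section_coef[OF assms(3) V]])
      (use assms frame_open[OF V(1)] in \<open>auto simp: coef_def\<close>)
qed

lemma smooth_section_local:
  assumes "\<And>x. x \<in> U \<Longrightarrow> \<exists>T. open T \<and> x \<in> T \<and> smooth_section A E T s"
  shows "smooth_section A E U s"
  unfolding smooth_section_iff
proof (intro conjI ballI allI impI)
  fix x assume "x \<in> U" then show "s x \<in> fibre E x" using assms smooth_section_fibre by blast
next
  fix V e \<sigma> assume V: "(V, e) \<in> frames E" "\<sigma> \<in> set e"
  show "smooth_fun_on A (U \<inter> V) (coef e \<sigma> s)"
  proof (rule smooth_fun_local)
    fix x assume x: "x \<in> U \<inter> V"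
    then obtain T where "open T" "x \<in> T" "smooth_section A E T s" using assms by blast
    then show "\<exists>T. open T \<and> x \<in> T \<and> smooth_fun_on A T (coef e \<sigma> s)"
      using smooth_section_coef[OF _ V] frame_open[OF V(1)] x by (intro exI[of _ "T \<inter> V"]) auto
  qed
qed

lemma smooth_section_add:
  assumes "open U" "smooth_section A E U s" "smooth_section A E U t"
  shows "smooth_section A E U (\<lambda>x. s x + t x)"
  unfolding smooth_section_iff
proof (intro conjI ballI allI impI)
  fix x assume "x \<in> U"
  then show "s x + t x \<in> fibre E x"
    using assms smooth_section_fibre subspace_add[OF fibre_subspace] by blast
next
  fix V e \<sigma> assume V: "(V, e) \<in> frames E" "\<sigma> \<in> set e"
  have o: "open (U \<inter> V)" using assms(1) frame_open[OF V(1)] by blast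
  show "smooth_fun_on A (U \<inter> V) (coef e \<sigma> (\<lambda>x. s x + t x))"
    by (rule smooth_fun_cong[OF o _ smooth_fun_add[OF o smooth_section_coef[OF assms(2) V] smooth_section_coef[OF assms(3) V]]])
      (use smooth_section_fibre[OF assms(2)] smooth_section_fibre[OF assms(3)] in \<open>simp add: coef_linear[OF V(1)]\<close>)
qed

lemma smooth_section_scale:
  assumes "open U" "smooth_fun_on A U f" "smooth_section A E U s"
  shows "smooth_section A E U (\<lambda>x. f x *\<^sub>R s x)"
  unfolding smooth_section_iff
proof (intro conjI ballI allI impI)
  fix x assume "x \<in> U"
  then show "f x *\<^sub>R s x \<in> fibre E x"
    using assms smooth_section_fibre subspace_scale[OF fibre_subspace] by blast
next
  fix V e \<sigma> assume V: "(V, e) \<in> frames E" "\<sigma> \<in> set e"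
  have o: "open (U \<inter> V)" using assms(1) frame_open[OF V(1)] by blast
  show "smooth_fun_on A (U \<inter> V) (coef e \<sigma> (\<lambda>x. f x *\<^sub>R s x))"
    by (rule smooth_fun_cong[OF o _ smooth_fun_mult[OF o smooth_fun_subset[OF assms(2)] smooth_section_coef[OF assms(3) V]]])
      (use smooth_section_fibre[OF assms(3)] in \<open>auto simp: coef_linear[OF V(1)]\<close>)
qed

lemma smooth_section_0: "open U \<Longrightarrow> smooth_section A E U (\<lambda>x. 0)"
proof (rule smooth_section_local)
  fix x assume "open U" "x \<in> U"
  obtain V e where V: "(V, e) \<in> frames E" "x \<in> V" by (rule obtain_frame)
  have "smooth_section A E V (\<lambda>x. 0)"
    unfolding smooth_section_iff
  proof (intro conjI ballI allI impI)
    fix y show "0 \<in> fibre E y" by (rule subspace_0[OF fibre_subspace])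
    fix W e' \<sigma> assume W: "(W, e') \<in> frames E" "\<sigma> \<in> set e'"
    have "coef e' \<sigma> (\<lambda>x. 0) y = 0" if "y \<in> W" for y
      using coef_linear(2)[OF W(1) that, of "\<lambda>x. 0" \<sigma> "\<lambda>x. 0"] subspace_0[OF fibre_subspace] by simp
    then show "smooth_fun_on A (V \<inter> W) (coef e' \<sigma> (\<lambda>x. 0))"
      using frame_open[OF V(1)] frame_open[OF W(1)] by (auto intro: smooth_fun_cong[OF _ _ smooth_fun_const[of _ 0]])
  qed
  then show "\<exists>T. open T \<and> x \<in> T \<and> smooth_section A E T (\<lambda>x. 0)" using V frame_open by blast
qed

lemma Sec_add: "X \<in> Sec A E \<Longrightarrow> Y \<in> Sec A E \<Longrightarrow> X + Y \<in> Sec A E"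
  by (simp add: plus_fun_def smooth_section_add)

lemma Sec_smul: "f \<in> Cinf A \<Longrightarrow> X \<in> Sec A E \<Longrightarrow> (\<lambda>x. f x *\<^sub>R X x) \<in> Sec A E"
  by (simp add: smooth_section_scale)

lemma Sec_0: "0 \<in> Sec A E"
  by (simp add: zero_fun_def smooth_section_0)

lemma Sec_uminus: "X \<in> Sec A E \<Longrightarrow> - X \<in> Sec A E"
  using Sec_smul[of "\<lambda>x. - 1" X] by (simp add: fun_Compl_def smooth_fun_const)

lemma Sec_fibre: "X \<in> Sec A E \<Longrightarrow> X x \<in> fibre E x"
  using smooth_section_fibre by blast

lemma bump_section:
  assumes "bump U x \<theta>" "open U" "smooth_section A E U s"
  shows "(\<lambda>y. if y \<in> U then \<theta> y *\<^sub>R s y else 0) \<in> Sec A E"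
proof -
  obtain K where K: "closed K" "K \<subseteq> U" "\<forall>y. y \<notin> K \<longrightarrow> \<theta> y = 0" and \<theta>: "smooth_fun_on A UNIV \<theta>"
    using assms(1) by (auto simp: bump_def)
  have "smooth_section A E UNIV (\<lambda>y. if y \<in> U then \<theta> y *\<^sub>R s y else 0)"
  proof (rule smooth_section_local)
    fix y :: 'm
    show "\<exists>T. open T \<and> y \<in> T \<and> smooth_section A E T (\<lambda>y. if y \<in> U then \<theta> y *\<^sub>R s y else 0)"
    proof (cases "y \<in> U")
      case True
      have "smooth_section A E U (\<lambda>y. if y \<in> U then \<theta> y *\<^sub>R s y else 0)"
        by (rule smooth_section_cong[OF assms(2) _ smooth_section_scale[OF assms(2) smooth_fun_subset[OF \<theta>] assms(3)]]) auto
      then show ?thesis using True assms(2) by blast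
    next
      case False
      have "open (- K)" using K by auto
      moreover from this have "smooth_section A E (- K) (\<lambda>y. if y \<in> U then \<theta> y *\<^sub>R s y else 0)"
        by (rule smooth_section_cong[OF _ _ smooth_section_0]) (use K \<open>open (- K)\<close> in auto)
      ultimately show ?thesis using False K by blast
    qed
  qed
  then show ?thesis by simp
qed

text \<open>Multiplication by a bump function that is 1 near x turns a local frame into global
  sections, the only ones the algebraic calculus knows.\<close>

lemma frame_extend:
  assumes V: "(V, e) \<in> frames E" "x \<in> V"
  obtains N g where "open N" "x \<in> N" "N \<subseteq> V" "\<forall>\<sigma>\<in>set e. g \<sigma> \<in> Sec A E" "\<forall>\<sigma>. \<forall>y\<in>N. g \<sigma> y = \<sigma> y"
proof -
  obtain \<theta> where \<theta>: "bump V x \<theta>" using bump_exists[OF frame_open[OF V(1)] V(2)] by blast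
  then obtain N where N: "open N" "x \<in> N" "N \<subseteq> V" "\<forall>y\<in>N. \<theta> y = 1" by (auto simp: bump_def)
  show ?thesis
    by (rule that[OF N(1-3), of "\<lambda>\<sigma> y. if y \<in> V then \<theta> y *\<^sub>R \<sigma> y else 0"])
      (use bump_section[OF \<theta> frame_open[OF V(1)] frame_smooth[OF V(1)]] N(3,4) in auto)
qed

lemma Sec_sum_list: "(\<And>x. x \<in> set xs \<Longrightarrow> g x \<in> Sec A E) \<Longrightarrow> (\<Sum>x\<leftarrow>xs. g x) \<in> Sec A E"
  by (induction xs) (simp_all only: list.simps sum_list.Nil sum_list.Cons list.set Sec_0 Sec_add insert_iff simp_thms)

lemma section_through:
  assumes "v \<in> fibre E x"
  obtains X where "X \<in> Sec A E" "X x = v"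
proof -
  obtain V e where V: "(V, e) \<in> frames E" "x \<in> V" by (rule obtain_frame)
  obtain N g where g: "open N" "x \<in> N" "N \<subseteq> V" "\<forall>\<sigma>\<in>set e. g \<sigma> \<in> Sec A E" "\<forall>\<sigma>. \<forall>y\<in>N. g \<sigma> y = \<sigma> y"
    by (rule frame_extend[OF V])
  define X where "X y = (\<Sum>\<sigma>\<leftarrow>e. coef e \<sigma> (\<lambda>_. v) x *\<^sub>R g \<sigma> y)" for y
  have "smooth_section A E UNIV (\<lambda>y. \<Sum>\<sigma>\<leftarrow>es. coef e \<sigma> (\<lambda>_. v) x *\<^sub>R g \<sigma> y)" if "set es \<subseteq> set e" for es
    using that g(4)
    by (induction es) (auto intro!: smooth_section_0 smooth_section_add smooth_section_scale smooth_fun_const)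
  then have "X \<in> Sec A E" by (simp add: X_def[abs_def])
  moreover have "X x = v"
    using coef_expansion[OF V, of "\<lambda>_. v"] assms g(2,5) by (simp add: X_def cong: map_cong)
  ultimately show ?thesis by (rule that)
qed

lemma sections_through:
  assumes "set vs \<subseteq> fibre E x"
  obtains Xs where "set Xs \<subseteq> Sec A E" "at_pt Xs x = vs"
proof -
  have "\<exists>Xs. set Xs \<subseteq> Sec A E \<and> at_pt Xs x = vs" using assms
  proof (induction vs)
    case (Cons v vs)
    then obtain Xs where Xs: "set Xs \<subseteq> Sec A E" "at_pt Xs x = vs" by auto
    obtain X where "X \<in> Sec A E" "X x = v" using section_through Cons.prems by (metis list.set_intros(1) subsetD)
    with Xs show ?case by (intro exI[of _ "X # Xs"]) auto
  qed auto
  then show ?thesis using that by blast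
qed

lemma smooth_formsD:
  assumes "\<omega> \<in> smooth_forms A E U"
  shows "x \<in> U \<Longrightarrow> \<omega> x \<in> alt_forms (fibre E x)"
    "(V, e) \<in> frames E \<Longrightarrow> set s \<subseteq> set e \<Longrightarrow> smooth_fun_on A (U \<inter> V) (\<lambda>x. \<omega> x (at_pt s x))"
  using assms unfolding smooth_forms_def by auto

text \<open>The sections are expanded in a frame one at a time, starting with the last; the suffix
  \<open>s\<close> collects the frame elements already substituted.\<close>

lemma smooth_form_sections:
  assumes U: "open U" and \<omega>: "\<omega> \<in> smooth_forms A E U" and Xs: "\<And>X. X \<in> set Xs \<Longrightarrow> smooth_section A E U X"
  shows "smooth_fun_on A U (\<lambda>x. \<omega> x (at_pt Xs x))"
proof (rule smooth_fun_local)
  fix x assume x: "x \<in> U"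
  obtain V e where V: "(V, e) \<in> frames E" "x \<in> V" by (rule obtain_frame)
  have o: "open (U \<inter> V)" using U frame_open[OF V(1)] by blast
  have "smooth_fun_on A (U \<inter> V) (\<lambda>x. \<omega> x (at_pt (Xs @ s) x))" if "set s \<subseteq> set e" for s
    using Xs that
  proof (induction Xs arbitrary: s rule: rev_induct)
    case Nil
    then show ?case using smooth_formsD(2)[OF \<omega> V(1)] by simp
  next
    case (snoc X Xs)
    have X: "smooth_section A E U X" using snoc.prems by simp
    have "smooth_fun_on A (U \<inter> V) (\<lambda>y. \<Sum>\<sigma>\<leftarrow>e. coef e \<sigma> X y * \<omega> y (at_pt (Xs @ \<sigma> # s) y))"
      using snoc.prems by (intro smooth_fun_sum_list smooth_fun_mult o smooth_section_coef[OF X V(1)] snoc.IH) auto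
    then show ?case
    proof (rule smooth_fun_cong[OF o, rotated])
      fix y assume y: "y \<in> U \<inter> V"
      have "\<omega> y (at_pt Xs y @ (\<Sum>\<sigma>\<leftarrow>e. coef e \<sigma> X y *\<^sub>R \<sigma> y) # at_pt s y) =
        (\<Sum>\<sigma>\<leftarrow>e. coef e \<sigma> X y * \<omega> y (at_pt Xs y @ \<sigma> y # at_pt s y))"
        by (rule alt_sum_list[OF smooth_formsD(1)[OF \<omega>] fibre_subspace])
          (use y snoc.prems(2) frame_fibre[OF V(1)] smooth_section_fibre[OF snoc.prems(1), of _ y] in \<open>auto simp: subset_iff\<close>)
      then show "(\<Sum>\<sigma>\<leftarrow>e. coef e \<sigma> X y * \<omega> y (at_pt (Xs @ \<sigma> # s) y)) = \<omega> y (at_pt ((Xs @ [X]) @ s) y)"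
        using coef_expansion[OF V(1), of y X] y smooth_section_fibre[OF X] by simp
    qed
  qed
  from this[of "[]"] show "\<exists>T. open T \<and> x \<in> T \<and> smooth_fun_on A T (\<lambda>x. \<omega> x (at_pt Xs x))"
    using o x V(2) by (intro exI[of _ "U \<inter> V"]) simp
qed

text \<open>Smoothness is defined by frames over open sets. Near each point these agree with global
  sections, which therefore suffice as test sections.\<close>

lemma smooth_formsI_global:
  assumes "\<And>x. \<omega> x \<in> alt_forms (fibre E x)" "\<And>Xs. set Xs \<subseteq> Sec A E \<Longrightarrow> (\<lambda>x. \<omega> x (at_pt Xs x)) \<in> Cinf A"
  shows "\<omega> \<in> smooth_forms A E UNIV"
  unfolding smooth_forms_def
proof (intro CollectI conjI ballI assms(1), clarify)
  fix V e s assume V: "(V, e) \<in> frames E" and s: "set s \<subseteq> set e"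
  have "smooth_fun_on A V (\<lambda>x. \<omega> x (at_pt s x))"
  proof (rule smooth_fun_local)
    fix x assume x: "x \<in> V"
    obtain N g where g: "open N" "x \<in> N" "N \<subseteq> V" "\<forall>\<sigma>\<in>set e. g \<sigma> \<in> Sec A E" "\<forall>\<sigma>. \<forall>y\<in>N. g \<sigma> y = \<sigma> y"
      by (rule frame_extend[OF V x])
    have "smooth_fun_on A UNIV (\<lambda>x. \<omega> x (at_pt (map g s) x))"
      using assms(2)[of "map g s"] g(4) s by auto
    then have "smooth_fun_on A N (\<lambda>x. \<omega> x (at_pt (map g s) x))" using smooth_fun_subset by blast
    then have "smooth_fun_on A N (\<lambda>x. \<omega> x (at_pt s x))"
      by (rule smooth_fun_cong[OF g(1), rotated]) (simp add: g(5) o_def)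
    then show "\<exists>T. open T \<and> x \<in> T \<and> smooth_fun_on A T (\<lambda>x. \<omega> x (at_pt s x))" using g by blast
  qed
  then show "smooth_fun_on A (UNIV \<inter> V) (\<lambda>x. \<omega> x (at_pt s x))" by simp
qed

end


section \<open>The differential\<close>

lemma tangent_spaceD:
  assumes "D \<in> tangent_space A x"
  shows "f \<notin> smooth_near A x \<Longrightarrow> D f = 0"
    "f \<in> smooth_near A x \<Longrightarrow> g \<in> smooth_near A x \<Longrightarrow> \<forall>\<^sub>F y in nhds x. f y = g y \<Longrightarrow> D f = D g"
    "f \<in> smooth_near A x \<Longrightarrow> g \<in> smooth_near A x \<Longrightarrow> D (\<lambda>y. f y + g y) = D f + D g"
    "f \<in> smooth_near A x \<Longrightarrow> D (\<lambda>y. c * f y) = c * D f"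
    "f \<in> smooth_near A x \<Longrightarrow> g \<in> smooth_near A x \<Longrightarrow> D (\<lambda>y. f y * g y) = D f * g x + f x * D g"
  using assms unfolding tangent_space_def by blast+

lemma (in smooth_manifold) smooth_near_cong:
  assumes "\<forall>\<^sub>F y in nhds x. f y = g y" "f \<in> smooth_near A x"
  shows "g \<in> smooth_near A x"
proof -
  obtain S where S: "open S" "x \<in> S" "\<forall>y\<in>S. f y = g y" using assms(1) by (auto simp: eventually_nhds)
  obtain U where U: "open U" "x \<in> U" "smooth_fun_on A U f" using assms(2) by (auto simp: smooth_near_def)
  have "smooth_fun_on A (U \<inter> S) g"
    by (rule smooth_fun_cong[OF _ _ smooth_fun_subset[OF U(3)]]) (use S U in auto)
  then show ?thesis using S U by (auto simp: smooth_near_def intro!: exI[of _ "U \<inter> S"])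
qed

lemma (in smooth_manifold) Cinf_smooth_near: "f \<in> Cinf A \<Longrightarrow> f \<in> smooth_near A x"
  by (auto simp: smooth_near_def intro!: exI[of _ UNIV])

lemma minus_one_power_apply: "((- 1) ^ i) x = ((- 1) ^ i :: real)"
  by (induction i) simp_all

context lie_algebroid
begin

text \<open>Tangent vectors depend on germs of smooth functions and give 0 on functions not smooth
  near x; functions with equal germs are smooth there or not together.\<close>

lemma anchor_deriv_local:
  assumes "X x \<in> fibre E x" "\<forall>\<^sub>F y in nhds x. f y = g y"
  shows "anchor_deriv E X f x = anchor_deriv E X g x"
proof -
  have g': "\<forall>\<^sub>F y in nhds x. g y = f y" using assms(2) by (rule eventually_mono) simp
  have D: "anchor E x (X x) \<in> tangent_space A x" by (rule anchor_tangent[OF assms(1)])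
  show ?thesis
  proof (cases "f \<in> smooth_near A x")
    case True
    then show ?thesis
      using tangent_spaceD(2)[OF D True _ assms(2)] smooth_near_cong[OF assms(2)] by (simp add: anchor_deriv_def)
  next
    case False
    then have "g \<notin> smooth_near A x" using smooth_near_cong[OF g'] by blast
    then show ?thesis using False tangent_spaceD(1)[OF D] by (simp add: anchor_deriv_def)
  qed
qed

sublocale lie_rinehart "Sec A E" "Cinf A" "\<lambda>f X x. f x *\<^sub>R X x" "lie E" "anchor_deriv E"
proof (unfold_locales, goal_cases)
  case (1 f g) then show ?case by (rule Cinf_ring)
next
  case (2 f g) then show ?case by (rule Cinf_ring)
next
  case 3 show ?case by (rule Cinf_ring)
next
  case (4 f) then show ?case by (rule Cinf_ring)
next
  case (5 X Y) then show ?case by (rule Sec_add)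
next
  case 6 show ?case by (rule Sec_0)
next
  case (7 X) then show ?case by (rule Sec_uminus)
next
  case (8 f X) then show ?case by (rule Sec_smul)
next
  case (9 X f) then show ?case by (rule anchor_smooth)
next
  case (10 X f g)
  show ?case
    using tangent_spaceD(3)[OF anchor_tangent[OF Sec_fibre[OF 10(1)]] Cinf_smooth_near[OF 10(2)] Cinf_smooth_near[OF 10(3)]]
    by (simp add: fun_eq_iff anchor_deriv_def plus_fun_def)
next
  case (11 X f g)
  show ?case
    using tangent_spaceD(5)[OF anchor_tangent[OF Sec_fibre[OF 11(1)]] Cinf_smooth_near[OF 11(2)] Cinf_smooth_near[OF 11(3)]]
    by (simp add: fun_eq_iff anchor_deriv_def times_fun_def plus_fun_def)
next
  case (12 X Y f)
  then show ?case by (simp add: fun_eq_iff anchor_deriv_def anchor_add Sec_fibre)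
next
  case (13 X f g)
  have "anchor E x (g x *\<^sub>R X x) f = (g x *\<^sub>R anchor E x (X x)) f" for x
    using anchor_scale[OF Sec_fibre[OF 13(1)]] by metis
  then show ?case by (simp add: fun_eq_iff anchor_deriv_def)
next
  case (14 X Y) then show ?case by (rule lie_closed)
next
  case (15 X Y Z) then show ?case by (rule lie_add)
next
  case (16 X Y) then show ?case by (rule lie_skew)
next
  case (17 X)
  \<comment> \<open>Skew symmetry gives 2 [X, X] = 0, and the sections form a real vector
    space.\<close>
  have "lie E X X = - lie E X X" by (rule lie_skew[OF 17 17])
  then have "2 *\<^sub>R lie E X X = 0" by (simp add: scaleR_2 eq_neg_iff_add_eq_0)
  then show ?case by (simp only: scaleR_eq_0_iff) simp
next
  case (18 X Y Z) then show ?case by (rule lie_jacobi)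
next
  case (19 X Y f)
  then show ?case using lie_leibniz[of X Y f] by (simp add: fun_eq_iff)
next
  case (20 X Y f) then show ?case by (rule anchor_lie)
qed

section \<open>Forms as maps on global sections\<close>

definition hat :: "('m \<Rightarrow> 'v list \<Rightarrow> real) \<Rightarrow> ('m \<Rightarrow> 'v) list \<Rightarrow> 'm \<Rightarrow> real" where
  "hat \<omega> Xs = (\<lambda>x. \<omega> x (at_pt Xs x))"

lemma hat_Cinf: "\<omega> \<in> smooth_forms A E UNIV \<Longrightarrow> set Xs \<subseteq> Sec A E \<Longrightarrow> hat \<omega> Xs \<in> Cinf A"
  unfolding hat_def using smooth_form_sections[of UNIV \<omega> Xs] by auto

lemma at_pt_fibre: "set Xs \<subseteq> Sec A E \<Longrightarrow> set (at_pt Xs x) \<subseteq> fibre E x"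
  using Sec_fibre by auto

lemma hat_alt_map:
  assumes \<omega>: "\<omega> \<in> smooth_forms A E UNIV"
  shows "alt_map (hat \<omega>)"
  unfolding alt_map_def hd_ok_def
proof (intro allI impI conjI ballI)
  fix us ws assume m: "set us \<subseteq> Sec A E" "set ws \<subseteq> Sec A E"
  note F = at_pt_fibre[OF m(1)] at_pt_fibre[OF m(2)]
  show "hat \<omega> (us @ ws) \<in> Cinf A" using \<omega> m by (intro hat_Cinf) auto
  show "hat \<omega> (us @ (u + v) # ws) = hat \<omega> (us @ u # ws) + hat \<omega> (us @ v # ws)"
    if "u \<in> Sec A E" "v \<in> Sec A E" for u v
  proof
    fix x
    have "\<omega> x (at_pt us x @ (u x + v x) # at_pt ws x) = \<omega> x (at_pt us x @ u x # at_pt ws x) + \<omega> x (at_pt us x @ v x # at_pt ws x)"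
      by (intro alt_formsD(2)[OF smooth_formsD(1)[OF \<omega> UNIV_I]] F Sec_fibre that)
    then show "hat \<omega> (us @ (u + v) # ws) x = (hat \<omega> (us @ u # ws) + hat \<omega> (us @ v # ws)) x"
      by (simp add: hat_def)
  qed
  show "hat \<omega> (us @ (\<lambda>x. f x *\<^sub>R v x) # ws) = f * hat \<omega> (us @ v # ws)" if "v \<in> Sec A E" for f v
  proof
    fix x
    have "\<omega> x (at_pt us x @ (f x *\<^sub>R v x) # at_pt ws x) = f x * \<omega> x (at_pt us x @ v x # at_pt ws x)"
      by (intro alt_formsD(3)[OF smooth_formsD(1)[OF \<omega> UNIV_I]] F Sec_fibre that)
    then show "hat \<omega> (us @ (\<lambda>x. f x *\<^sub>R v x) # ws) x = (f * hat \<omega> (us @ v # ws)) x"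
      by (simp add: hat_def)
  qed
  show "hat \<omega> (us @ v # v # ws) = 0" for v
  proof
    fix x show "hat \<omega> (us @ v # v # ws) x = 0 x"
      using alt_formsD(4)[OF smooth_formsD(1)[OF \<omega>, of x], of "at_pt us x @ v x # v x # at_pt ws x"] by (simp add: hat_def)
  qed
qed

lemma alt_map_sum_list:
  assumes W: "alt_map W" and ws: "set ws \<subseteq> Sec A E"
    and "\<And>i. i \<in> set is \<Longrightarrow> f i \<in> Cinf A" "\<And>i. i \<in> set is \<Longrightarrow> g i \<in> Sec A E"
  shows "W ((\<Sum>i\<leftarrow>is. (\<lambda>x. f i x *\<^sub>R g i x)) # ws) x = (\<Sum>i\<leftarrow>is. f i x * W (g i # ws) x)"
  using assms(3,4)
proof (induction "is")
  case Nil
  have "W (0 # ws) x = 0" using alt_map_0[OF W ws] by simp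
  then show ?case by (simp del: fun_app)
next
  case (Cons i "is")
  have 1: "(\<Sum>i\<leftarrow>is. (\<lambda>x. f i x *\<^sub>R g i x)) \<in> Sec A E"
    using Cons.prems by (intro Sec_sum_list Sec_smul) auto
  have 2: "(\<lambda>x. f i x *\<^sub>R g i x) \<in> Sec A E" using Cons.prems by (intro Sec_smul) auto
  have "W (((\<lambda>x. f i x *\<^sub>R g i x) + (\<Sum>i\<leftarrow>is. (\<lambda>x. f i x *\<^sub>R g i x))) # ws) =
     W ((\<lambda>x. f i x *\<^sub>R g i x) # ws) + W ((\<Sum>i\<leftarrow>is. (\<lambda>x. f i x *\<^sub>R g i x)) # ws)"
    by (rule alt_mapD(2)[OF W ws 2 1])
  moreover have "W ((\<lambda>x. f i x *\<^sub>R g i x) # ws) = f i * W (g i # ws)"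
    using Cons.prems by (intro alt_mapD(3)[OF W ws]) auto
  moreover have "W ((\<Sum>i\<leftarrow>is. (\<lambda>x. f i x *\<^sub>R g i x)) # ws) x = (\<Sum>i\<leftarrow>is. f i x * W (g i # ws) x)"
    using Cons by simp
  ultimately have "W (((\<lambda>x. f i x *\<^sub>R g i x) + (\<Sum>i\<leftarrow>is. (\<lambda>x. f i x *\<^sub>R g i x))) # ws) x =
     f i x * W (g i # ws) x + (\<Sum>i\<leftarrow>is. f i x * W (g i # ws) x)" by simp
  then show ?case by (simp del: fun_app)
qed

text \<open>
  Near \<open>x\<close> a section is a combination of global sections extending a frame, and the coefficients
  vanish at \<open>x\<close> if the section does.
\<close>

lemma alt_map_vanish:
  assumes W: "alt_map W" and ws: "set ws \<subseteq> Sec A E" and X: "X \<in> Sec A E" "X x = 0"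
  shows "W (X # ws) x = 0"
proof -
  obtain V e where V: "(V, e) \<in> frames E" "x \<in> V" by (rule obtain_frame)
  have oV: "open V" using frame_open[OF V(1)] .
  obtain \<theta> where \<theta>: "bump V x \<theta>" using bump_exists[OF oV V(2)] by blast
  then have \<theta>1: "\<theta> x = 1" "\<theta> \<in> Cinf A" and \<theta>0: "\<And>y. y \<notin> V \<Longrightarrow> \<theta> y = 0" by (auto simp: bump_def)
  define g where "g \<sigma> y = (if y \<in> V then \<theta> y *\<^sub>R \<sigma> y else 0)" for \<sigma> :: "'m \<Rightarrow> 'v" and y
  define f where "f \<sigma> y = (if y \<in> V then \<theta> y * coef e \<sigma> X y else 0)" for \<sigma> y
  have g: "g \<sigma> \<in> Sec A E" if "\<sigma> \<in> set e" for \<sigma>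
    unfolding g_def by (rule bump_section[OF \<theta> oV frame_smooth[OF V(1) that]])
  have f: "f \<sigma> \<in> Cinf A" if "\<sigma> \<in> set e" for \<sigma>
    unfolding f_def using X(1) smooth_section_coef[OF _ V(1) that, of UNIV X]
    by (intro bump_mult_smooth[OF \<theta> oV]) simp
  \<comment> \<open>One factor \<theta> sits in the coefficients and one in the sections, so their
    combination is \<theta>^2 X. The remainder h X has a coefficient that vanishes at x.\<close>
  define h where "h = 1 - \<theta> * \<theta>"
  have h: "h \<in> Cinf A" unfolding h_def by (intro Cinf_ring \<theta>1)
  have eq: "X = (\<Sum>\<sigma>\<leftarrow>e. (\<lambda>x. f \<sigma> x *\<^sub>R g \<sigma> x)) + (\<lambda>x. h x *\<^sub>R X x)"
  proof
    fix y
    have "(\<Sum>\<sigma>\<leftarrow>e. f \<sigma> y *\<^sub>R g \<sigma> y) = (\<theta> y * \<theta> y) *\<^sub>R X y"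
    proof (cases "y \<in> V")
      case True
      have "(\<Sum>\<sigma>\<leftarrow>e. f \<sigma> y *\<^sub>R g \<sigma> y) = (\<Sum>\<sigma>\<leftarrow>e. (\<theta> y * \<theta> y) *\<^sub>R (coef e \<sigma> X y *\<^sub>R \<sigma> y))"
        using True by (simp add: f_def g_def mult_ac)
      also have "\<dots> = (\<theta> y * \<theta> y) *\<^sub>R (\<Sum>\<sigma>\<leftarrow>e. coef e \<sigma> X y *\<^sub>R \<sigma> y)"
      proof -
        have "(\<Sum>\<sigma>\<leftarrow>es. c *\<^sub>R (coef e \<sigma> X y *\<^sub>R \<sigma> y)) = c *\<^sub>R (\<Sum>\<sigma>\<leftarrow>es. coef e \<sigma> X y *\<^sub>R \<sigma> y)" for c es
          by (induction es) (simp_all add: scaleR_add_right)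
        then show ?thesis .
      qed
      finally show ?thesis using coef_expansion[of V e y X] V(1) True Sec_fibre[OF X(1)] by simp
    next
      case False
      have "(\<Sum>\<sigma>\<leftarrow>es. f \<sigma> y *\<^sub>R g \<sigma> y) = 0" for es using False by (induction es) (simp_all add: f_def)
      then show ?thesis using \<theta>0[OF False] by simp
    qed
    then show "X y = ((\<Sum>\<sigma>\<leftarrow>e. (\<lambda>x. f \<sigma> x *\<^sub>R g \<sigma> x)) + (\<lambda>x. h x *\<^sub>R X x)) y"
      by (simp add: sum_list_apply h_def scaleR_diff_left)
  qed
  have s: "(\<Sum>\<sigma>\<leftarrow>e. (\<lambda>x. f \<sigma> x *\<^sub>R g \<sigma> x)) \<in> Sec A E" using f g by (intro Sec_sum_list Sec_smul) auto
  have "W (X # ws) = W ((\<Sum>\<sigma>\<leftarrow>e. (\<lambda>x. f \<sigma> x *\<^sub>R g \<sigma> x)) # ws) + W ((\<lambda>x. h x *\<^sub>R X x) # ws)"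
    by (subst eq) (rule alt_mapD(2)[OF W ws s Sec_smul[OF h X(1)]])
  also have "W ((\<lambda>x. h x *\<^sub>R X x) # ws) = h * W (X # ws)" by (rule alt_mapD(3)[OF W ws h X(1)])
  finally have eq2: "W (X # ws) = W ((\<Sum>\<sigma>\<leftarrow>e. (\<lambda>x. f \<sigma> x *\<^sub>R g \<sigma> x)) # ws) + h * W (X # ws)" .
  have "W (X # ws) x = W ((\<Sum>\<sigma>\<leftarrow>e. (\<lambda>x. f \<sigma> x *\<^sub>R g \<sigma> x)) # ws) x + h x * W (X # ws) x"
    using fun_cong[OF eq2, of x] by (simp only: plus_fun_apply times_fun_apply)
  also have "W ((\<Sum>\<sigma>\<leftarrow>e. (\<lambda>x. f \<sigma> x *\<^sub>R g \<sigma> x)) # ws) x = (\<Sum>\<sigma>\<leftarrow>e. f \<sigma> x * W (g \<sigma> # ws) x)"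
    by (rule alt_map_sum_list[OF W ws f g])
  also have "\<dots> = 0"
  proof -
    have "f \<sigma> x = 0" for \<sigma>
      using coef_linear(2)[OF V, of X \<sigma> "\<lambda>_. 0"] X subspace_0[OF fibre_subspace, of x] by (simp add: f_def coef_def)
    then show ?thesis by simp
  qed
  finally show ?thesis using \<theta>1 by (simp add: h_def)
qed

text \<open>By \<open>alt_map_vanish\<close> the head may be exchanged for any section with the same
  value at x; the new head is then absorbed into the map and the tail is treated by
  induction.\<close>

lemma alt_map_at_pt:
  assumes "alt_map W" "set Xs \<subseteq> Sec A E" "set Ys \<subseteq> Sec A E" "at_pt Xs x = at_pt Ys x"
  shows "W Xs x = W Ys x"
  using assms
proof (induction Xs arbitrary: Ys W)
  case Nil
  then show ?case by simp
next
  case (Cons X Xs)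
  then obtain Y Ys' where Y: "Ys = Y # Ys'" "X x = Y x" "at_pt Xs x = at_pt Ys' x" by (cases Ys) auto
  have m: "X \<in> Sec A E" "Y \<in> Sec A E" "set Xs \<subseteq> Sec A E" "set Ys' \<subseteq> Sec A E" using Cons.prems Y by auto
  have XY: "X + - Y \<in> Sec A E" using m by (intro Sec_add Sec_uminus)
  have "W ((X + - Y) # Xs) x = 0" using Y(2) by (intro alt_map_vanish[OF Cons.prems(1) m(3) XY]) simp
  moreover have "W ((X + - Y) # Xs) = W (X # Xs) + W (- Y # Xs)"
    by (rule alt_mapD(2)[OF Cons.prems(1) m(3,1) Sec_uminus[OF m(2)]])
  moreover have "W (- Y # Xs) = - W (Y # Xs)" by (rule alt_map_uminus[OF Cons.prems(1) m(3,2)])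
  ultimately have "W (X # Xs) x = W (Y # Xs) x" by simp
  also have "\<dots> = W (Y # Ys') x"
    by (rule Cons.IH[OF alt_map_ins[OF Cons.prems(1) m(2)] m(3,4) Y(3)])
  finally show ?case by (simp add: Y(1))
qed

text \<open>Inverse of \<open>hat\<close> on alternating maps. The choice of extensions is literally
  the one in \<open>differential\<close>, so that the two can be compared directly.\<close>

definition unhat :: "(('m \<Rightarrow> 'v) list \<Rightarrow> 'm \<Rightarrow> real) \<Rightarrow> 'm \<Rightarrow> 'v list \<Rightarrow> real" where
  "unhat W x vs = (if set vs \<subseteq> fibre E x then W (SOME Xs. set Xs \<subseteq> Sec A E \<and> at_pt Xs x = vs) x else 0)"

lemma unhat_apply:
  assumes "alt_map W" "set Xs \<subseteq> Sec A E"
  shows "unhat W x (at_pt Xs x) = W Xs x"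
proof -
  define Ys where "Ys = (SOME Ys. set Ys \<subseteq> Sec A E \<and> at_pt Ys x = at_pt Xs x)"
  have Ys: "set Ys \<subseteq> Sec A E \<and> at_pt Ys x = at_pt Xs x"
    unfolding Ys_def by (rule someI[of _ Xs]) (simp add: assms(2))
  have "W Ys x = W Xs x" by (rule alt_map_at_pt[OF assms(1) _ assms(2)]) (use Ys in auto)
  then show ?thesis using at_pt_fibre[OF assms(2)] by (simp add: unhat_def Ys_def)
qed

lemma hat_unhat: "alt_map W \<Longrightarrow> set Xs \<subseteq> Sec A E \<Longrightarrow> hat (unhat W) Xs = W Xs"
  by (simp add: hat_def unhat_apply)

lemma alt_map_prefix: "alt_map W \<Longrightarrow> set us \<subseteq> Sec A E \<Longrightarrow> hd_ok (\<lambda>ws. W (us @ ws))"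
  by (simp add: alt_map_def)

lemma unhat_alt_forms:
  assumes W: "alt_map W"
  shows "unhat W x \<in> alt_forms (fibre E x)"
proof (rule alt_formsI[OF fibre_subspace])
  fix vs assume "\<not> set vs \<subseteq> fibre E x" then show "unhat W x vs = 0" by (simp add: unhat_def)
next
  fix us u v ws
  assume m: "set us \<subseteq> fibre E x" "set ws \<subseteq> fibre E x" "u \<in> fibre E x" "v \<in> fibre E x"
  obtain Us where U: "set Us \<subseteq> Sec A E" "at_pt Us x = us" by (rule sections_through[OF m(1)])
  obtain Ws where Ws: "set Ws \<subseteq> Sec A E" "at_pt Ws x = ws" by (rule sections_through[OF m(2)])
  obtain X where X: "X \<in> Sec A E" "X x = u" by (rule section_through[OF m(3)])
  obtain Y where Y: "Y \<in> Sec A E" "Y x = v" by (rule section_through[OF m(4)])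
  have "W (Us @ (X + Y) # Ws) = W (Us @ X # Ws) + W (Us @ Y # Ws)"
    using alt_map_prefix[OF W U(1)] X Y Ws by (simp add: hd_ok_def)
  then have "unhat W x (at_pt (Us @ (X + Y) # Ws) x) = unhat W x (at_pt (Us @ X # Ws) x) + unhat W x (at_pt (Us @ Y # Ws) x)"
    using U Ws X Y Sec_add[OF X(1) Y(1)] by (subst (1 2 3) unhat_apply[OF W]) (auto simp del: map_append)
  then show "unhat W x (us @ (u + v) # ws) = unhat W x (us @ u # ws) + unhat W x (us @ v # ws)"
    using U Ws X Y by simp
next
  fix us v ws c
  assume m: "set us \<subseteq> fibre E x" "set ws \<subseteq> fibre E x" "v \<in> fibre E x"
  obtain Us where U: "set Us \<subseteq> Sec A E" "at_pt Us x = us" by (rule sections_through[OF m(1)])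
  obtain Ws where Ws: "set Ws \<subseteq> Sec A E" "at_pt Ws x = ws" by (rule sections_through[OF m(2)])
  obtain Y where Y: "Y \<in> Sec A E" "Y x = v" by (rule section_through[OF m(3)])
  have c: "(\<lambda>_. c) \<in> Cinf A" by (simp add: smooth_fun_const)
  have "W (Us @ (\<lambda>x. c *\<^sub>R Y x) # Ws) = (\<lambda>_. c) * W (Us @ Y # Ws)"
    using alt_map_prefix[OF W U(1)] Y Ws c by (simp add: hd_ok_def)
  then have "unhat W x (at_pt (Us @ (\<lambda>x. c *\<^sub>R Y x) # Ws) x) = c * unhat W x (at_pt (Us @ Y # Ws) x)"
    using U Ws Y Sec_smul[OF c Y(1)] by (subst (1 2) unhat_apply[OF W]) (auto simp del: map_append)
  then show "unhat W x (us @ (c *\<^sub>R v) # ws) = c * unhat W x (us @ v # ws)"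
    using U Ws Y by simp
next
  fix us v ws
  assume m: "set us \<subseteq> fibre E x" "set ws \<subseteq> fibre E x" "v \<in> fibre E x"
  obtain Us where U: "set Us \<subseteq> Sec A E" "at_pt Us x = us" by (rule sections_through[OF m(1)])
  obtain Ws where Ws: "set Ws \<subseteq> Sec A E" "at_pt Ws x = ws" by (rule sections_through[OF m(2)])
  obtain Y where Y: "Y \<in> Sec A E" "Y x = v" by (rule section_through[OF m(3)])
  have "W (Us @ Y # Y # Ws) = 0"
    using alt_map_prefix[OF W U(1)] Y Ws by (simp add: hd_ok_def)
  then have "unhat W x (at_pt (Us @ Y # Y # Ws) x) = 0"
    using U Ws Y by (subst unhat_apply[OF W]) (auto simp del: map_append)
  then show "unhat W x (us @ v # v # ws) = 0"
    using U Ws Y by simp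
qed

lemma unhat_smooth:
  assumes "alt_map W"
  shows "unhat W \<in> smooth_forms A E UNIV"
  by (rule smooth_formsI_global[OF unhat_alt_forms[OF assms]])
    (simp add: unhat_apply[OF assms], use alt_mapD(1)[OF assms] in auto)

lemma form_at_eqI:
  assumes "\<omega> x \<in> alt_forms (fibre E x)" "\<eta> x \<in> alt_forms (fibre E x)"
    "\<And>Xs. set Xs \<subseteq> Sec A E \<Longrightarrow> hat \<omega> Xs x = hat \<eta> Xs x"
  shows "\<omega> x = \<eta> x"
proof
  fix vs show "\<omega> x vs = \<eta> x vs"
  proof (cases "set vs \<subseteq> fibre E x")
    case True
    then obtain Xs where "set Xs \<subseteq> Sec A E" "at_pt Xs x = vs" by (rule sections_through)
    then show ?thesis using assms(3)[of Xs] by (simp add: hat_def)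
  next
    case False
    then show ?thesis using alt_formsD(1)[OF assms(1)] alt_formsD(1)[OF assms(2)] by simp
  qed
qed

lemma koszul_eq_dd:
  assumes "\<omega> \<in> smooth_forms A E UNIV" "set Xs \<subseteq> Sec A E"
  shows "koszul E \<omega> x Xs = dd Xs (hat \<omega>) x"
  unfolding dd_eq_koszul[OF hat_alt_map[OF assms(1)] assms(2)]
  by (simp add: koszul_def hat_def sum_fun_apply minus_one_power_apply)

text \<open>Both sides choose the same extension, so only the Koszul formula against the recursion
  is at issue. Tensoriality of \<open>dd\<close> removes the choice afterwards, through
  \<open>unhat_apply\<close>.\<close>

lemma differential_eq:
  assumes "\<omega> \<in> smooth_forms A E UNIV"
  shows "differential A E \<omega> = unhat (\<lambda>Xs. dd Xs (hat \<omega>))"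
proof (intro ext)
  fix x vs
  show "differential A E \<omega> x vs = unhat (\<lambda>Xs. dd Xs (hat \<omega>)) x vs"
  proof (cases "set vs \<subseteq> fibre E x")
    case True
    then obtain Xs where "set Xs \<subseteq> Sec A E \<and> at_pt Xs x = vs" using sections_through by metis
    then have "set (SOME Xs. set Xs \<subseteq> Sec A E \<and> at_pt Xs x = vs) \<subseteq> Sec A E"
      by (rule someI2) blast
    then show ?thesis using True by (simp add: differential_def unhat_def koszul_eq_dd[OF assms])
  qed (simp add: differential_def unhat_def)
qed

lemma differential_smooth: "\<omega> \<in> smooth_forms A E UNIV \<Longrightarrow> differential A E \<omega> \<in> smooth_forms A E UNIV"
  by (simp add: differential_eq unhat_smooth dd_alt_map hat_alt_map)

lemma hat_differential:
  "\<omega> \<in> smooth_forms A E UNIV \<Longrightarrow> set Xs \<subseteq> Sec A E \<Longrightarrow> hat (differential A E \<omega>) Xs = dd Xs (hat \<omega>)"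
  by (simp add: differential_eq hat_unhat dd_alt_map hat_alt_map)

lemma koszul_local:
  assumes "\<forall>\<^sub>F y in nhds x. \<omega> y = \<eta> y" "set Xs \<subseteq> Sec A E"
  shows "koszul E \<omega> x Xs = koszul E \<eta> x Xs"
proof -
  have x: "\<omega> x = \<eta> x" using assms(1) by (rule eventually_nhds_x_imp_x)
  have "anchor_deriv E (Xs ! i) (\<lambda>y. \<omega> y (at_pt (nths Xs (- {i})) y)) x = anchor_deriv E (Xs ! i) (\<lambda>y. \<eta> y (at_pt (nths Xs (- {i})) y)) x"
    if "i < length Xs" for i
  proof (rule anchor_deriv_local)
    show "(Xs ! i) x \<in> fibre E x" using that assms(2) Sec_fibre nth_mem by blast
    show "\<forall>\<^sub>F y in nhds x. \<omega> y (at_pt (nths Xs (- {i})) y) = \<eta> y (at_pt (nths Xs (- {i})) y)"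
      using assms(1) by (rule eventually_mono) simp
  qed
  then show ?thesis by (simp add: koszul_def x)
qed

text \<open>The form enters by its value at x and by anchor derivatives, which see germs only.
  Smoothness is not assumed, so a merely local representative can be exchanged for its
  cut-off.\<close>

lemma differential_local:
  assumes "\<forall>\<^sub>F y in nhds x. \<omega> y = \<eta> y"
  shows "differential A E \<omega> x = differential A E \<eta> x"
proof
  fix vs
  show "differential A E \<omega> x vs = differential A E \<eta> x vs"
  proof (cases "set vs \<subseteq> fibre E x")
    case True
    then obtain Xs where "set Xs \<subseteq> Sec A E \<and> at_pt Xs x = vs" using sections_through by metis
    then have "set (SOME Xs. set Xs \<subseteq> Sec A E \<and> at_pt Xs x = vs) \<subseteq> Sec A E"
      by (rule someI2) blast
    then show ?thesis using True by (simp add: differential_def koszul_local[OF assms])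
  qed (simp add: differential_def)
qed

end


section \<open>Multivector fields\<close>

lemma contraction_contr:
  "contraction F a \<omega> = contr (coord (SOME bs. basis_list F bs)) (SOME bs. basis_list F bs) a \<omega>"
  by (simp add: fun_eq_iff contraction_def Let_def contr_eq_sum dual_basis_eq)

lemma contraction_linear:
  "contraction F (a + b) \<omega> = contraction F a \<omega> + contraction F b \<omega>"
  "contraction F (c *\<^sub>R a) \<omega> = c *\<^sub>R contraction F a \<omega>"
  "contraction F (- a) \<omega> = - contraction F a \<omega>"
  "contraction F (a - b) \<omega> = contraction F a \<omega> - contraction F b \<omega>"
  "contraction F 0 \<omega> = 0"
  "contraction F a (\<omega> + \<eta>) = contraction F a \<omega> + contraction F a \<eta>"
  "contraction F a (c *\<^sub>R \<omega>) = c *\<^sub>R contraction F a \<omega>"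
  "contraction F a (- \<omega>) = - contraction F a \<omega>"
  "contraction F a (\<omega> - \<eta>) = contraction F a \<omega> - contraction F a \<eta>"
  "contraction F a 0 = 0"
  unfolding contraction_contr by (rule contr_linear)+

lemma contraction_scalar_form: "contraction F (scalar_form c) \<omega> = c *\<^sub>R \<omega>"
  unfolding contraction_contr by (rule contr_scalar_form)

lemma par_contraction: "par (contraction F a \<omega>) = contraction F (par a) (par \<omega>)"
  unfolding contraction_contr by (rule par_contr)

lemma hook_contraction:
  assumes "basis_list F bs" "\<omega> \<in> alt_forms F" "v \<in> F"
  shows "hook v (contraction F a \<omega>) = contraction F (par a) (hook v \<omega>)"
  unfolding contraction_contr
  using basis_list_subspace[OF assms(1)] basis_list_subset[OF someI[of "basis_list F", OF assms(1)]] assms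
  by (intro hook_contr)

lemma contraction_wedge_ev:
  assumes "basis_list F bs" "\<omega> \<in> alt_forms F" "v \<in> F"
  shows "contraction F (wedge (ev F v) a) \<omega> = contraction F a (hook v \<omega>)"
  unfolding contraction_contr
  by (rule contr_wedge_ev_basis[OF someI[of "basis_list F", OF assms(1)] assms(2,3)])

definition dframe :: "('m \<Rightarrow> 'v::real_vector) list \<Rightarrow> ('m \<Rightarrow> 'v \<Rightarrow> real) list" where
  "dframe e = map (\<lambda>i x. dual_basis (at_pt e x) ! i) [0..<length e]"

lemma at_pt_dframe: "at_pt (dframe e) x = map (coord (at_pt e x)) (at_pt e x)"
  by (rule nth_equalityI) (simp_all add: dframe_def dual_basis_eq)

lemma of_fun_eq: "of_fun f x = scalar_form (f x)"
  by (simp add: fun_eq_iff of_fun_def scalar_form_def)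

lemma of_sec_eq: "of_sec E X x = ev (fibre E x) (X x)"
  by (simp add: fun_eq_iff of_sec_def ev_def)

lemma parity_eq: "parity a x = par (a x)"
  by (simp add: fun_eq_iff parity_def par_def)

lemma wedge_sec_eq: "(a \<and>\<^sub>\<A> b) x = wedge (a x) (b x)"
  by (simp add: wedge_sec_def)

context vector_bundle
begin

lemma fibre_basis: obtains bs where "basis_list (fibre E x) bs"
proof -
  obtain V e where "(V, e) \<in> frames E" "x \<in> V" by (rule obtain_frame)
  then show ?thesis using frame_basis that by blast
qed

lemma multivectors_iff: "a \<in> multivectors A E \<longleftrightarrow> (\<forall>x. a x \<in> alt_forms (dual_space (fibre E x))) \<and>
   (\<forall>V e s. (V, e) \<in> frames E \<longrightarrow> set s \<subseteq> set (dframe e) \<longrightarrow> smooth_fun_on A V (\<lambda>x. a x (at_pt s x)))"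
  unfolding multivectors_def smooth_forms_def dual_bundle_def dframe_def by auto

lemma multivectorsI:
  assumes "\<And>x. a x \<in> alt_forms (dual_space (fibre E x))"
    "\<And>V e s. (V, e) \<in> frames E \<Longrightarrow> set s \<subseteq> set (dframe e) \<Longrightarrow> smooth_fun_on A V (\<lambda>x. a x (at_pt s x))"
  shows "a \<in> multivectors A E"
  using assms by (simp add: multivectors_iff)

lemma multivectors_alt: "a \<in> multivectors A E \<Longrightarrow> a x \<in> alt_forms (dual_space (fibre E x))"
  by (simp add: multivectors_iff)

lemma multivectors_smooth:
  "a \<in> multivectors A E \<Longrightarrow> (V, e) \<in> frames E \<Longrightarrow> set s \<subseteq> set (dframe e) \<Longrightarrow> smooth_fun_on A V (\<lambda>x. a x (at_pt s x))"
  by (simp add: multivectors_iff)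

lemma multivector_coef_smooth:
  assumes "a \<in> multivectors A E" "(V, e) \<in> frames E"
  shows "smooth_fun_on A V (\<lambda>x. a x (nths (map (coord (at_pt e x)) (at_pt e x)) I))"
proof -
  have "smooth_fun_on A V (\<lambda>x. a x (at_pt (nths (dframe e) I) x))"
    by (rule multivectors_smooth[OF assms set_nths_subset])
  then show ?thesis by (simp only: nths_map[symmetric] at_pt_dframe)
qed

lemma multivectors_add: "a \<in> multivectors A E \<Longrightarrow> b \<in> multivectors A E \<Longrightarrow> a + b \<in> multivectors A E"
  by (rule multivectorsI)
    (auto intro: alt_forms_lin multivectors_alt smooth_fun_add multivectors_smooth frame_open)

lemma multivectors_scale: "a \<in> multivectors A E \<Longrightarrow> t *\<^sub>R a \<in> multivectors A E"
  by (rule multivectorsI)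
    (auto intro: alt_forms_lin multivectors_alt smooth_fun_mult smooth_fun_const multivectors_smooth frame_open)

lemma multivectors_0: "0 \<in> multivectors A E"
  by (rule multivectorsI) (auto intro: alt_forms_lin smooth_fun_const)

lemma multivectors_uminus: "a \<in> multivectors A E \<Longrightarrow> - a \<in> multivectors A E"
  using multivectors_scale[of a "-1"] by simp

lemma multivectors_parity: "a \<in> multivectors A E \<Longrightarrow> parity a \<in> multivectors A E"
proof (rule multivectorsI)
  fix V e s assume "a \<in> multivectors A E" "(V, e) \<in> frames E" "set s \<subseteq> set (dframe e)"
  then show "smooth_fun_on A V (\<lambda>x. parity a x (at_pt s x))"
    by (simp add: parity_def smooth_fun_mult smooth_fun_const multivectors_smooth frame_open)
qed (simp add: parity_eq par_alt_forms multivectors_alt)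

lemma multivectors_wedge:
  assumes "a \<in> multivectors A E" "b \<in> multivectors A E"
  shows "a \<and>\<^sub>\<A> b \<in> multivectors A E"
proof (rule multivectorsI)
  fix x show "(a \<and>\<^sub>\<A> b) x \<in> alt_forms (dual_space (fibre E x))"
    by (simp add: wedge_sec_eq wedge_alt_forms subspace_dual_space multivectors_alt assms)
next
  fix V e s assume V: "(V, e) \<in> frames E" and s: "set s \<subseteq> set (dframe e)"
  have n: "set (nths s I) \<subseteq> set (dframe e)" for I using s set_nths_subset[of s I] by (rule order_trans[rotated])
  have "smooth_fun_on A V (\<lambda>x. \<Sum>I\<in>Pow {..<length s}. (-1) ^ card {(i, j). i \<in> I \<and> j \<notin> I \<and> j < i}
      * a x (at_pt (nths s I) x) * b x (at_pt (nths s (- I)) x))"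
    by (intro smooth_fun_sum smooth_fun_mult smooth_fun_const frame_open[OF V] multivectors_smooth[OF _ V] assms n)
  then show "smooth_fun_on A V (\<lambda>x. (a \<and>\<^sub>\<A> b) x (at_pt s x))"
    by (simp add: wedge_sec_eq wedge_def nths_map)
qed

lemma of_fun_multivectors:
  assumes "f \<in> Cinf A" shows "of_fun f \<in> multivectors A E"
proof (rule multivectorsI)
  fix V e and s :: "('m \<Rightarrow> 'v \<Rightarrow> real) list"
  have "smooth_fun_on A V f" using assms smooth_fun_subset by auto
  then show "smooth_fun_on A V (\<lambda>x. of_fun f x (at_pt s x))"
    by (cases s) (simp_all add: of_fun_def smooth_fun_const)
qed (simp add: of_fun_eq scalar_form_alt_forms)

lemma of_sec_multivectors:
  assumes "X \<in> Sec A E" shows "of_sec E X \<in> multivectors A E"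
proof (rule multivectorsI)
  fix x show "of_sec E X x \<in> alt_forms (dual_space (fibre E x))"
    unfolding of_sec_eq by (rule ev_alt_forms[OF Sec_fibre[OF assms]])
next
  fix V e s assume V: "(V, e) \<in> frames E" and s: "set s \<subseteq> set (dframe e)"
  show "smooth_fun_on A V (\<lambda>x. of_sec E X x (at_pt s x))"
  proof (cases "length s = 1")
    case True
    then obtain \<sigma> where \<sigma>: "s = [\<sigma>]" by (auto simp: length_Suc_conv)
    then obtain i where i: "i < length e" "\<sigma> = (\<lambda>x. dual_basis (at_pt e x) ! i)"
      using s by (auto simp: dframe_def)
    have "smooth_fun_on A V (coef e (e ! i) X)"
      using smooth_section_coef[of UNIV X V e "e ! i"] V i assms by simp
    then show ?thesis
    proof (rule smooth_fun_cong[OF frame_open[OF V], rotated])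
      fix x assume x: "x \<in> V"
      have "\<sigma> x = coord (at_pt e x) ((e ! i) x)" using i by (simp add: dual_basis_eq)
      then show "coef e (e ! i) X x = of_sec E X x (at_pt s x)"
        using coord_dual_space[OF frame_basis[OF V x]] by (simp add: \<sigma> of_sec_def coef_def)
    qed
  next
    case False
    then show ?thesis by (simp add: of_sec_eq ev_degree_1 smooth_fun_const)
  qed
qed

text \<open>By independence of the basis the local frame computes the contraction, which gives a
  finite sum of products of smooth components.\<close>

lemma contraction_smooth:
  assumes U: "open U" and a: "a \<in> multivectors A E" and \<omega>: "\<omega> \<in> smooth_forms A E U"
  shows "(\<lambda>x. contraction (fibre E x) (a x) (\<omega> x)) \<in> smooth_forms A E U"
  unfolding smooth_forms_def
proof (intro CollectI conjI ballI, goal_cases)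
  case (1 x)
  obtain bs where bs: "basis_list (fibre E x) bs" by (rule fibre_basis)
  show ?case 
    by (rule contraction_alt_forms[OF bs smooth_formsD(1)[OF \<omega> 1] multivectors_alt[OF a]])
next
  case (2 p)
  obtain V e where p: "p = (V, e)" by (cases p)
  then have V: "(V, e) \<in> frames E" using 2 by simp
  have o: "open (U \<inter> V)" using U frame_open[OF V] by blast
  have "smooth_fun_on A (U \<inter> V) (\<lambda>x. contraction (fibre E x) (a x) (\<omega> x) (at_pt s x))" if s: "set s \<subseteq> set e" for s
  proof -
    have n: "set (nths e I @ s) \<subseteq> set e" for I using s set_nths_subset[of e I] by simp
    have "smooth_fun_on A (U \<inter> V) (\<lambda>x. \<Sum>I\<in>Pow {..<length e}.
        a x (nths (map (coord (at_pt e x)) (at_pt e x)) I) * \<omega> x (at_pt (nths e I @ s) x))"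
      by (intro smooth_fun_sum smooth_fun_mult o smooth_fun_subset[OF multivector_coef_smooth[OF a V]]
          smooth_formsD(2)[OF \<omega> V n] Int_lower2)
    then show ?thesis
    proof (rule smooth_fun_cong[OF o, rotated])
      fix x assume x: "x \<in> U \<inter> V"
      show "(\<Sum>I\<in>Pow {..<length e}. a x (nths (map (coord (at_pt e x)) (at_pt e x)) I) * \<omega> x (at_pt (nths e I @ s) x))
        = contraction (fibre E x) (a x) (\<omega> x) (at_pt s x)"
        using contraction_eq_contr[OF frame_basis[OF V, of x] smooth_formsD(1)[OF \<omega>, of x] multivectors_alt[OF a, of x]] x
        by (simp add: contr_eq_sum nths_map)
    qed
  qed
  then show ?case by (simp add: p)
qed

text \<open>A component of b in a dual frame is, locally, a component of \<eta> divided by the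
  nowhere vanishing value of \<mu> on the reordered frame. This gives smoothness of a b that has
  been chosen point by point.\<close>

lemma multivectorsI_star:
  assumes b: "\<And>x. b x \<in> alt_forms (dual_space (fibre E x))"
    and loc: "\<And>x. \<exists>N \<mu> \<eta>. open N \<and> x \<in> N \<and> \<mu> \<in> smooth_forms A E N \<and> \<eta> \<in> smooth_forms A E N \<and>
      (\<forall>y\<in>N. top_form (fibre E y) (\<mu> y) \<and> contraction (fibre E y) (b y) (\<mu> y) = \<eta> y)"
  shows "b \<in> multivectors A E"
proof (rule multivectorsI[OF b])
  fix V e s assume V: "(V, e) \<in> frames E" and s: "set s \<subseteq> set (dframe e)"
  obtain "is" where "is": "s = map (\<lambda>i x. dual_basis (at_pt e x) ! i) is" "set is \<subseteq> {..<length e}"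
  proof -
    have "\<exists>is. s = map (\<lambda>i x. dual_basis (at_pt e x) ! i) is \<and> set is \<subseteq> {..<length e}"
      using s
    proof (induction s)
      case (Cons \<sigma> s)
      then obtain "is" where "s = map (\<lambda>i x. dual_basis (at_pt e x) ! i) is" "set is \<subseteq> {..<length e}" by auto
      moreover obtain i where "i < length e" "\<sigma> = (\<lambda>x. dual_basis (at_pt e x) ! i)"
        using Cons.prems by (auto simp: dframe_def)
      ultimately show ?case by (intro exI[of _ "i # is"]) auto
    qed simp
    then show ?thesis using that by auto
  qed
  have at: "at_pt s x = map (coord (at_pt e x)) (at_pt (map ((!) e) is) x)" for x
    using "is" by (auto simp: dual_basis_eq)
  show "smooth_fun_on A V (\<lambda>x. b x (at_pt s x))"
  proof (cases "distinct is")
    case False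
    have "\<not> distinct (at_pt s x)" for x using False by (auto simp: "is"(1) distinct_map)
    then have "b x (at_pt s x) = 0" for x using alt_formsD(4)[OF b] by simp
    then show ?thesis by (simp add: smooth_fun_const)
  next
    case True
    \<comment> \<open>The indices not in \<open>is\<close> complete the chosen frame elements to a
      reordered frame, \<open>s'\<close> followed by \<open>t'\<close>.\<close>
    define js where "js = filter (\<lambda>j. j \<notin> set is) [0..<length e]"
    define s' where "s' = map ((!) e) is"
    define t' where "t' = map ((!) e) js"
    have ij: "distinct (is @ js)" "set (is @ js) = {..<length e}"
      using True "is"(2) by (auto simp: js_def)
    have "set (s' @ t') = (!) e ` set (is @ js)" by (simp add: s'_def t'_def image_Un)
    also have "\<dots> = set e" unfolding ij(2) by (simp add: lessThan_atLeast0 nth_image)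
    finally have st: "set (s' @ t') = set e" .
    then have st2: "set t' \<subseteq> set e" by auto
    show ?thesis
    proof (rule smooth_fun_local)
      fix x assume x: "x \<in> V"
      from loc[of x] obtain N \<mu> \<eta> where N: "open N" "x \<in> N" "\<mu> \<in> smooth_forms A E N" "\<eta> \<in> smooth_forms A E N"
        "\<forall>y\<in>N. top_form (fibre E y) (\<mu> y) \<and> contraction (fibre E y) (b y) (\<mu> y) = \<eta> y" by auto
      have o: "open (N \<inter> V)" using N(1) frame_open[OF V] by blast
      have bas: "basis_list (fibre E y) (at_pt s' y @ at_pt t' y)" and co: "coord (at_pt s' y @ at_pt t' y) = coord (at_pt e y)"
        if "y \<in> V" for y
      proof -
        note B = frame_basis[OF V that]
        have lt: "i < length e" if "i \<in> set (is @ js)" for i using that unfolding ij(2) by simp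
        have eq: "at_pt s' y @ at_pt t' y = map (\<lambda>i. (e ! i) y) (is @ js)" by (simp add: s'_def t'_def)
        have "inj_on (\<lambda>i. (e ! i) y) (set (is @ js))"
        proof (rule inj_onI)
          fix i j assume m: "i \<in> set (is @ js)" "j \<in> set (is @ js)" and h: "(e ! i) y = (e ! j) y"
          have "distinct (at_pt e y)" using B by (simp add: basis_list_def)
          from nth_eq_iff_index_eq[OF this, of i j] show "i = j" using lt[OF m(1)] lt[OF m(2)] h by simp
        qed
        then have dist: "distinct (at_pt s' y @ at_pt t' y)" unfolding eq distinct_map using ij(1) by simp
        have seteq: "set (at_pt s' y @ at_pt t' y) = set (at_pt e y)"
          by (simp only: map_append[symmetric] set_map st)
        show "basis_list (fibre E y) (at_pt s' y @ at_pt t' y)"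
          using B dist unfolding basis_list_def seteq by simp
        show "coord (at_pt s' y @ at_pt t' y) = coord (at_pt e y)"
          unfolding coord_def seteq ..
      qed
      have "smooth_fun_on A (N \<inter> V) (\<lambda>y. \<eta> y (at_pt t' y) * inverse (\<mu> y (at_pt (s' @ t') y)))"
      proof (intro smooth_fun_mult smooth_fun_inverse o)
        show "smooth_fun_on A (N \<inter> V) (\<lambda>y. \<eta> y (at_pt t' y))" by (rule smooth_formsD(2)[OF N(4) V st2])
        show "smooth_fun_on A (N \<inter> V) (\<lambda>y. \<mu> y (at_pt (s' @ t') y))"
          by (rule smooth_formsD(2)[OF N(3) V]) (simp only: st)
        show "\<mu> y (at_pt (s' @ t') y) \<noteq> 0" if "y \<in> N \<inter> V" for y
          using top_form_basis_nonzero[OF bas, of y "\<mu> y"] N(5) that by simp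
      qed
      then have "smooth_fun_on A (N \<inter> V) (\<lambda>y. b y (at_pt s y))"
      proof (rule smooth_fun_cong[OF o, rotated])
        fix y assume y: "y \<in> N \<inter> V"
        have "contraction (fibre E y) (b y) (\<mu> y) (at_pt t' y) =
          b y (map (coord (at_pt s' y @ at_pt t' y)) (at_pt s' y)) * \<mu> y (at_pt s' y @ at_pt t' y)"
          using N(5) y by (intro contraction_top bas b) auto
        then show "\<eta> y (at_pt t' y) * inverse (\<mu> y (at_pt (s' @ t') y)) = b y (at_pt s y)"
          using y N(5) co[of y] top_form_basis_nonzero[OF bas, of y "\<mu> y"] by (simp add: at s'_def[symmetric])
      qed
      then show "\<exists>T. open T \<and> x \<in> T \<and> smooth_fun_on A T (\<lambda>x. b x (at_pt s x))"
        using o x N(2) by (intro exI[of _ "N \<inter> V"]) simp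
    qed
  qed
qed

lemma multivectors_deg_subset: "a \<in> multivectors_deg A E p \<Longrightarrow> a \<in> multivectors A E"
  by (simp add: multivectors_deg_def)

lemma multivectors_degD: "a \<in> multivectors_deg A E p \<Longrightarrow> int (length \<xi>s) \<noteq> p \<Longrightarrow> a x \<xi>s = 0"
  by (simp add: multivectors_deg_def)

lemma of_fun_deg: "f \<in> Cinf A \<Longrightarrow> of_fun f \<in> multivectors_deg A E 0"
  using of_fun_multivectors[of f] by (auto simp: multivectors_deg_def of_fun_def)

lemma of_sec_deg: "X \<in> Sec A E \<Longrightarrow> of_sec E X \<in> multivectors_deg A E 1"
  using of_sec_multivectors[of X] by (auto simp: multivectors_deg_def of_sec_eq ev_degree_1)

lemma multivectors_deg_add: "a \<in> multivectors_deg A E p \<Longrightarrow> b \<in> multivectors_deg A E p \<Longrightarrow> a + b \<in> multivectors_deg A E p"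
  by (auto simp: multivectors_deg_def multivectors_add)

lemma multivectors_deg_0: "0 \<in> multivectors_deg A E p"
  by (auto simp: multivectors_deg_def multivectors_0)

lemma multivectors_deg_scale: "a \<in> multivectors_deg A E p \<Longrightarrow> c *\<^sub>R a \<in> multivectors_deg A E p"
  by (auto simp: multivectors_deg_def multivectors_scale)

lemma multivectors_deg_neg: "a \<in> multivectors_deg A E p \<Longrightarrow> p < 0 \<Longrightarrow> a = 0"
  by (auto simp: multivectors_deg_def fun_eq_iff)

lemma multivectors_deg_wedge:
  assumes a: "a \<in> multivectors_deg A E p" and b: "b \<in> multivectors_deg A E q"
  shows "a \<and>\<^sub>\<A> b \<in> multivectors_deg A E (p + q)"
proof (cases "p < 0 \<or> q < 0")
  case True
  then have "a = 0 \<or> b = 0" using multivectors_deg_neg[OF a] multivectors_deg_neg[OF b] by auto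
  then have "(a \<and>\<^sub>\<A> b) x = 0" for x by (auto simp: wedge_sec_eq)
  then have "a \<and>\<^sub>\<A> b = 0" by (intro ext) simp
  then show ?thesis by (simp add: multivectors_deg_0)
next
  case False
  have "(a \<and>\<^sub>\<A> b) x \<xi>s = 0" if "int (length \<xi>s) \<noteq> p + q" for x \<xi>s
    unfolding wedge_sec_eq
    by (rule wedge_degree[where p = "nat p" and q = "nat q"])
      (use False that multivectors_degD[OF a] multivectors_degD[OF b] in auto)
  then show ?thesis using multivectors_wedge[of a b] a b by (simp add: multivectors_deg_def)
qed

lemma par_deg:
  assumes "a \<in> multivectors_deg A E p"
  shows "par (a x) = ((-1) powi p) *\<^sub>R a x"
proof
  fix \<xi>s
  show "par (a x) \<xi>s = (((-1) powi p) *\<^sub>R a x) \<xi>s"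
    using multivectors_degD[OF assms, of \<xi>s x] by (cases "int (length \<xi>s) = p") (auto simp: par_def)
qed

primrec wedge_secs :: "('m \<Rightarrow> 'v) list \<Rightarrow> ('m \<Rightarrow> real) \<Rightarrow> 'm \<Rightarrow> ('v \<Rightarrow> real) list \<Rightarrow> real" where
  "wedge_secs [] f = of_fun f"
| "wedge_secs (X # Xs) f = of_sec E X \<and>\<^sub>\<A> wedge_secs Xs f"

lemma wedge_secs_apply: "wedge_secs Xs f x \<xi>s = (f x *\<^sub>R wedge_list (fibre E x) (at_pt Xs x)) \<xi>s"
proof -
  have "wedge_secs Xs f x \<in> {f x *\<^sub>R wedge_list (fibre E x) (at_pt Xs x)}"
  proof (induction Xs)
    case Nil
    show ?case by (simp add: fun_eq_iff of_fun_def scalar_form_def)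
  next
    case (Cons X Xs)
    then show ?case by (simp add: wedge_sec_eq of_sec_eq del: fun_app)
  qed
  then show ?thesis by simp
qed

text \<open>
  Near a point every multivector field is a sum of products of global sections and functions, so a
  local property needs to be checked on functions and under multiplication with sections only.
\<close>

lemma multivector_induct_near [consumes 1, case_names local zero add func sec]:
  assumes c: "c \<in> multivectors_deg A E q"
    and local: "\<And>q c c'. c \<in> multivectors_deg A E q \<Longrightarrow> c' \<in> multivectors_deg A E q \<Longrightarrow>
      \<forall>\<^sub>F y in nhds x. c y = c' y \<Longrightarrow> P q c' \<Longrightarrow> P q c"
    and zero: "\<And>q. P q 0"
    and add: "\<And>q c c'. c \<in> multivectors_deg A E q \<Longrightarrow> c' \<in> multivectors_deg A E q \<Longrightarrow> P q c \<Longrightarrow> P q c' \<Longrightarrow> P q (c + c')"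
    and func: "\<And>f. f \<in> Cinf A \<Longrightarrow> P 0 (of_fun f)"
    and sec: "\<And>q X c. X \<in> Sec A E \<Longrightarrow> c \<in> multivectors_deg A E q \<Longrightarrow> P q c \<Longrightarrow> P (q + 1) (of_sec E X \<and>\<^sub>\<A> c)"
  shows "P q c"
proof -
  obtain V e where V: "(V, e) \<in> frames E" "x \<in> V" by (rule obtain_frame)
  have oV: "open V" using frame_open[OF V(1)] .
  obtain \<theta> where \<theta>: "bump V x \<theta>" using bump_exists[OF oV V(2)] by blast
  then obtain N where N: "open N" "x \<in> N" "N \<subseteq> V" "\<forall>y\<in>N. \<theta> y = 1" by (auto simp: bump_def)
  define g where "g \<sigma> y = (if y \<in> V then \<theta> y *\<^sub>R \<sigma> y else 0)" for \<sigma> :: "'m \<Rightarrow> 'v" and y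
  have g: "g \<sigma> \<in> Sec A E" if "\<sigma> \<in> set e" for \<sigma>
    unfolding g_def by (rule bump_section[OF \<theta> oV frame_smooth[OF V(1) that]])
  \<comment> \<open>The cut-off is 1 on \<open>N\<close>, so the global coefficients and sections
    agree there with the coefficients of \<open>c\<close> and the frame.\<close>
  define k where "k I y = (if y \<in> V then \<theta> y * c y (nths (map (coord (at_pt e y)) (at_pt e y)) I) else 0)" for I y
  have k: "k I \<in> Cinf A" for I
    unfolding k_def by (rule bump_mult_smooth[OF \<theta> oV multivector_coef_smooth[OF multivectors_deg_subset[OF c] V(1)]])
  have W: "wedge_secs Xs f \<in> multivectors_deg A E (int (length Xs)) \<and> P (int (length Xs)) (wedge_secs Xs f)"
    if "set Xs \<subseteq> Sec A E" "f \<in> Cinf A" for Xs f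
    using that(1)
  proof (induction Xs)
    case Nil
    show ?case using func[OF that(2)] of_fun_deg[OF that(2)] by simp
  next
    case (Cons X Xs)
    then have X: "X \<in> Sec A E" and IH: "wedge_secs Xs f \<in> multivectors_deg A E (int (length Xs))" "P (int (length Xs)) (wedge_secs Xs f)"
      by auto
    from sec[OF X IH] multivectors_deg_wedge[OF of_sec_deg[OF X] IH(1)] show ?case by (simp add: add.commute)
  qed
  \<comment> \<open>Only index sets of size q are kept, so that every summand and every partial sum
    has degree q, as \<open>add\<close> and \<open>local\<close> demand.\<close>
  define T where "T = {I \<in> Pow {..<length e}. int (card I) = q}"
  define h where "h I = wedge_secs (map g (nths e I)) (k I)" for I
  have len: "length (nths e I) = card I" if "I \<subseteq> {..<length e}" for I
  proof -
    have "{i. i < length e \<and> i \<in> I} = I" using that by auto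
    then show ?thesis by (simp add: length_nths)
  qed
  have hP: "h I \<in> multivectors_deg A E q \<and> P q (h I)" if "I \<in> T" for I
  proof -
    have "set (map g (nths e I)) \<subseteq> Sec A E" using g set_nths_subset[of e I] by auto
    from W[OF this k[of I]] show ?thesis using that len[of I] by (simp add: h_def T_def)
  qed
  have fT: "finite T" by (simp add: T_def)
  have sumP: "sum h T' \<in> multivectors_deg A E q \<and> P q (sum h T')" if "T' \<subseteq> T" for T'
    using finite_subset[OF that fT] that
  proof (induction T' rule: finite_induct)
    case empty
    show ?case using zero multivectors_deg_0 by (simp del: fun_app)
  next
    case (insert I T')
    then have "h I \<in> multivectors_deg A E q" "P q (h I)" "sum h T' \<in> multivectors_deg A E q" "P q (sum h T')"
      using hP[of I] by auto
    then show ?case unfolding sum.insert[OF insert.hyps] by (intro conjI add multivectors_deg_add)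
  qed
  have "\<forall>\<^sub>F y in nhds x. c y = sum h T y"
    unfolding eventually_nhds
  proof (intro exI[of _ N] conjI N(1,2) ballI)
    fix y assume y: "y \<in> N"
    then have yV: "y \<in> V" "\<theta> y = 1" using N by auto
    have gs: "g \<sigma> y = \<sigma> y" for \<sigma> using yV by (simp add: g_def)
    note B = frame_basis[OF V(1) yV(1)]
    have "c y = (\<Sum>I\<in>Pow {..<length (at_pt e y)}. c y (nths (map (coord (at_pt e y)) (at_pt e y)) I) *\<^sub>R wedge_list (fibre E y) (nths (at_pt e y) I))"
      by (rule multivector_expansion[OF B multivectors_alt[OF multivectors_deg_subset[OF c]], symmetric])
    also have "\<dots> = (\<Sum>I\<in>T. c y (nths (map (coord (at_pt e y)) (at_pt e y)) I) *\<^sub>R wedge_list (fibre E y) (nths (at_pt e y) I))"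
    proof (rule sum.mono_neutral_right)
      show "\<forall>I\<in>Pow {..<length (at_pt e y)} - T. c y (nths (map (coord (at_pt e y)) (at_pt e y)) I) *\<^sub>R wedge_list (fibre E y) (nths (at_pt e y) I) = 0"
      proof
        fix I assume I: "I \<in> Pow {..<length (at_pt e y)} - T"
        then have "int (length (nths (map (coord (at_pt e y)) (at_pt e y)) I)) \<noteq> q"
          using len[of I] by (auto simp: T_def nths_map)
        then have "c y (nths (map (coord (at_pt e y)) (at_pt e y)) I) = 0" by (rule multivectors_degD[OF c])
        then show "c y (nths (map (coord (at_pt e y)) (at_pt e y)) I) *\<^sub>R wedge_list (fibre E y) (nths (at_pt e y) I) = 0"
          by simp
      qed
    qed (auto simp: T_def)
    also have "\<dots> = (\<Sum>I\<in>T. h I y)"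
    proof (rule sum.cong[OF refl])
      fix I
      have "at_pt (map g (nths e I)) y = nths (at_pt e y) I" by (simp add: nths_map gs o_def)
      then show "c y (nths (map (coord (at_pt e y)) (at_pt e y)) I) *\<^sub>R wedge_list (fibre E y) (nths (at_pt e y) I) = h I y"
        using yV by (simp add: fun_eq_iff h_def wedge_secs_apply k_def)
    qed
    finally show "c y = sum h T y" by (simp add: sum_fun_apply)
  qed
  then show ?thesis using sumP[OF order_refl] by (intro local[OF c]) auto
qed

end


section \<open>The Lie derivative and the Schouten bracket\<close>

context lie_rinehart
begin

lemma LX_length_0:
  assumes "X \<in> S" "set Zs \<subseteq> S" "\<And>ws. set ws \<subseteq> S \<Longrightarrow> length ws = length Zs \<Longrightarrow> W ws = 0"
  shows "LX X Zs W = 0"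
  using assms
proof (induction Zs arbitrary: W)
  case Nil
  then show ?case by (simp add: rho_0)
next
  case (Cons Z Zs)
  have "LX X Zs (\<lambda>ws. W (Z # ws)) = 0" using Cons.prems by (intro Cons.IH) auto
  moreover have "W (lb X Z # Zs) = 0" using Cons.prems by (intro Cons.prems(3)) (auto intro: lb_S)
  ultimately show ?case by simp
qed

text \<open>Every term of \<open>dd Zs W\<close> evaluates \<open>W\<close> on lists one shorter
  than \<open>Zs\<close>, since \<open>LX\<close> preserves the length.\<close>

lemma dd_length_0:
  assumes "set Zs \<subseteq> S" "\<And>ws. set ws \<subseteq> S \<Longrightarrow> Suc (length ws) = length Zs \<Longrightarrow> W ws = 0"
  shows "dd Zs W = 0"
  using assms
proof (induction Zs arbitrary: W)
  case (Cons Z Zs)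
  have "dd Zs (\<lambda>ws. W (Z # ws)) = 0" using Cons.prems by (intro Cons.IH) auto
  moreover have "LX Z Zs W = 0" using Cons.prems by (intro LX_length_0) auto
  ultimately show ?case by simp
qed simp

lemma C_sign: "f \<in> C \<Longrightarrow> (-1) ^ n * f \<in> C"
  by (induction n) (auto simp: C_uminus)

lemma C_valued_sign: "C_valued W \<Longrightarrow> C_valued (\<lambda>ws. (-1) ^ length ws * W ws)"
  by (simp add: C_valued_def C_sign)

lemma LX_sign:
  "X \<in> S \<Longrightarrow> set Zs \<subseteq> S \<Longrightarrow> C_valued W \<Longrightarrow> LX X Zs (\<lambda>ws. (-1) ^ length ws * W ws) = (-1) ^ length Zs * LX X Zs W"
proof (induction Zs arbitrary: W)
  case (Cons Z Zs)
  have c: "C_valued (\<lambda>ws. W (Z # ws))" using Cons.prems by (simp add: C_valued_ins)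
  have "LX X Zs (\<lambda>ws. - ((-1) ^ length ws * W (Z # ws))) = - LX X Zs (\<lambda>ws. (-1) ^ length ws * W (Z # ws))"
    using Cons.prems by (intro LX_uminus C_valued_sign[OF c]) auto
  then show ?case using Cons.IH[OF _ _ c] Cons.prems by (simp add: algebra_simps)
qed simp

text \<open>Each inserted argument reverses the grading sign, while \<open>LX\<close> commutes with
  it; the leading minus is the odd degree of d.\<close>

lemma dd_sign:
  "set Zs \<subseteq> S \<Longrightarrow> C_valued W \<Longrightarrow> dd Zs (\<lambda>ws. (-1) ^ length ws * W ws) = - ((-1) ^ length Zs * dd Zs W)"
proof (induction Zs arbitrary: W)
  case (Cons Z Zs)
  have c: "C_valued (\<lambda>ws. W (Z # ws))" using Cons.prems by (simp add: C_valued_ins)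
  have "dd Zs (\<lambda>ws. - ((-1) ^ length ws * W (Z # ws))) = - dd Zs (\<lambda>ws. (-1) ^ length ws * W (Z # ws))"
    using Cons.prems by (intro dd_uminus C_valued_sign[OF c]) auto
  moreover have "LX Z Zs (\<lambda>ws. (-1) ^ length ws * W ws) = (-1) ^ length Zs * LX Z Zs W"
    using Cons.prems by (intro LX_sign) auto
  ultimately show ?case using Cons.IH[OF _ c] Cons.prems by (simp add: right_diff_distrib)
qed simp

end

lemma (in vector_bundle) smooth_forms_subset:
  assumes "\<omega> \<in> smooth_forms A E U" "U' \<subseteq> U"
  shows "\<omega> \<in> smooth_forms A E U'"
proof -
  have "smooth_fun_on A (U' \<inter> V) (\<lambda>x. \<omega> x (at_pt s x))" if "(V, e) \<in> frames E" "set s \<subseteq> set e" for V e s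
    using assms(2) by (intro smooth_fun_subset[OF smooth_formsD(2)[OF assms(1) that]]) auto
  moreover have "\<omega> x \<in> alt_forms (fibre E x)" if "x \<in> U'" for x
    using smooth_formsD(1)[OF assms(1), of x] assms(2) that by auto
  ultimately show ?thesis unfolding smooth_forms_def by auto
qed

lemma (in vector_bundle) bump_form:
  assumes "bump U x \<theta>" "open U" "\<omega> \<in> smooth_forms A E U"
  shows "(\<lambda>y. if y \<in> U then \<theta> y *\<^sub>R \<omega> y else 0) \<in> smooth_forms A E UNIV"
proof (rule smooth_formsI_global)
  fix y show "(if y \<in> U then \<theta> y *\<^sub>R \<omega> y else 0) \<in> alt_forms (fibre E y)"
    using smooth_formsD(1)[OF assms(3), of y] by (simp add: alt_forms_lin)
next
  fix Xs assume "set Xs \<subseteq> Sec A E"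
  then have "smooth_fun_on A U (\<lambda>y. \<omega> y (at_pt Xs y))"
    by (intro smooth_form_sections[OF assms(2,3)]) (auto intro: smooth_section_subset)
  from bump_mult_smooth[OF assms(1,2) this]
  show "(\<lambda>y. (if y \<in> U then \<theta> y *\<^sub>R \<omega> y else 0) (at_pt Xs y)) \<in> Cinf A"
    by (simp add: if_distrib[of "\<lambda>f. f _"] cong: if_cong)
qed

context lie_algebroid
begin

section \<open>Linearity, parity and degree of the differential\<close>

abbreviation SF :: "('m \<Rightarrow> 'v list \<Rightarrow> real) set" where
  "SF \<equiv> smooth_forms A E UNIV"

lemma SF_alt: "\<omega> \<in> SF \<Longrightarrow> \<omega> x \<in> alt_forms (fibre E x)"
  using smooth_formsD(1) by blast

lemma SF_smooth: "\<omega> \<in> SF \<Longrightarrow> set Xs \<subseteq> Sec A E \<Longrightarrow> smooth_fun_on A UNIV (\<lambda>x. \<omega> x (at_pt Xs x))"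
  using hat_Cinf[of \<omega> Xs] by (simp add: hat_def)

lemma SF_add: "\<omega> \<in> SF \<Longrightarrow> \<eta> \<in> SF \<Longrightarrow> \<omega> + \<eta> \<in> SF"
  by (rule smooth_formsI_global)
    (simp_all add: SF_alt alt_forms_lin smooth_fun_add SF_smooth)

lemma SF_scale: "\<omega> \<in> SF \<Longrightarrow> f \<in> Cinf A \<Longrightarrow> (\<lambda>x. f x *\<^sub>R \<omega> x) \<in> SF"
  by (rule smooth_formsI_global)
    (simp_all add: SF_alt alt_forms_lin smooth_fun_mult SF_smooth)

lemma SF_const_scale: "\<omega> \<in> SF \<Longrightarrow> c *\<^sub>R \<omega> \<in> SF"
  using SF_scale[of \<omega> "\<lambda>_. c"] by (simp add: smooth_fun_const scaleR_fun_def)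

lemma SF_parity: "\<omega> \<in> SF \<Longrightarrow> parity \<omega> \<in> SF"
  by (rule smooth_formsI_global)
    (simp_all add: parity_eq SF_alt par_alt_forms par_apply smooth_fun_mult smooth_fun_const SF_smooth)

lemma SF_contraction: "a \<in> multivectors A E \<Longrightarrow> \<omega> \<in> SF \<Longrightarrow> contraction_sec E a \<omega> \<in> SF"
  unfolding contraction_sec_def by (rule contraction_smooth[OF open_UNIV])

lemma differential_at:
  assumes "\<omega> \<in> SF" "\<eta> x \<in> alt_forms (fibre E x)"
    "\<And>Xs. set Xs \<subseteq> Sec A E \<Longrightarrow> dd Xs (hat \<omega>) x = hat \<eta> Xs x"
  shows "differential A E \<omega> x = \<eta> x"
  by (rule form_at_eqI) (use assms SF_alt[OF differential_smooth[OF assms(1)]] hat_differential[OF assms(1)] in simp_all)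

lemma hat_C_valued: "\<omega> \<in> SF \<Longrightarrow> C_valued (hat \<omega>)"
  by (rule alt_map_C_valued[OF hat_alt_map])

lemma differential_add:
  assumes "\<omega> \<in> SF" "\<eta> \<in> SF"
  shows "differential A E (\<omega> + \<eta>) x = differential A E \<omega> x + differential A E \<eta> x"
proof -
  have "differential A E (\<omega> + \<eta>) x = (differential A E \<omega> + differential A E \<eta>) x"
  proof (rule differential_at[OF SF_add[OF assms]])
    show "(differential A E \<omega> + differential A E \<eta>) x \<in> alt_forms (fibre E x)"
      using SF_alt[OF differential_smooth[OF assms(1)]] SF_alt[OF differential_smooth[OF assms(2)]]
      by (simp add: alt_forms_lin)
    fix Xs assume Xs: "set Xs \<subseteq> Sec A E"
    have "hat (\<omega> + \<eta>) = (\<lambda>ws. hat \<omega> ws + hat \<eta> ws)" by (simp add: hat_def fun_eq_iff)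
    then have "dd Xs (hat (\<omega> + \<eta>)) = dd Xs (hat \<omega>) + dd Xs (hat \<eta>)"
      using dd_add[OF Xs hat_C_valued[OF assms(1)] hat_C_valued[OF assms(2)]] by simp
    also have "\<dots> = hat (differential A E \<omega>) Xs + hat (differential A E \<eta>) Xs"
      by (simp only: hat_differential[OF assms(1) Xs] hat_differential[OF assms(2) Xs])
    finally show "dd Xs (hat (\<omega> + \<eta>)) x = hat (differential A E \<omega> + differential A E \<eta>) Xs x"
      by (simp add: hat_def)
  qed
  then show ?thesis by simp
qed

lemma differential_const_scale:
  assumes "\<omega> \<in> SF"
  shows "differential A E (c *\<^sub>R \<omega>) x = c *\<^sub>R differential A E \<omega> x"
proof -
  have c: "(\<lambda>_. c) \<in> Cinf A" by (simp add: smooth_fun_const)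
  \<comment> \<open>A derivation kills constants, because D 1 = D (1 * 1) = 2 D 1.\<close>
  have r: "anchor_deriv E X (\<lambda>_. c) = 0" if "X \<in> Sec A E" for X
  proof
    fix x
    have one: "(\<lambda>_. 1) \<in> smooth_near A x" by (rule Cinf_smooth_near) (simp add: smooth_fun_const)
    note D = anchor_tangent[OF Sec_fibre[OF that], of x]
    have "anchor E x (X x) (\<lambda>_. 1) = 0" using tangent_spaceD(5)[OF D one one] by simp
    then show "anchor_deriv E X (\<lambda>_. c) x = 0 x"
      using tangent_spaceD(4)[OF D one, of c] by (simp add: anchor_deriv_def)
  qed
  have L: "dd Xs (\<lambda>ws. (\<lambda>_. c) * W ws) = (\<lambda>_. c) * dd Xs W" if "set Xs \<subseteq> Sec A E" "C_valued W" for Xs W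
    using that
  proof (induction Xs arbitrary: W)
    case (Cons X Xs)
    have a: "dd Xs (\<lambda>ws. (\<lambda>_. c) * W (X # ws)) = (\<lambda>_. c) * dd Xs (\<lambda>ws. W (X # ws))"
      using Cons.prems by (intro Cons.IH C_valued_ins) auto
    have b: "LX X Xs (\<lambda>ws. (\<lambda>_. c) * W ws) = (\<lambda>_. c) * LX X Xs W + anchor_deriv E X (\<lambda>_. c) * W Xs"
      by (rule LX_mult) (use Cons.prems c in auto)
    have z: "anchor_deriv E X (\<lambda>_. c) = 0" using r Cons.prems by auto
    have "dd (X # Xs) (\<lambda>ws. (\<lambda>_. c) * W ws) = (\<lambda>_. c) * dd (X # Xs) W"
      unfolding dd.simps a b z by (simp only: mult_zero_left add_0_right right_diff_distrib)
    then show ?case .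
  qed simp
  have "differential A E (c *\<^sub>R \<omega>) x = (c *\<^sub>R differential A E \<omega>) x"
  proof (rule differential_at[OF SF_const_scale[OF assms]])
    show "(c *\<^sub>R differential A E \<omega>) x \<in> alt_forms (fibre E x)"
      using SF_alt[OF differential_smooth[OF assms]] by (simp add: alt_forms_lin)
    fix Xs assume Xs: "set Xs \<subseteq> Sec A E"
    have "hat (c *\<^sub>R \<omega>) = (\<lambda>ws. (\<lambda>_. c) * hat \<omega> ws)" by (simp add: hat_def fun_eq_iff)
    then have "dd Xs (hat (c *\<^sub>R \<omega>)) x = c * dd Xs (hat \<omega>) x"
      using L[OF Xs hat_C_valued[OF assms]] by simp
    then show "dd Xs (hat (c *\<^sub>R \<omega>)) x = hat (c *\<^sub>R differential A E \<omega>) Xs x"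
      using fun_cong[OF hat_differential[OF assms Xs], of x] by (simp add: hat_def)
  qed
  then show ?thesis by simp
qed

lemma differential_parity:
  assumes "\<omega> \<in> SF"
  shows "differential A E (parity \<omega>) x = - par (differential A E \<omega> x)"
proof -
  have "differential A E (parity \<omega>) x = (- parity (differential A E \<omega>)) x"
  proof (rule differential_at[OF SF_parity[OF assms]])
    have "(-1) *\<^sub>R par (differential A E \<omega> x) \<in> alt_forms (fibre E x)"
      using SF_alt[OF differential_smooth[OF assms]] by (intro alt_forms_lin par_alt_forms)
    then show "(- parity (differential A E \<omega>)) x \<in> alt_forms (fibre E x)" by (simp add: parity_eq)
    fix Xs assume Xs: "set Xs \<subseteq> Sec A E"
    have "hat (parity \<omega>) = (\<lambda>ws. (-1) ^ length ws * hat \<omega> ws)"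
      by (simp add: hat_def fun_eq_iff parity_def minus_one_power_apply)
    then have "dd Xs (hat (parity \<omega>)) = - ((-1) ^ length Xs * dd Xs (hat \<omega>))"
      using dd_sign[OF Xs hat_C_valued[OF assms]] by simp
    then show "dd Xs (hat (parity \<omega>)) x = hat (- parity (differential A E \<omega>)) Xs x"
      using fun_cong[OF hat_differential[OF assms Xs], of x]
      by (simp add: hat_def parity_def minus_one_power_apply)
  qed
  then show ?thesis by (simp add: parity_eq)
qed

lemma differential_differential:
  assumes "\<omega> \<in> SF"
  shows "differential A E (differential A E \<omega>) x = 0"
proof -
  have "differential A E (differential A E \<omega>) x = (0 :: 'm \<Rightarrow> 'v list \<Rightarrow> real) x"
  proof (rule differential_at[OF differential_smooth[OF assms]])
    show "(0 :: 'm \<Rightarrow> 'v list \<Rightarrow> real) x \<in> alt_forms (fibre E x)" by (simp add: alt_forms_lin)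
    fix Xs assume Xs: "set Xs \<subseteq> Sec A E"
    have "dd Xs (hat (differential A E \<omega>)) = dd Xs (\<lambda>ws. dd ws (hat \<omega>))"
      by (rule dd_cong[OF Xs hat_differential[OF assms]])
    also have "\<dots> = 0" by (rule dd_dd[OF Xs hat_alt_map[OF assms]])
    finally show "dd Xs (hat (differential A E \<omega>)) x = hat 0 Xs x" by (simp add: hat_def)
  qed
  then show ?thesis by simp
qed

lemma differential_length:
  assumes "\<omega> \<in> SF" "\<And>y vs. int (length vs) \<noteq> k \<Longrightarrow> \<omega> y vs = 0" "int (length vs) \<noteq> k + 1"
  shows "differential A E \<omega> x vs = 0"
proof (cases "set vs \<subseteq> fibre E x")
  case True
  obtain Xs where Xs: "set Xs \<subseteq> Sec A E" "at_pt Xs x = vs" by (rule sections_through[OF True])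
  have len: "length vs = length Xs" using Xs(2) by auto
  have "dd Xs (hat \<omega>) = 0"
  proof (rule dd_length_0[OF Xs(1)])
    fix ws :: "('m \<Rightarrow> 'v) list" assume "Suc (length ws) = length Xs"
    then have "int (length ws) \<noteq> k" using assms(3) len by auto
    then show "hat \<omega> ws = 0" using assms(2) by (simp add: hat_def fun_eq_iff)
  qed
  then have "hat (differential A E \<omega>) Xs x = 0" by (simp add: hat_differential[OF assms(1) Xs(1)])
  then show ?thesis using Xs(2) by (simp add: hat_def)
next
  case False
  then show ?thesis by (simp add: differential_def)
qed

section \<open>Lie derivatives of forms\<close>

definition ins_form :: "('m \<Rightarrow> 'v) \<Rightarrow> ('m \<Rightarrow> 'v list \<Rightarrow> real) \<Rightarrow> 'm \<Rightarrow> 'v list \<Rightarrow> real" where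
  "ins_form X \<omega> = (\<lambda>x. hook (X x) (\<omega> x))"

lemma hat_ins_form: "hat (ins_form X \<omega>) = (\<lambda>ws. hat \<omega> (X # ws))"
  by (simp add: hat_def ins_form_def hook_apply fun_eq_iff)

lemma SF_ins: "X \<in> Sec A E \<Longrightarrow> \<omega> \<in> SF \<Longrightarrow> ins_form X \<omega> \<in> SF"
proof (rule smooth_formsI_global)
  fix x assume "X \<in> Sec A E" "\<omega> \<in> SF"
  then show "ins_form X \<omega> x \<in> alt_forms (fibre E x)"
    by (simp only: ins_form_def hook_alt_forms SF_alt Sec_fibre)
next
  fix Xs assume "X \<in> Sec A E" "\<omega> \<in> SF" "set Xs \<subseteq> Sec A E"
  then have "hat \<omega> (X # Xs) \<in> Cinf A" by (intro hat_Cinf) auto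
  then show "(\<lambda>x. ins_form X \<omega> x (at_pt Xs x)) \<in> Cinf A"
    by (simp add: hat_def ins_form_def hook_apply)
qed

definition lie_form :: "('m \<Rightarrow> 'v) \<Rightarrow> ('m \<Rightarrow> 'v list \<Rightarrow> real) \<Rightarrow> 'm \<Rightarrow> 'v list \<Rightarrow> real" where
  "lie_form X \<omega> = unhat (\<lambda>Xs. LX X Xs (hat \<omega>))"

lemma SF_lie: "X \<in> Sec A E \<Longrightarrow> \<omega> \<in> SF \<Longrightarrow> lie_form X \<omega> \<in> SF"
  unfolding lie_form_def by (intro unhat_smooth LX_alt_map hat_alt_map)

lemma hat_lie_form:
  "X \<in> Sec A E \<Longrightarrow> \<omega> \<in> SF \<Longrightarrow> set Xs \<subseteq> Sec A E \<Longrightarrow> hat (lie_form X \<omega>) Xs = LX X Xs (hat \<omega>)"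
  unfolding lie_form_def by (intro hat_unhat LX_alt_map hat_alt_map)

lemma lie_form_at:
  assumes "X \<in> Sec A E" "\<omega> \<in> SF" "\<eta> x \<in> alt_forms (fibre E x)"
    "\<And>Xs. set Xs \<subseteq> Sec A E \<Longrightarrow> LX X Xs (hat \<omega>) x = hat \<eta> Xs x"
  shows "lie_form X \<omega> x = \<eta> x"
  by (rule form_at_eqI) (use assms SF_alt[OF SF_lie[OF assms(1,2)]] hat_lie_form[OF assms(1,2)] in simp_all)

text \<open>This is the second recursion equation of \<open>dd\<close>, read as L_X = i_X d + d
  i_X.\<close>

lemma cartan:
  assumes "X \<in> Sec A E" "\<omega> \<in> SF"
  shows "lie_form X \<omega> x = hook (X x) (differential A E \<omega> x) + differential A E (ins_form X \<omega>) x"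
proof -
  note S = differential_smooth[OF assms(2)] differential_smooth[OF SF_ins[OF assms]]
  have "lie_form X \<omega> x = (ins_form X (differential A E \<omega>) + differential A E (ins_form X \<omega>)) x"
  proof (rule lie_form_at[OF assms])
    show "(ins_form X (differential A E \<omega>) + differential A E (ins_form X \<omega>)) x \<in> alt_forms (fibre E x)"
      by (rule SF_alt[OF SF_add[OF SF_ins[OF assms(1) S(1)] S(2)]])
    fix Xs assume Xs: "set Xs \<subseteq> Sec A E"
    have "hat (differential A E \<omega>) (X # Xs) = LX X Xs (hat \<omega>) - dd Xs (\<lambda>ws. hat \<omega> (X # ws))"
      using hat_differential[OF assms(2), of "X # Xs"] Xs assms(1) by simp
    moreover have "hat (differential A E (ins_form X \<omega>)) Xs = dd Xs (\<lambda>ws. hat \<omega> (X # ws))"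
      using hat_differential[OF SF_ins[OF assms] Xs] by (simp add: hat_ins_form)
    ultimately have "LX X Xs (hat \<omega>) = hat (ins_form X (differential A E \<omega>)) Xs + hat (differential A E (ins_form X \<omega>)) Xs"
      by (simp add: hat_ins_form)
    then show "LX X Xs (hat \<omega>) x = hat (ins_form X (differential A E \<omega>) + differential A E (ins_form X \<omega>)) Xs x"
      by (simp add: hat_def)
  qed
  then show ?thesis by (simp add: ins_form_def)
qed

text \<open>Locality is inherited from the differential through Cartan's formula.\<close>

lemma lie_form_local:
  assumes "X \<in> Sec A E" "\<omega> \<in> SF" "\<eta> \<in> SF" "\<forall>\<^sub>F y in nhds x. \<omega> y = \<eta> y"
  shows "lie_form X \<omega> x = lie_form X \<eta> x"
proof -
  have "\<forall>\<^sub>F y in nhds x. ins_form X \<omega> y = ins_form X \<eta> y"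
    using assms(4) by (rule eventually_mono) (simp add: ins_form_def)
  then show ?thesis
    unfolding cartan[OF assms(1,2)] cartan[OF assms(1,3)]
    using differential_local[OF assms(4)] differential_local[of "ins_form X \<omega>" "ins_form X \<eta>" x] by simp
qed

lemma ins_form_add: "ins_form X (\<omega> + \<eta>) = ins_form X \<omega> + ins_form X \<eta>"
  by (simp add: ins_form_def fun_eq_iff hook_apply)

lemma lie_form_add:
  assumes "X \<in> Sec A E" "\<omega> \<in> SF" "\<eta> \<in> SF"
  shows "lie_form X (\<omega> + \<eta>) x = lie_form X \<omega> x + lie_form X \<eta> x"
  using differential_add[OF assms(2,3)] differential_add[OF SF_ins[OF assms(1,2)] SF_ins[OF assms(1,3)]]
  unfolding cartan[OF assms(1) SF_add[OF assms(2,3)]] cartan[OF assms(1,2)] cartan[OF assms(1,3)] ins_form_add by simp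

lemma lie_form_0: "X \<in> Sec A E \<Longrightarrow> lie_form X 0 x = 0"
proof -
  assume X: "X \<in> Sec A E"
  have 0: "(0 :: 'm \<Rightarrow> 'v list \<Rightarrow> real) \<in> SF"
    by (rule smooth_formsI_global) (simp_all add: alt_forms_lin smooth_fun_const)
  show ?thesis using lie_form_add[OF X 0 0, of x] by simp
qed

lemma lie_form_scale:
  assumes "X \<in> Sec A E" "\<omega> \<in> SF" "f \<in> Cinf A"
  shows "lie_form X (\<lambda>x. f x *\<^sub>R \<omega> x) x = f x *\<^sub>R lie_form X \<omega> x + anchor_deriv E X f x *\<^sub>R \<omega> x"
proof -
  have "lie_form X (\<lambda>x. f x *\<^sub>R \<omega> x) x = ((\<lambda>x. f x *\<^sub>R lie_form X \<omega> x) + (\<lambda>x. anchor_deriv E X f x *\<^sub>R \<omega> x)) x"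
  proof (rule lie_form_at[OF assms(1) SF_scale[OF assms(2,3)]])
    show "((\<lambda>x. f x *\<^sub>R lie_form X \<omega> x) + (\<lambda>x. anchor_deriv E X f x *\<^sub>R \<omega> x)) x \<in> alt_forms (fibre E x)"
      using SF_alt[OF SF_lie[OF assms(1,2)]] SF_alt[OF assms(2)] by (simp add: alt_forms_lin)
    fix Xs assume Xs: "set Xs \<subseteq> Sec A E"
    have "hat (\<lambda>x. f x *\<^sub>R \<omega> x) = (\<lambda>ws. f * hat \<omega> ws)" by (simp add: hat_def fun_eq_iff)
    then have "LX X Xs (hat (\<lambda>x. f x *\<^sub>R \<omega> x)) = f * LX X Xs (hat \<omega>) + anchor_deriv E X f * hat \<omega> Xs"
      using LX_mult[OF assms(1) Xs hat_C_valued[OF assms(2)] assms(3)] by simp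
    then show "LX X Xs (hat (\<lambda>x. f x *\<^sub>R \<omega> x)) x = hat ((\<lambda>x. f x *\<^sub>R lie_form X \<omega> x) + (\<lambda>x. anchor_deriv E X f x *\<^sub>R \<omega> x)) Xs x"
      using fun_cong[OF hat_lie_form[OF assms(1,2) Xs], of x] by (simp add: hat_def)
  qed
  then show ?thesis by simp
qed

text \<open>The second recursion equation of \<open>LX\<close>, transported to forms.\<close>

lemma lie_form_ins:
  assumes "X \<in> Sec A E" "Y \<in> Sec A E" "\<omega> \<in> SF"
  shows "lie_form X (ins_form Y \<omega>) x = hook (Y x) (lie_form X \<omega> x) + hook (lie E X Y x) (\<omega> x)"
proof -
  have XY: "lie E X Y \<in> Sec A E" by (rule lie_closed[OF assms(1,2)])
  have "lie_form X (ins_form Y \<omega>) x = (ins_form Y (lie_form X \<omega>) + ins_form (lie E X Y) \<omega>) x"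
  proof (rule lie_form_at[OF assms(1) SF_ins[OF assms(2,3)]])
    show "(ins_form Y (lie_form X \<omega>) + ins_form (lie E X Y) \<omega>) x \<in> alt_forms (fibre E x)"
      by (rule SF_alt[OF SF_add[OF SF_ins[OF assms(2) SF_lie[OF assms(1,3)]] SF_ins[OF XY assms(3)]]])
    fix Xs assume Xs: "set Xs \<subseteq> Sec A E"
    have "hat (lie_form X \<omega>) (Y # Xs) = LX X (Y # Xs) (hat \<omega>)"
      using Xs assms(2) by (intro hat_lie_form[OF assms(1,3)]) auto
    then have "LX X Xs (hat (ins_form Y \<omega>)) = hat (ins_form Y (lie_form X \<omega>)) Xs + hat (ins_form (lie E X Y) \<omega>) Xs"
      by (simp add: hat_ins_form)
    then show "LX X Xs (hat (ins_form Y \<omega>)) x = hat (ins_form Y (lie_form X \<omega>) + ins_form (lie E X Y) \<omega>) Xs x"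
      by (simp add: hat_def)
  qed
  then show ?thesis by (simp add: ins_form_def)
qed

lemma contraction_sec_wedge:
  assumes "X \<in> Sec A E" "\<omega> \<in> SF"
  shows "contraction_sec E (of_sec E X \<and>\<^sub>\<A> c) \<omega> = contraction_sec E c (ins_form X \<omega>)"
proof
  fix x
  obtain bs where bs: "basis_list (fibre E x) bs" by (rule fibre_basis)
  show "contraction_sec E (of_sec E X \<and>\<^sub>\<A> c) \<omega> x = contraction_sec E c (ins_form X \<omega>) x"
    using contraction_wedge_ev[OF bs SF_alt[OF assms(2)] Sec_fibre[OF assms(1)]]
    by (simp add: contraction_sec_def wedge_sec_eq of_sec_eq ins_form_def)
qed

lemma ins_form_contraction:
  assumes "X \<in> Sec A E" "\<omega> \<in> SF"
  shows "ins_form X (contraction_sec E c \<omega>) = contraction_sec E (parity c) (ins_form X \<omega>)"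
proof
  fix x
  obtain bs where bs: "basis_list (fibre E x) bs" by (rule fibre_basis)
  show "ins_form X (contraction_sec E c \<omega>) x = contraction_sec E (parity c) (ins_form X \<omega>) x"
    using hook_contraction[OF bs SF_alt[OF assms(2)] Sec_fibre[OF assms(1)]]
    by (simp add: contraction_sec_def parity_eq ins_form_def)
qed

end

locale schouten_algebroid = lie_algebroid A E
  for A :: "('m::{t2_space, second_countable_topology}, 'b::real_inner) atlas"
    and E :: "('m, 'v::real_vector) algebroid" +
  fixes br :: "('m \<Rightarrow> ('v \<Rightarrow> real) list \<Rightarrow> real) \<Rightarrow> ('m \<Rightarrow> ('v \<Rightarrow> real) list \<Rightarrow> real)
      \<Rightarrow> 'm \<Rightarrow> ('v \<Rightarrow> real) list \<Rightarrow> real"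
  assumes schouten: "schouten_bracket A E br"
begin

section \<open>Locality of the Schouten bracket and its action on contractions\<close>

lemmas br_conj = schouten[unfolded schouten_bracket_def]

lemma br_add_right: "a \<in> multivectors A E \<Longrightarrow> b \<in> multivectors A E \<Longrightarrow> c \<in> multivectors A E \<Longrightarrow> br a (b + c) = br a b + br a c"
  using br_conj[THEN conjunct1] by blast

lemma br_scale_right: "a \<in> multivectors A E \<Longrightarrow> b \<in> multivectors A E \<Longrightarrow> br a (t *\<^sub>R b) = t *\<^sub>R br a b"
  using br_conj[THEN conjunct2, THEN conjunct1] by blast

lemma br_deg: "a \<in> multivectors_deg A E p \<Longrightarrow> b \<in> multivectors_deg A E q \<Longrightarrow> br a b \<in> multivectors_deg A E (p + q - 1)"
  using br_conj[THEN conjunct2, THEN conjunct2, THEN conjunct1] by blast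

lemma br_sec_sec: "X \<in> Sec A E \<Longrightarrow> Y \<in> Sec A E \<Longrightarrow> br (of_sec E X) (of_sec E Y) = of_sec E (lie E X Y)"
  using br_conj[THEN conjunct2, THEN conjunct2, THEN conjunct2, THEN conjunct1] by blast

lemma br_sec_fun: "X \<in> Sec A E \<Longrightarrow> f \<in> Cinf A \<Longrightarrow> br (of_sec E X) (of_fun f) = of_fun (anchor_deriv E X f)"
  using br_conj[THEN conjunct2, THEN conjunct2, THEN conjunct2, THEN conjunct2, THEN conjunct1] by blast

lemma br_skew: "a \<in> multivectors_deg A E p \<Longrightarrow> b \<in> multivectors_deg A E q \<Longrightarrow> br a b = - ((-1) powi ((p - 1) * (q - 1)) *\<^sub>R br b a)"
  using br_conj[THEN conjunct2, THEN conjunct2, THEN conjunct2, THEN conjunct2, THEN conjunct2, THEN conjunct1] by blast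

lemma br_leibniz: "a \<in> multivectors_deg A E p \<Longrightarrow> b \<in> multivectors_deg A E q \<Longrightarrow> c \<in> multivectors_deg A E s \<Longrightarrow>
    br a (b \<and>\<^sub>\<A> c) = br a b \<and>\<^sub>\<A> c + (-1) powi ((p - 1) * q) *\<^sub>R (b \<and>\<^sub>\<A> br a c)"
  using br_conj[THEN conjunct2, THEN conjunct2, THEN conjunct2, THEN conjunct2, THEN conjunct2, THEN conjunct2, THEN conjunct2] by blast

lemma br_0_right: "a \<in> multivectors A E \<Longrightarrow> br a 0 = 0"
  using br_scale_right[of a 0 0] multivectors_0 by simp

text \<open>The difference d of the two arguments vanishes near x, so d = f d for a smooth f with
  f(x) = 0. The Leibniz rule writes [a, d] as [a, f] \<and> d + f [a, d], and both terms vanish at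
  x.\<close>

lemma br_local:
  assumes a: "a \<in> multivectors_deg A E p" and b: "b \<in> multivectors_deg A E q" "b' \<in> multivectors_deg A E q"
    and eq: "\<forall>\<^sub>F y in nhds x. b y = b' y"
  shows "br a b x = br a b' x"
proof -
  define d where "d = b + (-1) *\<^sub>R b'"
  have d: "d \<in> multivectors_deg A E q" unfolding d_def by (intro multivectors_deg_add multivectors_deg_scale b)
  obtain N where N: "open N" "x \<in> N" "\<forall>y\<in>N. b y = b' y" using eq by (auto simp: eventually_nhds)
  have d0: "d y = 0" if "y \<in> N" for y using N(3) that by (simp add: d_def)
  obtain \<theta> where \<theta>: "bump N x \<theta>" using bump_exists[OF N(1,2)] by blast
  then have \<theta>1: "\<theta> x = 1" "\<theta> \<in> Cinf A" and \<theta>0: "\<And>y. y \<notin> N \<Longrightarrow> \<theta> y = 0" by (auto simp: bump_def)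
  define f where "f = 1 - \<theta>"
  have f: "f \<in> Cinf A" unfolding f_def by (intro Cinf_ring \<theta>1)
  have "(of_fun f \<and>\<^sub>\<A> d) y = d y" for y
    using d0[of y] \<theta>0[of y] by (cases "y \<in> N") (simp_all add: wedge_sec_eq of_fun_eq f_def)
  then have fd: "of_fun f \<and>\<^sub>\<A> d = d" by (intro ext) simp
  have "br a d = br a (of_fun f) \<and>\<^sub>\<A> d + (-1) powi ((p - 1) * 0) *\<^sub>R (of_fun f \<and>\<^sub>\<A> br a d)"
    using br_leibniz[OF a of_fun_deg[OF f] d] unfolding fd .
  then have "br a d x = wedge (br a (of_fun f) x) (d x) + wedge (scalar_form (f x)) (br a d x)"
    by (metis (no_types, lifting) mult_zero_right of_fun_eq plus_fun_apply power_int_0_right scaleR_one wedge_sec_eq)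
  then have 0: "br a d x = 0" using d0[OF N(2)] \<theta>1 by (simp add: f_def)
  have "b = d + b'" by (simp add: d_def)
  then have "br a b = br a d + br a b'"
    using br_add_right[OF multivectors_deg_subset[OF a] multivectors_deg_subset[OF d] multivectors_deg_subset[OF b(2)]] by simp
  then show ?thesis using 0 by simp
qed

text \<open>Both sides are local and additive in c. For a function it is the Leibniz rule of L_X;
  for a product with a section Y it follows from i(Y \<and> c) = i_c i_Y and from L_X i_Y = i_Y L_X
  + i_[X,Y].\<close>

lemma lie_form_contraction:
  assumes X: "X \<in> Sec A E" and c: "c \<in> multivectors_deg A E q" and \<omega>: "\<omega> \<in> SF"
  shows "lie_form X (contraction_sec E c \<omega>) x =
    contraction_sec E c (lie_form X \<omega>) x + contraction_sec E (br (of_sec E X) c) \<omega> x"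
proof -
  note sX = of_sec_multivectors[OF X] of_sec_deg[OF X]
  \<comment> \<open>The form is quantified because the step for Y \<and> c uses the hypothesis at
    \<open>ins_form Y \<omega>\<close>.\<close>
  have "\<forall>\<omega>\<in>SF. lie_form X (contraction_sec E c \<omega>) x =
    contraction_sec E c (lie_form X \<omega>) x + contraction_sec E (br (of_sec E X) c) \<omega> x"
    using c
  proof (induction rule: multivector_induct_near[where x = x])
    case (local q c c')
    have m: "c \<in> multivectors A E" "c' \<in> multivectors A E" using local(1,2) multivectors_deg_subset by auto
    have x: "c x = c' x" using local(3) by (rule eventually_nhds_x_imp_x)
    have b: "br (of_sec E X) c x = br (of_sec E X) c' x" by (rule br_local[OF sX(2) local(1-3)])
    show ?case
    proof
      fix \<omega> assume \<omega>: "\<omega> \<in> SF"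
      have "\<forall>\<^sub>F y in nhds x. contraction_sec E c \<omega> y = contraction_sec E c' \<omega> y"
        using local(3) by (rule eventually_mono) (simp add: contraction_sec_def)
      then have "lie_form X (contraction_sec E c \<omega>) x = lie_form X (contraction_sec E c' \<omega>) x"
        by (rule lie_form_local[OF X SF_contraction[OF m(1) \<omega>] SF_contraction[OF m(2) \<omega>]])
      then show "lie_form X (contraction_sec E c \<omega>) x =
        contraction_sec E c (lie_form X \<omega>) x + contraction_sec E (br (of_sec E X) c) \<omega> x"
        using bspec[OF local(4) \<omega>] by (simp add: contraction_sec_def x b del: fun_app)
    qed
  next
    case (zero q)
    have e: "contraction_sec E 0 \<omega> = 0" for \<omega> by (simp add: contraction_sec_def contraction_linear fun_eq_iff)
    have "lie_form X (contraction_sec E 0 \<omega>) x =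
      contraction_sec E 0 (lie_form X \<omega>) x + contraction_sec E (br (of_sec E X) 0) \<omega> x" for \<omega>
      by (simp add: e lie_form_0[OF X] br_0_right[OF sX(1)])
    then show ?case by blast
  next
    case (add q c c')
    have m: "c \<in> multivectors A E" "c' \<in> multivectors A E" using add(1,2) multivectors_deg_subset by auto
    have e: "contraction_sec E (a + a') \<omega> = contraction_sec E a \<omega> + contraction_sec E a' \<omega>" for a a' \<omega>
      by (simp add: contraction_sec_def contraction_linear fun_eq_iff)
    show ?case
    proof
      fix \<omega> assume \<omega>: "\<omega> \<in> SF"
      have 1: "lie_form X (contraction_sec E c \<omega>) x =
          contraction_sec E c (lie_form X \<omega>) x + contraction_sec E (br (of_sec E X) c) \<omega> x"
        using add(3) \<omega> by blast
      have 2: "lie_form X (contraction_sec E c' \<omega>) x =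
          contraction_sec E c' (lie_form X \<omega>) x + contraction_sec E (br (of_sec E X) c') \<omega> x"
        using add(4) \<omega> by blast
      show "lie_form X (contraction_sec E (c + c') \<omega>) x =
          contraction_sec E (c + c') (lie_form X \<omega>) x + contraction_sec E (br (of_sec E X) (c + c')) \<omega> x"
        unfolding e br_add_right[OF sX(1) m] lie_form_add[OF X SF_contraction[OF m(1) \<omega>] SF_contraction[OF m(2) \<omega>]] 1 2
        by (simp add: algebra_simps)
    qed
  next
    case (func f)
    have e: "contraction_sec E (of_fun f) \<omega> = (\<lambda>x. f x *\<^sub>R \<omega> x)" for f \<omega>
      by (simp add: contraction_sec_def of_fun_eq contraction_scalar_form)
    show ?case by (simp add: e br_sec_fun[OF X func] lie_form_scale[OF X _ func] del: mem_Collect_eq fun_app)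
  next
    case (sec q Y c)
    have Y: "Y \<in> Sec A E" and XY: "lie E X Y \<in> Sec A E" using sec(1) lie_closed[OF X] by auto
    have br: "br (of_sec E X) (of_sec E Y \<and>\<^sub>\<A> c) = (of_sec E (lie E X Y) \<and>\<^sub>\<A> c) + (of_sec E Y \<and>\<^sub>\<A> br (of_sec E X) c)"
      using br_leibniz[OF sX(2) of_sec_deg[OF Y] sec(2)] br_sec_sec[OF X Y] by simp
    have e: "contraction_sec E (a + a') \<omega> = contraction_sec E a \<omega> + contraction_sec E a' \<omega>" for a a' \<omega>
      by (simp add: contraction_sec_def contraction_linear fun_eq_iff)
    show ?case
    proof
      fix \<omega> assume \<omega>: "\<omega> \<in> SF"
      have "lie_form X (contraction_sec E (of_sec E Y \<and>\<^sub>\<A> c) \<omega>) x = lie_form X (contraction_sec E c (ins_form Y \<omega>)) x"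
        by (simp add: contraction_sec_wedge[OF Y \<omega>])
      also have "\<dots> = contraction_sec E c (lie_form X (ins_form Y \<omega>)) x + contraction_sec E (br (of_sec E X) c) (ins_form Y \<omega>) x"
        using sec(3) SF_ins[OF Y \<omega>] by blast
      also have "contraction_sec E c (lie_form X (ins_form Y \<omega>)) x =
         contraction_sec E c (ins_form Y (lie_form X \<omega>)) x + contraction_sec E c (ins_form (lie E X Y) \<omega>) x"
      proof -
        have "lie_form X (ins_form Y \<omega>) x = ins_form Y (lie_form X \<omega>) x + ins_form (lie E X Y) \<omega> x"
          unfolding lie_form_ins[OF X Y \<omega>] by (simp add: ins_form_def)
        then show ?thesis by (simp add: contraction_sec_def contraction_linear)
      qed
      finally have eq: "lie_form X (contraction_sec E (of_sec E Y \<and>\<^sub>\<A> c) \<omega>) x =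
          contraction_sec E c (ins_form Y (lie_form X \<omega>)) x + contraction_sec E c (ins_form (lie E X Y) \<omega>) x
          + contraction_sec E (br (of_sec E X) c) (ins_form Y \<omega>) x" .
      show "lie_form X (contraction_sec E (of_sec E Y \<and>\<^sub>\<A> c) \<omega>) x =
          contraction_sec E (of_sec E Y \<and>\<^sub>\<A> c) (lie_form X \<omega>) x
          + contraction_sec E (br (of_sec E X) (of_sec E Y \<and>\<^sub>\<A> c)) \<omega> x"
        using eq unfolding br e contraction_sec_wedge[OF Y \<omega>] contraction_sec_wedge[OF XY \<omega>]
            contraction_sec_wedge[OF Y SF_lie[OF X \<omega>]]
        by (simp only: plus_fun_apply[where x = x] add.assoc)
    qed
  qed
  with \<omega> show ?thesis by blast
qed

end


section \<open>Existence and uniqueness\<close>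

lemma top_form_uminus: "top_form F \<mu> \<Longrightarrow> top_form F (- \<mu>)"
  using alt_forms_lin(2)[of \<mu> F "-1"] by (simp add: top_form_def)

context lie_algebroid
begin

section \<open>Volume forms near a point, existence and uniqueness of the operator\<close>

definition rank :: nat where "rank = (THE r. \<forall>x. dim (fibre E x) = r)"

lemma dim_fibre: "dim (fibre E x) = rank"
proof -
  obtain r where r: "\<forall>(U, e)\<in>frames E. length e = r" using constant_rank by blast
  have d: "dim (fibre E y) = r" for y
  proof -
    obtain V e where V: "(V, e) \<in> frames E" "y \<in> V" by (rule obtain_frame)
    have "length e = r" using r V(1) by auto
    then show ?thesis using basis_list_length[OF frame_basis[OF V]] by simp
  qed
  then have "rank = r" unfolding rank_def by (intro the_equality) auto
  with d show ?thesis by simp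
qed

lemma local_rep_top: "local_rep A E \<nu> U \<mu> \<Longrightarrow> x \<in> U \<Longrightarrow> top_form (fibre E x) (\<mu> x)"
  using smooth_formsD(1)[of \<mu> U x] by (simp add: local_rep_def top_form_def)

text \<open>A global form standing in for a local representative. The degree condition holds
  everywhere and makes the form closed; nonvanishing is demanded on \<open>N\<close> only, since the
  cut-off may destroy it farther out.\<close>

definition volume_near :: "'m set \<Rightarrow> 'm \<Rightarrow> ('m \<Rightarrow> 'v list \<Rightarrow> real) \<Rightarrow> bool" where
  "volume_near N x \<mu> \<longleftrightarrow> open N \<and> x \<in> N \<and> \<mu> \<in> SF \<and> (\<forall>y\<in>N. top_form (fibre E y) (\<mu> y)) \<and>
     (\<forall>y vs. length vs \<noteq> rank \<longrightarrow> \<mu> y vs = 0)"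

lemma volume_near_uminus:
  assumes "volume_near N x \<mu>" shows "volume_near N x (- \<mu>)"
proof -
  have "- \<mu> \<in> SF" using SF_const_scale[of \<mu> "-1"] assms by (simp add: volume_near_def)
  then show ?thesis using assms by (simp add: volume_near_def top_form_uminus)
qed

lemma local_rep_volume:
  assumes "local_rep A E \<nu> U \<mu>" "x \<in> U"
  obtains N \<mu>' where "volume_near N x \<mu>'" "\<forall>y\<in>N. y \<in> U \<and> \<mu> y = \<mu>' y"
proof -
  have U: "open U" and \<mu>: "\<mu> \<in> smooth_forms A E U" using assms(1) by (auto simp: local_rep_def)
  obtain \<theta> where \<theta>: "bump U x \<theta>" using bump_exists[OF U assms(2)] by blast
  then obtain N where N: "open N" "x \<in> N" "N \<subseteq> U" "\<forall>y\<in>N. \<theta> y = 1" by (auto simp: bump_def)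
  define \<mu>' where "\<mu>' y = (if y \<in> U then \<theta> y *\<^sub>R \<mu> y else 0)" for y
  have SF: "\<mu>' \<in> SF" unfolding \<mu>'_def by (rule bump_form[OF \<theta> U \<mu>])
  have e: "\<forall>y\<in>N. y \<in> U \<and> \<mu> y = \<mu>' y" using N by (auto simp: \<mu>'_def)
  have "\<mu>' y vs = 0" if "length vs \<noteq> rank" for y vs
    using assms(1) that by (simp add: \<mu>'_def local_rep_def dim_fibre)
  then have "volume_near N x \<mu>'"
    using N SF e local_rep_top[OF assms(1)] unfolding volume_near_def by metis
  then show ?thesis using e that by blast
qed

text \<open>The differential has degree \<open>rank\<close> + 1, and no sublist of a basis has that
  many entries.\<close>

lemma volume_closed:
  assumes "volume_near N x \<mu>"
  shows "differential A E \<mu> y = 0"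
proof -
  have \<mu>: "\<mu> \<in> SF" using assms by (simp add: volume_near_def)
  obtain bs where bs: "basis_list (fibre E y) bs" by (rule fibre_basis)
  have "differential A E \<mu> y (nths bs J) = 0" if "J \<subseteq> {..<length bs}" for J
  proof (rule differential_length[OF \<mu>])
    show "\<mu> z vs = 0" if "int (length vs) \<noteq> int rank" for z vs
      using assms that by (simp add: volume_near_def)
    have "length bs = rank" using basis_list_length[OF bs] dim_fibre by simp
    moreover have "length (nths bs J) \<le> length bs" by (simp add: length_nths) (metis (no_types, lifting) card_mono card_lessThan finite_lessThan mem_Collect_eq lessThan_iff subsetI)
    ultimately show "int (length (nths bs J)) \<noteq> int rank + 1" by simp
  qed
  then show ?thesis
    by (intro form_eqI[OF bs SF_alt[OF differential_smooth[OF \<mu>]] alt_forms_lin(3)]) simp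
qed

text \<open>The term i_a d \<mu> drops out because \<mu> is closed. The other one sees only the germ
  of \<mu> and may be computed with its global replacement.\<close>

lemma lie_diff_volume:
  assumes "volume_near N x \<mu>'" "\<forall>y\<in>N. \<mu> y = \<mu>' y" "y \<in> N"
  shows "lie_diff A E a \<mu> y = - differential A E (contraction_sec E (parity a) \<mu>') y"
proof -
  have N: "open N" using assms(1) by (simp add: volume_near_def)
  have ev: "\<forall>\<^sub>F z in nhds y. \<mu> z = \<mu>' z"
    using N assms(2,3) by (auto simp: eventually_nhds)
  have "differential A E \<mu> y = 0" using differential_local[OF ev] volume_closed[OF assms(1)] by simp
  moreover have "differential A E (contraction_sec E (parity a) \<mu>) y = differential A E (contraction_sec E (parity a) \<mu>') y"
    by (rule differential_local) (use ev in \<open>auto simp: contraction_sec_def elim: eventually_mono\<close>)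
  ultimately show ?thesis
    by (simp add: lie_diff_def contraction_sec_def contraction_linear)
qed

text \<open>The ratio h of the two representatives is smooth, hence continuous, and takes only the
  values 1 and -1.\<close>

lemma local_rep_sign:
  assumes "local_rep A E \<nu> U1 \<mu>1" "local_rep A E \<nu> U2 \<mu>2" "x \<in> U1" "x \<in> U2"
  shows "\<exists>s\<in>{1, -1}. \<exists>N. open N \<and> x \<in> N \<and> (\<forall>y\<in>N. \<mu>2 y = s *\<^sub>R \<mu>1 y)"
proof -
  obtain V e where V: "(V, e) \<in> frames E" "x \<in> V" by (rule obtain_frame)
  define W where "W = U1 \<inter> U2 \<inter> V"
  have o: "open W" "x \<in> W" using assms frame_open[OF V(1)] V(2) by (auto simp: W_def local_rep_def)
  have m: "\<mu>1 \<in> smooth_forms A E U1" "\<mu>2 \<in> smooth_forms A E U2" using assms by (auto simp: local_rep_def)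
  define h where "h y = \<mu>2 y (at_pt e y) * inverse (\<mu>1 y (at_pt e y))" for y
  have nz: "\<mu>1 y (at_pt e y) \<noteq> 0" if "y \<in> W" for y
    using that top_form_basis_nonzero[OF frame_basis[OF V(1), of y] local_rep_top[OF assms(1), of y]] by (simp add: W_def)
  have pm: "\<mu>2 y = \<mu>1 y \<or> \<mu>2 y = - \<mu>1 y" if "y \<in> W" for y
  proof -
    have U: "y \<in> U1" "y \<in> U2" using that by (auto simp: W_def)
    have "\<nu> y = {\<mu>1 y, - \<mu>1 y}" using assms(1) U(1) by (simp add: local_rep_def)
    moreover have "\<nu> y = {\<mu>2 y, - \<mu>2 y}" using assms(2) U(2) by (simp add: local_rep_def)
    ultimately have "{\<mu>1 y, - \<mu>1 y} = {\<mu>2 y, - \<mu>2 y}" by simp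
    then have "\<mu>2 y \<in> {\<mu>1 y, - \<mu>1 y}" by blast
    then show ?thesis by blast
  qed
  have hs: "\<mu>2 y = h y *\<^sub>R \<mu>1 y \<and> (h y = 1 \<or> h y = -1)" if "y \<in> W" for y
    using pm[OF that] nz[OF that] by (auto simp: h_def)
  have "smooth_fun_on A W h"
    unfolding h_def
  proof (intro smooth_fun_mult smooth_fun_inverse o(1) nz)
    show "smooth_fun_on A W (\<lambda>y. \<mu>2 y (at_pt e y))"
      by (rule smooth_fun_subset[OF smooth_formsD(2)[OF m(2) V(1) order_refl]]) (auto simp: W_def)
    show "smooth_fun_on A W (\<lambda>y. \<mu>1 y (at_pt e y))"
      by (rule smooth_fun_subset[OF smooth_formsD(2)[OF m(1) V(1) order_refl]]) (auto simp: W_def)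
  qed
  then have cont: "continuous_on W h" by (rule smooth_fun_continuous[OF o(1)])
  \<comment> \<open>The two possible values are 2 apart, so a ball of radius 1 isolates one of
    them.\<close>
  define N where "N = W \<inter> h -` ball (h x) 1"
  have "open N" unfolding N_def using cont o(1) by (simp add: continuous_on_open_vimage Int_commute)
  moreover have "x \<in> N" using o(2) by (simp add: N_def)
  moreover have "\<mu>2 y = h x *\<^sub>R \<mu>1 y" if "y \<in> N" for y
  proof -
    have y: "y \<in> W" "dist (h x) (h y) < 1" using that by (auto simp: N_def)
    have "h y = h x" using hs[OF y(1)] hs[OF o(2)] y(2) by (auto simp: dist_real_def)
    then show ?thesis using hs[OF y(1)] by simp
  qed
  moreover have "h x \<in> {1, -1}" using hs[OF o(2)] by auto
  ultimately show ?thesis by blast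
qed

text \<open>Both sides scale with the constant sign relating the representatives. The sign has to be
  constant near x and not only known at x, because \<open>lie_diff\<close> differentiates.\<close>

lemma lie_diff_rep_independent:
  assumes "local_rep A E \<nu> U1 \<mu>1" "local_rep A E \<nu> U2 \<mu>2" "x \<in> U1" "x \<in> U2" "a \<in> multivectors A E"
    and "lie_diff A E a \<mu>1 x = - contraction (fibre E x) b (\<mu>1 x)"
  shows "lie_diff A E a \<mu>2 x = - contraction (fibre E x) b (\<mu>2 x)"
proof -
  obtain s N where s: "s \<in> {1, -1}" "open N" "x \<in> N" "\<forall>y\<in>N. \<mu>2 y = s *\<^sub>R \<mu>1 y"
    using local_rep_sign[OF assms(1-4)] by blast
  obtain N' \<mu>' where \<mu>': "volume_near N' x \<mu>'" "\<forall>y\<in>N'. y \<in> U1 \<and> \<mu>1 y = \<mu>' y"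
    by (rule local_rep_volume[OF assms(1,3)])
  have SF: "\<mu>' \<in> SF" and x: "x \<in> N'" and oN': "open N'" using \<mu>'(1) by (auto simp: volume_near_def)
  have V: "volume_near (N \<inter> N') x (s *\<^sub>R \<mu>')"
  proof -
    have "volume_near N' x (s *\<^sub>R \<mu>')" using s(1) \<mu>'(1) volume_near_uminus[OF \<mu>'(1)] by auto
    then show ?thesis using s(2,3) by (auto simp: volume_near_def)
  qed
  have c: "contraction_sec E (parity a) (s *\<^sub>R \<mu>') = s *\<^sub>R contraction_sec E (parity a) \<mu>'"
    by (simp add: contraction_sec_def contraction_linear fun_eq_iff)
  have "lie_diff A E a \<mu>2 x = - differential A E (contraction_sec E (parity a) (s *\<^sub>R \<mu>')) x"
    by (rule lie_diff_volume[OF V]) (use s(3,4) \<mu>'(2) x in auto)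
  also have "\<dots> = s *\<^sub>R - differential A E (contraction_sec E (parity a) \<mu>') x"
    unfolding c by (simp add: differential_const_scale SF_contraction multivectors_parity assms(5) SF)
  also have "- differential A E (contraction_sec E (parity a) \<mu>') x = lie_diff A E a \<mu>1 x"
    using lie_diff_volume[OF \<mu>'(1) _ x, of \<mu>1 a] \<mu>'(2) by simp
  also have "s *\<^sub>R lie_diff A E a \<mu>1 x = - contraction (fibre E x) b (\<mu>2 x)"
    using s(3,4) assms(6) by (simp add: contraction_linear)
  finally show ?thesis .
qed

text \<open>In each fibre i_b \<mu> can be prescribed because \<mu> is a top form, and one
  representative then serves for all. The choices fit together smoothly by
  \<open>multivectorsI_star\<close>.\<close>

lemma volume_operator_exists:
  assumes \<nu>: "\<nu> \<in> Sec_Vol A E" and a: "a \<in> multivectors A E"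
  shows "\<exists>b\<in>multivectors A E. \<forall>U \<mu>. local_rep A E \<nu> U \<mu> \<longrightarrow>
    (\<forall>x\<in>U. lie_diff A E a \<mu> x = - contraction_sec E b \<mu> x)"
proof -
  define ok where "ok b x \<longleftrightarrow> b \<in> alt_forms (dual_space (fibre E x)) \<and> (\<forall>U \<mu>. local_rep A E \<nu> U \<mu> \<longrightarrow> x \<in> U \<longrightarrow>
     lie_diff A E a \<mu> x = - contraction (fibre E x) b (\<mu> x))" for b x
  have rep: "\<exists>U \<mu>. x \<in> U \<and> local_rep A E \<nu> U \<mu>" for x using \<nu> by (simp add: Sec_Vol_def)
  have ex: "\<exists>b. ok b x" for x
  proof -
    obtain U \<mu> where U: "x \<in> U" "local_rep A E \<nu> U \<mu>" using rep by blast
    obtain N \<mu>' where N: "volume_near N x \<mu>'" "\<forall>y\<in>N. y \<in> U \<and> \<mu> y = \<mu>' y"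
      by (rule local_rep_volume[OF U(2,1)])
    have x: "x \<in> N" and SF: "\<mu>' \<in> SF" using N(1) by (auto simp: volume_near_def)
    have \<eta>: "differential A E (contraction_sec E (parity a) \<mu>') x \<in> alt_forms (fibre E x)"
      by (intro SF_alt differential_smooth SF_contraction multivectors_parity a SF)
    obtain bs where bs: "basis_list (fibre E x) bs" by (rule fibre_basis)
    obtain b where b: "b \<in> alt_forms (dual_space (fibre E x))"
      "contraction (fibre E x) b (\<mu> x) = differential A E (contraction_sec E (parity a) \<mu>') x"
      using contraction_top_surj[OF bs local_rep_top[OF U(2,1)] \<eta>] by blast
    have "lie_diff A E a \<mu> x = - contraction (fibre E x) b (\<mu> x)"
      using lie_diff_volume[OF N(1) _ x, of \<mu> a] N(2) b(2) by simp
    then have "ok b x" unfolding ok_def using b(1) lie_diff_rep_independent[OF U(2) _ U(1) _ a] by blast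
    then show ?thesis by blast
  qed
  define b where "b x = (SOME b. ok b x)" for x
  have b: "ok (b x) x" for x unfolding b_def by (rule someI_ex[OF ex])
  have "b \<in> multivectors A E"
  proof (rule multivectorsI_star)
    fix x
    show "b x \<in> alt_forms (dual_space (fibre E x))" using b by (simp add: ok_def)
    obtain U \<mu> where U: "x \<in> U" "local_rep A E \<nu> U \<mu>" using rep by blast
    obtain N \<mu>' where N: "volume_near N x \<mu>'" "\<forall>y\<in>N. y \<in> U \<and> \<mu> y = \<mu>' y"
      by (rule local_rep_volume[OF U(2,1)])
    have x: "x \<in> N" "open N" and SF: "\<mu>' \<in> SF" and top: "\<forall>y\<in>N. top_form (fibre E y) (\<mu>' y)"
      using N(1) by (auto simp: volume_near_def)
    have \<eta>: "differential A E (contraction_sec E (parity a) \<mu>') \<in> SF"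
      by (intro differential_smooth SF_contraction multivectors_parity a SF)
    have "contraction (fibre E y) (b y) (\<mu>' y) = differential A E (contraction_sec E (parity a) \<mu>') y" if "y \<in> N" for y
    proof -
      have "lie_diff A E a \<mu> y = - contraction (fibre E y) (b y) (\<mu> y)"
        using b[of y] N(2) that U(2) by (simp add: ok_def)
      then show ?thesis using lie_diff_volume[OF N(1) _ that, of \<mu> a] N(2) that by simp
    qed
    then show "\<exists>N \<mu> \<eta>. open N \<and> x \<in> N \<and> \<mu> \<in> smooth_forms A E N \<and> \<eta> \<in> smooth_forms A E N \<and>
      (\<forall>y\<in>N. top_form (fibre E y) (\<mu> y) \<and> contraction (fibre E y) (b y) (\<mu> y) = \<eta> y)"
      using x top smooth_forms_subset[OF SF subset_UNIV, of N] smooth_forms_subset[OF \<eta> subset_UNIV, of N] by blast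
  qed
  then show ?thesis using b by (intro bexI[of _ b]) (auto simp: ok_def contraction_sec_def)
qed

lemma volume_operator_unique:
  assumes \<nu>: "\<nu> \<in> Sec_Vol A E" and b: "b \<in> multivectors A E" "b' \<in> multivectors A E"
    and "\<And>U \<mu> x. local_rep A E \<nu> U \<mu> \<Longrightarrow> x \<in> U \<Longrightarrow> contraction_sec E b \<mu> x = contraction_sec E b' \<mu> x"
  shows "b = b'"
proof
  fix x
  obtain U \<mu> where U: "x \<in> U" "local_rep A E \<nu> U \<mu>" using \<nu> unfolding Sec_Vol_def by blast
  obtain bs where bs: "basis_list (fibre E x) bs" by (rule fibre_basis)
  show "b x = b' x"
    using assms(4)[OF U(2,1)]
    by (intro contraction_top_inject[OF bs local_rep_top[OF U(2,1)]] multivectors_alt b) (simp add: contraction_sec_def)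
qed

end


section \<open>The generating operator\<close>

lemma multivector_vanish_deg:
  assumes "basis_list F bs" "b \<in> alt_forms (dual_space F)"
    "\<And>I. I \<subseteq> {..<length bs} \<Longrightarrow> int (card I) \<noteq> q \<Longrightarrow> b (nths (map (coord bs) bs) I) = 0"
    "int (length \<xi>s) \<noteq> q"
  shows "b \<xi>s = 0"
proof -
  have "b \<xi>s = (\<Sum>I\<in>Pow {..<length bs}. b (nths (map (coord bs) bs) I) * wedge_list F (nths bs I) \<xi>s)"
    by (subst (1) multivector_expansion[OF assms(1,2), symmetric]) (simp add: sum_fun_apply)
  also have "\<dots> = 0"
  proof (rule sum.neutral, rule ballI)
    fix I assume I: "I \<in> Pow {..<length bs}"
    have "{i. i < length bs \<and> i \<in> I} = I" using I by auto
    then have "length (nths bs I) = card I" by (simp add: length_nths)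
    then show "b (nths (map (coord bs) bs) I) * wedge_list F (nths bs I) \<xi>s = 0"
      using assms(3)[of I] I assms(4) wedge_list_degree[of \<xi>s "nths bs I" F] by (cases "int (card I) = q") auto
  qed
  finally show ?thesis .
qed

lemma contraction_length:
  assumes "basis_list F bs" "a \<in> alt_forms (dual_space F)" "\<mu> \<in> alt_forms F"
    "\<And>\<xi>s. int (length \<xi>s) \<noteq> p \<Longrightarrow> a \<xi>s = 0" "\<And>vs. length vs \<noteq> r \<Longrightarrow> \<mu> vs = 0" "int (length vs) \<noteq> int r - p"
  shows "contraction F a \<mu> vs = 0"
  unfolding contraction_eq_contr[OF assms(1,3,2)] contr_eq_sum
proof (rule sum.neutral, rule ballI)
  fix I
  have "length (nths (map (coord bs) bs) I) = length (nths bs I)" by (simp add: nths_map)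
  then show "a (nths (map (coord bs) bs) I) * \<mu> (nths bs I @ vs) = 0"
    using assms(4)[of "nths (map (coord bs) bs) I"] assms(5)[of "nths bs I @ vs"] assms(6)
    by (cases "int (length (nths bs I)) = p") auto
qed

text \<open>\<open>D\<close> is an arbitrary solution of the formula: membership in
  \<open>Gen\<close> is asserted for every such operator and not for one construction.\<close>

locale volume_operator = schouten_algebroid A E br
  for A :: "('m::{t2_space, second_countable_topology}, 'b::real_inner) atlas"
    and E :: "('m, 'v::real_vector) algebroid" and br +
  fixes \<nu> :: "'m \<Rightarrow> ('v list \<Rightarrow> real) set"
    and D :: "('m \<Rightarrow> ('v \<Rightarrow> real) list \<Rightarrow> real) \<Rightarrow> 'm \<Rightarrow> ('v \<Rightarrow> real) list \<Rightarrow> real"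
  assumes \<nu>: "\<nu> \<in> Sec_Vol A E"
    and D: "D \<in> multivectors A E \<rightarrow>\<^sub>E multivectors A E"
    and D_eq: "a \<in> multivectors A E \<Longrightarrow> local_rep A E \<nu> U \<mu> \<Longrightarrow> x \<in> U \<Longrightarrow>
      lie_diff A E a \<mu> x = - contraction_sec E (D a) \<mu> x"
begin

lemma differential_uminus: "\<omega> \<in> SF \<Longrightarrow> differential A E (- \<omega>) x = - differential A E \<omega> x"
  using differential_const_scale[of \<omega> "-1" x] by simp

lemma D_mv: "a \<in> multivectors A E \<Longrightarrow> D a \<in> multivectors A E"
  using D by auto

definition star :: "('m \<Rightarrow> 'v list \<Rightarrow> real) \<Rightarrow> ('m \<Rightarrow> ('v \<Rightarrow> real) list \<Rightarrow> real) \<Rightarrow> 'm \<Rightarrow> 'v list \<Rightarrow> real" where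
  "star \<mu> a = contraction_sec E a \<mu>"

text \<open>Since \<open>\<mu>\<close> is closed, \<open>D\<close> is conjugate to \<open>d\<close> under \<open>a \<mapsto> i\<^sub>a \<mu>\<close>, up to the sign \<open>parity\<close>.\<close>

lemma obtain_volume:
  obtains N \<mu> where "volume_near N x \<mu>"
    "\<forall>a\<in>multivectors A E. \<forall>y\<in>N. star \<mu> (D a) y = differential A E (star \<mu> (parity a)) y"
proof -
  obtain U \<mu> where U: "x \<in> U" "local_rep A E \<nu> U \<mu>" using \<nu> unfolding Sec_Vol_def by blast
  obtain N \<mu>' where N: "volume_near N x \<mu>'" "\<forall>y\<in>N. y \<in> U \<and> \<mu> y = \<mu>' y"
    by (rule local_rep_volume[OF U(2,1)])
  have "star \<mu>' (D a) y = differential A E (star \<mu>' (parity a)) y" if "a \<in> multivectors A E" "y \<in> N" for a y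
    using D_eq[OF that(1) U(2), of y] lie_diff_volume[OF N(1) _ that(2), of \<mu> a] N(2) that(2)
    by (simp add: star_def contraction_sec_def)
  then show ?thesis using N(1) that by blast
qed

lemma star_SF: "volume_near N x \<mu> \<Longrightarrow> a \<in> multivectors A E \<Longrightarrow> star \<mu> a \<in> SF"
  unfolding star_def by (rule SF_contraction) (simp_all add: volume_near_def)

lemma star_inject:
  assumes "volume_near N x \<mu>" "a \<in> multivectors A E" "b \<in> multivectors A E" "star \<mu> a x = star \<mu> b x"
  shows "a x = b x"
proof -
  obtain bs where bs: "basis_list (fibre E x) bs" by (rule fibre_basis)
  have "top_form (fibre E x) (\<mu> x)" using assms(1) by (simp add: volume_near_def)
  then show ?thesis
    using assms(4) by (intro contraction_top_inject[OF bs _ multivectors_alt[OF assms(2)] multivectors_alt[OF assms(3)]])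
      (simp_all add: star_def contraction_sec_def)
qed

lemma star_linear:
  "star \<mu> (a + b) x = star \<mu> a x + star \<mu> b x" "star \<mu> (c *\<^sub>R a) x = c *\<^sub>R star \<mu> a x"
  "star \<mu> (- a) x = - star \<mu> a x" "star \<mu> (a - b) x = star \<mu> a x - star \<mu> b x" "star \<mu> 0 x = 0"
  by (simp_all add: star_def contraction_sec_def contraction_linear)

lemma parity_linear: "parity (a + b) = parity a + parity b" "parity (c *\<^sub>R a) = c *\<^sub>R parity a"
    "parity (parity a) = a"
  by (intro ext; simp add: parity_eq)+

lemma D_add:
  assumes "a \<in> multivectors A E" "b \<in> multivectors A E"
  shows "D (a + b) = D a + D b"
proof
  fix x
  obtain N \<mu> where V: "volume_near N x \<mu>"
    and S: "\<forall>a\<in>multivectors A E. \<forall>y\<in>N. star \<mu> (D a) y = differential A E (star \<mu> (parity a)) y" by (rule obtain_volume)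
  have x: "x \<in> N" using V by (simp add: volume_near_def)
  note m = multivectors_parity[OF assms(1)] multivectors_parity[OF assms(2)]
  have e: "star \<mu> (parity (a + b)) = star \<mu> (parity a) + star \<mu> (parity b)"
    by (intro ext) (simp add: parity_linear star_linear)
  have "star \<mu> (D (a + b)) x = differential A E (star \<mu> (parity (a + b))) x"
    using S x multivectors_add[OF assms] by blast
  also have "\<dots> = star \<mu> (D a) x + star \<mu> (D b) x"
    unfolding e differential_add[OF star_SF[OF V m(1)] star_SF[OF V m(2)]] using S x assms by simp
  also have "\<dots> = star \<mu> (D a + D b) x" by (simp add: star_linear)
  finally show "D (a + b) x = (D a + D b) x"
    by (rule star_inject[OF V D_mv[OF multivectors_add[OF assms]] multivectors_add[OF D_mv[OF assms(1)] D_mv[OF assms(2)]]])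
qed

lemma D_scale:
  assumes "a \<in> multivectors A E"
  shows "D (t *\<^sub>R a) = t *\<^sub>R D a"
proof
  fix x
  obtain N \<mu> where V: "volume_near N x \<mu>"
    and S: "\<forall>a\<in>multivectors A E. \<forall>y\<in>N. star \<mu> (D a) y = differential A E (star \<mu> (parity a)) y" by (rule obtain_volume)
  have x: "x \<in> N" using V by (simp add: volume_near_def)
  have e: "star \<mu> (parity (t *\<^sub>R a)) = t *\<^sub>R star \<mu> (parity a)"
    by (intro ext) (simp add: parity_linear star_linear)
  have "star \<mu> (D (t *\<^sub>R a)) x = differential A E (star \<mu> (parity (t *\<^sub>R a))) x"
    using S x multivectors_scale[OF assms] by blast
  also have "\<dots> = t *\<^sub>R star \<mu> (D a) x"
    unfolding e differential_const_scale[OF star_SF[OF V multivectors_parity[OF assms]]] using S x assms by simp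
  also have "\<dots> = star \<mu> (t *\<^sub>R D a) x" by (simp add: star_linear)
  finally show "D (t *\<^sub>R a) x = (t *\<^sub>R D a) x"
    by (rule star_inject[OF V D_mv[OF multivectors_scale[OF assms]] multivectors_scale[OF D_mv[OF assms]]])
qed

lemma D_0: "D 0 = 0"
  using D_scale[OF multivectors_0, of 0] by simp

text \<open>On \<mu> the involution \<open>par\<close> is multiplication by (-1)^rank. Transporting
  the parity through \<open>star\<close> produces this sign twice, so only the sign from the oddness
  of d remains.\<close>

lemma D_parity:
  assumes "a \<in> multivectors A E"
  shows "parity (D a) = - D (parity a)"
proof
  fix x
  obtain N \<mu> where V: "volume_near N x \<mu>"
    and S: "\<forall>a\<in>multivectors A E. \<forall>y\<in>N. star \<mu> (D a) y = differential A E (star \<mu> (parity a)) y" by (rule obtain_volume)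
  have x: "x \<in> N" using V by (simp add: volume_near_def)
  define s :: real where "s = (-1) ^ rank"
  have s: "s * s = 1" by (simp add: s_def flip: power_add mult_2)
  have par\<mu>: "par (\<mu> y) = s *\<^sub>R \<mu> y" for y
  proof
    fix vs show "par (\<mu> y) vs = (s *\<^sub>R \<mu> y) vs"
      using V by (cases "length vs = rank") (simp_all add: par_def s_def volume_near_def)
  qed
  have sp: "star \<mu> (parity b) y = s *\<^sub>R par (star \<mu> b y)" for b y
    by (simp add: star_def contraction_sec_def par_contraction par\<mu> contraction_linear parity_eq s)
  have e: "parity (star \<mu> (parity a)) = s *\<^sub>R star \<mu> a"
    by (intro ext) (simp add: parity_eq sp)
  have SFs: "star \<mu> a \<in> SF" "star \<mu> (parity a) \<in> SF" using star_SF[OF V] assms multivectors_parity by auto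
  have "star \<mu> (parity (D a)) x = s *\<^sub>R par (differential A E (star \<mu> (parity a)) x)"
    using S x assms by (simp add: sp)
  also have "par (differential A E (star \<mu> (parity a)) x) = - differential A E (parity (star \<mu> (parity a))) x"
    using differential_parity[OF SFs(2), of x] by simp
  also have "\<dots> = - (s *\<^sub>R differential A E (star \<mu> a) x)"
    unfolding e differential_const_scale[OF SFs(1)] ..
  also have "differential A E (star \<mu> a) x = star \<mu> (D (parity a)) x"
    using S x multivectors_parity[OF assms] by (simp add: parity_linear)
  also have "s *\<^sub>R - (s *\<^sub>R star \<mu> (D (parity a)) x) = star \<mu> (- D (parity a)) x"
    by (simp add: star_linear s)
  finally show "parity (D a) x = (- D (parity a)) x"
    by (rule star_inject[OF V multivectors_parity[OF D_mv[OF assms]] multivectors_uminus[OF D_mv[OF multivectors_parity[OF assms]]]])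
qed

text \<open>Degree p becomes \<open>rank\<close> - p under \<open>star\<close>, \<open>rank\<close>
  - p + 1 under d, and p - 1 on the way back.\<close>

lemma D_deg:
  assumes a: "a \<in> multivectors_deg A E p"
  shows "D a \<in> multivectors_deg A E (p - 1)"
proof -
  have am: "a \<in> multivectors A E" by (rule multivectors_deg_subset[OF a])
  have "D a x \<xi>s = 0" if len: "int (length \<xi>s) \<noteq> p - 1" for x \<xi>s
  proof -
    obtain N \<mu> where V: "volume_near N x \<mu>"
      and S: "\<forall>a\<in>multivectors A E. \<forall>y\<in>N. star \<mu> (D a) y = differential A E (star \<mu> (parity a)) y" by (rule obtain_volume)
    have x: "x \<in> N" and top: "top_form (fibre E x) (\<mu> x)" and \<mu>: "\<mu> \<in> SF" "\<And>y vs. length vs \<noteq> rank \<Longrightarrow> \<mu> y vs = 0"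
      using V by (auto simp: volume_near_def)
    obtain bs where bs: "basis_list (fibre E x) bs" by (rule fibre_basis)
    have lb: "length bs = rank" using basis_list_length[OF bs] dim_fibre by simp
    have "differential A E (star \<mu> (parity a)) x vs = 0" if "int (length vs) \<noteq> int rank - p + 1" for vs
    proof (rule differential_length[OF star_SF[OF V multivectors_parity[OF am]] _ that])
      fix y ws assume w: "int (length (ws :: 'v list)) \<noteq> int rank - p"
      obtain cs where cs: "basis_list (fibre E y) cs" by (rule fibre_basis)
      show "star \<mu> (parity a) y ws = 0"
        unfolding star_def contraction_sec_def
        by (rule contraction_length[OF cs multivectors_alt[OF multivectors_parity[OF am]] SF_alt[OF \<mu>(1)] _ \<mu>(2) w])
          (simp add: parity_def multivectors_degD[OF a])
    qed
    then have st0: "star \<mu> (D a) x vs = 0" if "int (length vs) \<noteq> int rank - p + 1" for vs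
      using S x am that by simp
    show ?thesis
    proof (rule multivector_vanish_deg[OF bs multivectors_alt[OF D_mv[OF am]] _ len])
      fix I assume I: "I \<subseteq> {..<length bs}" "int (card I) \<noteq> p - 1"
      have "{i. i < length bs \<and> i \<in> - I} = {..<length bs} - I" by auto
      then have "length (nths bs (- I)) = length bs - card I"
        using I(1) by (simp add: length_nths card_Diff_subset finite_subset)
      moreover have "card I \<le> length bs" using I(1) card_mono[of "{..<length bs}" I] by simp
      ultimately have "int (length (nths bs (- I))) \<noteq> int rank - p + 1" using I(2) lb by auto
      then have "contraction (fibre E x) (D a x) (\<mu> x) (nths bs (- I)) = 0"
        using st0 by (simp add: star_def contraction_sec_def)
      then show "D a x (nths (map (coord bs) bs) I) = 0"
        using contraction_top_nths[OF bs top multivectors_alt[OF D_mv[OF am]], of I]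
          top_form_basis_nonzero[OF nths_perm_basis(1)[OF bs] top, of I] by simp
    qed
  qed
  then show ?thesis using D_mv[OF am] by (simp add: multivectors_deg_def)
qed

lemma D_local:
  assumes "a \<in> multivectors A E" "b \<in> multivectors A E" "\<forall>\<^sub>F y in nhds x. a y = b y"
  shows "D a x = D b x"
proof -
  obtain N \<mu> where V: "volume_near N x \<mu>"
    and S: "\<forall>a\<in>multivectors A E. \<forall>y\<in>N. star \<mu> (D a) y = differential A E (star \<mu> (parity a)) y" by (rule obtain_volume)
  have x: "x \<in> N" using V by (simp add: volume_near_def)
  have "\<forall>\<^sub>F y in nhds x. star \<mu> (parity a) y = star \<mu> (parity b) y"
    using assms(3) by (rule eventually_mono) (simp add: star_def contraction_sec_def parity_eq)
  then have "star \<mu> (D a) x = star \<mu> (D b) x" using differential_local S x assms(1,2) by metis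
  then show ?thesis by (rule star_inject[OF V D_mv[OF assms(1)] D_mv[OF assms(2)]])
qed

text \<open>As \<open>D\<close> anticommutes with parity, contraction of \<mu> by
  \<open>parity (D a)\<close> equals - d(i_a \<mu>) near x, and d applied once more gives 0.\<close>

lemma D_D:
  assumes "a \<in> multivectors A E"
  shows "D (D a) = 0"
proof
  fix x
  obtain N \<mu> where V: "volume_near N x \<mu>"
    and S: "\<forall>a\<in>multivectors A E. \<forall>y\<in>N. star \<mu> (D a) y = differential A E (star \<mu> (parity a)) y" by (rule obtain_volume)
  have x: "x \<in> N" "open N" using V by (auto simp: volume_near_def)
  have SFd: "differential A E (star \<mu> a) \<in> SF" by (rule differential_smooth[OF star_SF[OF V assms]])
  have "star \<mu> (parity (D a)) y = ((-1) *\<^sub>R differential A E (star \<mu> a)) y" if "y \<in> N" for y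
    using S that multivectors_parity[OF assms] by (simp add: D_parity[OF assms] star_linear parity_linear)
  then have "\<forall>\<^sub>F y in nhds x. star \<mu> (parity (D a)) y = ((-1) *\<^sub>R differential A E (star \<mu> a)) y"
    using x by (auto simp: eventually_nhds)
  then have "differential A E (star \<mu> (parity (D a))) x = differential A E ((-1) *\<^sub>R differential A E (star \<mu> a)) x"
    by (rule differential_local)
  also have "\<dots> = 0"
    unfolding differential_const_scale[OF SFd] differential_differential[OF star_SF[OF V assms]] by simp
  finally have "star \<mu> (D (D a)) x = star \<mu> 0 x" using S x D_mv[OF assms] by (simp add: star_linear)
  then show "D (D a) x = 0 x" by (rule star_inject[OF V D_mv[OF D_mv[OF assms]] multivectors_0])
qed

text \<open>Start from i(D(X \<and> c)) \<mu> = - d i_X i_c \<mu> and put d i_X = L_X - i_X d. Then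
  L_X i_c yields the bracket and the factor D(X), and i_X d yields X \<and> D(c).\<close>

lemma D_sec_wedge:
  assumes X: "X \<in> Sec A E" and c: "c \<in> multivectors_deg A E q"
  shows "D (of_sec E X \<and>\<^sub>\<A> c) x =
    D (of_sec E X) x [] *\<^sub>R c x - wedge (ev (fibre E x) (X x)) (D c x) - br (of_sec E X) c x"
proof -
  obtain N \<mu> where V: "volume_near N x \<mu>"
    and S: "\<forall>a\<in>multivectors A E. \<forall>y\<in>N. star \<mu> (D a) y = differential A E (star \<mu> (parity a)) y" by (rule obtain_volume)
  have x: "x \<in> N" "open N" and \<mu>: "\<mu> \<in> SF" using V by (auto simp: volume_near_def)
  have S': "star \<mu> (D a) x = differential A E (star \<mu> (parity a)) x" if "a \<in> multivectors A E" for a using S x that by blast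
  have cm: "c \<in> multivectors A E" and Xm: "of_sec E X \<in> multivectors A E"
    using multivectors_deg_subset[OF c] of_sec_multivectors[OF X] by auto
  obtain bs where bs: "basis_list (fibre E x) bs" by (rule fibre_basis)
  define g where "g = D (of_sec E X) x []"
  \<comment> \<open>By degree \<open>D\<close> of a section is a function, and \<open>g\<close> is
    its value at x.\<close>
  have DX: "D (of_sec E X) x = scalar_form g"
    using multivectors_degD[OF D_deg[OF of_sec_deg[OF X]]] by (auto simp: fun_eq_iff scalar_form_def g_def)
  have pX: "parity (of_sec E X \<and>\<^sub>\<A> b) = - (of_sec E X \<and>\<^sub>\<A> parity b)" for b
    by (rule ext) (simp add: parity_eq wedge_sec_eq par_wedge of_sec_eq)
  have i1: "star \<mu> (of_sec E X \<and>\<^sub>\<A> parity c) = ins_form X (star \<mu> c)"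
    unfolding star_def contraction_sec_wedge[OF X \<mu>] ins_form_contraction[OF X \<mu>] ..
  have SFc: "star \<mu> c \<in> SF" by (rule star_SF[OF V cm])
  have A: "star \<mu> (D (of_sec E X \<and>\<^sub>\<A> c)) x = - differential A E (ins_form X (star \<mu> c)) x"
  proof -
    have e: "star \<mu> (parity (of_sec E X \<and>\<^sub>\<A> c)) = (-1) *\<^sub>R ins_form X (star \<mu> c)"
      by (rule ext) (simp add: pX star_linear i1)
    show ?thesis
      unfolding S'[OF multivectors_wedge[OF Xm cm]] e differential_const_scale[OF SF_ins[OF X SFc]] by simp
  qed
  \<comment> \<open>The relation between \<open>D\<close> and d read backwards: d(i_c \<mu>) is
    itself a contraction of \<mu>, and i_X is absorbed as a further factor.\<close>
  have B: "hook (X x) (differential A E (star \<mu> c) x) = - contraction (fibre E x) (wedge (ev (fibre E x) (X x)) (D c x)) (\<mu> x)"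
  proof -
    have "differential A E (star \<mu> c) x = star \<mu> (D (parity c)) x"
      using S'[OF multivectors_parity[OF cm]] by (simp add: parity_linear)
    also have "D (parity c) = - parity (D c)" by (simp add: D_parity[OF cm])
    also have "star \<mu> (- parity (D c)) x = - contraction (fibre E x) (par (D c x)) (\<mu> x)"
      by (simp add: star_def contraction_sec_def contraction_linear parity_eq)
    finally show ?thesis
      using hook_contraction[OF bs SF_alt[OF \<mu>] Sec_fibre[OF X], of "par (D c x)"]
        contraction_wedge_ev[OF bs SF_alt[OF \<mu>] Sec_fibre[OF X], of "D c x"] by simp
  qed
  \<comment> \<open>So \<open>g\<close> is minus the divergence of X with respect to \<mu>.\<close>
  have C: "lie_form X \<mu> x = - (g *\<^sub>R \<mu> x)"
  proof -
    have "ins_form X \<mu> = star \<mu> (of_sec E X \<and>\<^sub>\<A> of_fun (\<lambda>_. 1))"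
      unfolding star_def contraction_sec_wedge[OF X \<mu>]
      by (rule ext) (simp add: contraction_sec_def of_fun_eq contraction_scalar_form)
    also have "of_sec E X \<and>\<^sub>\<A> of_fun (\<lambda>_. 1) = (-1) *\<^sub>R parity (of_sec E X)"
      by (rule ext) (simp add: wedge_sec_eq of_fun_eq parity_eq of_sec_eq)
    also have "star \<mu> ((-1) *\<^sub>R parity (of_sec E X)) = (-1) *\<^sub>R star \<mu> (parity (of_sec E X))"
      by (rule ext) (simp add: star_linear)
    finally have "differential A E (ins_form X \<mu>) x = - star \<mu> (D (of_sec E X)) x"
      using S'[OF Xm] by (simp add: differential_uminus[OF star_SF[OF V multivectors_parity[OF Xm]]])
    then show ?thesis
      unfolding cartan[OF X \<mu>] volume_closed[OF V]
      by (simp add: star_def contraction_sec_def DX contraction_scalar_form)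
  qed
  have Dd: "lie_form X (star \<mu> c) x = - (g *\<^sub>R star \<mu> c x) + contraction (fibre E x) (br (of_sec E X) c x) (\<mu> x)"
    using lie_form_contraction[OF X c \<mu>, of x]
    by (simp add: star_def contraction_sec_def C contraction_linear)
  define R where "R = g *\<^sub>R c x - wedge (ev (fibre E x) (X x)) (D c x) - br (of_sec E X) c x"
  have "star \<mu> (D (of_sec E X \<and>\<^sub>\<A> c)) x = - lie_form X (star \<mu> c) x + hook (X x) (differential A E (star \<mu> c) x)"
    unfolding A cartan[OF X SFc] by simp
  also have "\<dots> = contraction (fibre E x) R (\<mu> x)"
    unfolding Dd B R_def by (simp add: contraction_linear star_def contraction_sec_def)
  finally have eq: "contraction (fibre E x) (D (of_sec E X \<and>\<^sub>\<A> c) x) (\<mu> x) = contraction (fibre E x) R (\<mu> x)"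
    by (simp add: star_def contraction_sec_def)
  have brm: "br (of_sec E X) c \<in> multivectors A E" by (rule multivectors_deg_subset[OF br_deg[OF of_sec_deg[OF X] c]])
  have Rm: "R \<in> alt_forms (dual_space (fibre E x))"
    unfolding R_def
    by (intro subspace_diff[OF subspace_alt_forms] alt_forms_lin wedge_alt_forms subspace_dual_space
        ev_alt_forms Sec_fibre X multivectors_alt cm D_mv brm)
  have top: "top_form (fibre E x) (\<mu> x)" using V by (simp add: volume_near_def)
  show ?thesis
    using contraction_top_inject[OF bs top multivectors_alt[OF D_mv[OF multivectors_wedge[OF Xm cm]]] Rm eq]
    by (simp add: R_def g_def)
qed

text \<open>The identity in \<open>Gen\<close> at one point, solved for D(a \<and> b). The degree p
  is a parameter because the sign depends on it and zero has every degree.\<close>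

definition gen_at :: "'m \<Rightarrow> int \<Rightarrow> ('m \<Rightarrow> ('v \<Rightarrow> real) list \<Rightarrow> real) \<Rightarrow> ('m \<Rightarrow> ('v \<Rightarrow> real) list \<Rightarrow> real) \<Rightarrow> bool" where
  "gen_at x p a b \<longleftrightarrow> D (a \<and>\<^sub>\<A> b) x =
     wedge (D a x) (b x) + (-1) powi p *\<^sub>R wedge (a x) (D b x) + (-1) powi p *\<^sub>R br a b x"

text \<open>Bring X to the front of a \<and> X \<and> c and apply \<open>D_sec_wedge\<close> to X
  \<and> (a \<and> c) and to X \<and> c. The terms with D(X) agree, the brackets with X match by the
  Leibniz rule and skew symmetry, and what is left is the hypothesis multiplied by X.\<close>

lemma gen_at_step:
  assumes X: "X \<in> Sec A E" and a: "a \<in> multivectors_deg A E p" and c: "c \<in> multivectors_deg A E q"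
    and G: "gen_at x p a c"
  shows "gen_at x p a (of_sec E X \<and>\<^sub>\<A> c)"
proof -
  define \<sigma> :: real where "\<sigma> = (-1) powi p"
  have \<sigma>: "\<sigma> * \<sigma> = 1" by (simp add: \<sigma>_def flip: power_int_mult_distrib)
  have \<sigma>': "(-1) powi (p - 1) = - \<sigma>" by (simp add: \<sigma>_def power_int_diff)
  note Xd = of_sec_deg[OF X]
  define v where "v = ev (fibre E x) (X x)"
  have vx: "of_sec E X x = v" by (simp add: v_def of_sec_eq)
  define g where "g = D (of_sec E X) x []"
  define \<alpha> \<gamma> \<alpha>' \<gamma>' where "\<alpha> = a x" and "\<gamma> = c x" and "\<alpha>' = D a x" and "\<gamma>' = D c x"
  define bXa bXc bac where "bXa = br (of_sec E X) a x" and "bXc = br (of_sec E X) c x" and "bac = br a c x"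
  have comm: "wedge \<beta> v = wedge v (par \<beta>)" for \<beta> unfolding v_def by (rule wedge_ev_commute)
  have pa: "par \<alpha> = \<sigma> *\<^sub>R \<alpha>" unfolding \<alpha>_def \<sigma>_def by (rule par_deg[OF a])
  have pa': "par \<alpha>' = - (\<sigma> *\<^sub>R \<alpha>')" unfolding \<alpha>'_def using par_deg[OF D_deg[OF a], of x] \<sigma>' by simp
  have aXc: "a \<and>\<^sub>\<A> (of_sec E X \<and>\<^sub>\<A> c) = \<sigma> *\<^sub>R (of_sec E X \<and>\<^sub>\<A> (a \<and>\<^sub>\<A> c))"
  proof
    fix y
    have "wedge (a y) (of_sec E X y) = wedge (of_sec E X y) (\<sigma> *\<^sub>R a y)"
      unfolding of_sec_eq wedge_ev_commute par_deg[OF a] \<sigma>_def ..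
    then show "(a \<and>\<^sub>\<A> (of_sec E X \<and>\<^sub>\<A> c)) y = (\<sigma> *\<^sub>R (of_sec E X \<and>\<^sub>\<A> (a \<and>\<^sub>\<A> c))) y"
      by (simp add: wedge_sec_eq flip: wedge_assoc)
  qed
  have acd: "a \<and>\<^sub>\<A> c \<in> multivectors_deg A E (p + q)" by (rule multivectors_deg_wedge[OF a c])
  have Xac: "of_sec E X \<and>\<^sub>\<A> (a \<and>\<^sub>\<A> c) \<in> multivectors A E"
    by (rule multivectors_deg_subset[OF multivectors_deg_wedge[OF Xd acd]])
  have brXac: "br (of_sec E X) (a \<and>\<^sub>\<A> c) x = wedge bXa \<gamma> + wedge \<alpha> bXc"
    using br_leibniz[OF Xd a c] by (simp add: wedge_sec_eq bXa_def bXc_def \<alpha>_def \<gamma>_def)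
  have Dac: "D (a \<and>\<^sub>\<A> c) x = wedge \<alpha>' \<gamma> + \<sigma> *\<^sub>R wedge \<alpha> \<gamma>' + \<sigma> *\<^sub>R bac"
    using G by (simp add: gen_at_def \<alpha>_def \<gamma>_def \<alpha>'_def \<gamma>'_def bac_def \<sigma>_def)
  have L: "D (a \<and>\<^sub>\<A> (of_sec E X \<and>\<^sub>\<A> c)) x = \<sigma> *\<^sub>R (g *\<^sub>R wedge \<alpha> \<gamma>
      - wedge v (wedge \<alpha>' \<gamma> + \<sigma> *\<^sub>R wedge \<alpha> \<gamma>' + \<sigma> *\<^sub>R bac) - (wedge bXa \<gamma> + wedge \<alpha> bXc))"
    unfolding aXc D_scale[OF Xac] using D_sec_wedge[OF X acd, of x]
    by (simp add: brXac Dac g_def v_def wedge_sec_eq \<alpha>_def \<gamma>_def)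
  have DXc: "D (of_sec E X \<and>\<^sub>\<A> c) x = g *\<^sub>R \<gamma> - wedge v \<gamma>' - bXc"
    using D_sec_wedge[OF X c, of x] by (simp add: g_def v_def \<gamma>_def \<gamma>'_def bXc_def)
  \<comment> \<open>The exponent (p - 1) * (1 - 1) is 0, so skew symmetry brings only the minus
    sign.\<close>
  have braX: "br a (of_sec E X) x = - bXa"
    using br_skew[OF a Xd] by (simp add: bXa_def)
  have braXc: "br a (of_sec E X \<and>\<^sub>\<A> c) x = - wedge bXa \<gamma> - \<sigma> *\<^sub>R wedge v bac"
    using br_leibniz[OF a Xd c] \<sigma>' braX by (simp add: wedge_sec_eq vx \<gamma>_def bac_def)
  have "wedge \<alpha>' (wedge v \<gamma>) = - (\<sigma> *\<^sub>R wedge v (wedge \<alpha>' \<gamma>))"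
    by (simp add: comm pa' flip: wedge_assoc)
  moreover have "wedge \<alpha> (wedge v \<gamma>') = \<sigma> *\<^sub>R wedge v (wedge \<alpha> \<gamma>')"
    by (simp add: comm pa flip: wedge_assoc)
  ultimately show ?thesis
    unfolding gen_at_def L
    using \<sigma> by (simp add: DXc braXc wedge_sec_eq vx algebra_simps flip: \<sigma>_def \<alpha>_def \<gamma>_def \<alpha>'_def \<gamma>'_def)
qed

text \<open>For fixed a the identity is local and additive in b and stable under b \<mapsto> X
  \<and> b, so b may be taken to be a function.\<close>

lemma gen_at_induct:
  assumes a: "a \<in> multivectors_deg A E p" and b: "b \<in> multivectors_deg A E q"
    and func: "\<And>f. f \<in> Cinf A \<Longrightarrow> gen_at x p a (of_fun f)"
  shows "gen_at x p a b"
  using b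
proof (induction rule: multivector_induct_near[where x = x])
  case (local q c c')
  have am: "a \<in> multivectors A E" by (rule multivectors_deg_subset[OF a])
  have m: "c \<in> multivectors A E" "c' \<in> multivectors A E" using local(1,2) multivectors_deg_subset by auto
  have x: "c x = c' x" using local(3) by (rule eventually_nhds_x_imp_x)
  have "\<forall>\<^sub>F y in nhds x. (a \<and>\<^sub>\<A> c) y = (a \<and>\<^sub>\<A> c') y"
    using local(3) by (rule eventually_mono) (simp add: wedge_sec_eq)
  then have 1: "D (a \<and>\<^sub>\<A> c) x = D (a \<and>\<^sub>\<A> c') x"
    by (rule D_local[OF multivectors_wedge[OF am m(1)] multivectors_wedge[OF am m(2)]])
  have 2: "D c x = D c' x" by (rule D_local[OF m local(3)])
  have 3: "br a c x = br a c' x" by (rule br_local[OF a local(1-3)])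
  show ?case using local(4) unfolding gen_at_def 1 2 3 x .
next
  case (zero q)
  have z: "a \<and>\<^sub>\<A> 0 = 0" by (intro ext) (simp add: wedge_sec_eq)
  have "gen_at x p a 0"
    unfolding gen_at_def z D_0 br_0_right[OF multivectors_deg_subset[OF a]] by simp
  then show ?case .
next
  case (add q c c')
  have am: "a \<in> multivectors A E" by (rule multivectors_deg_subset[OF a])
  have m: "c \<in> multivectors A E" "c' \<in> multivectors A E" using add(1,2) multivectors_deg_subset by auto
  have w: "a \<and>\<^sub>\<A> (c + c') = (a \<and>\<^sub>\<A> c) + (a \<and>\<^sub>\<A> c')" by (intro ext) (simp add: wedge_sec_eq)
  have "gen_at x p a c" "gen_at x p a c'" by (fact add)+
  then have "gen_at x p a (c + c')"
    unfolding gen_at_def w D_add[OF multivectors_wedge[OF am m(1)] multivectors_wedge[OF am m(2)]]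
      D_add[OF m] br_add_right[OF am m] by (simp add: algebra_simps)
  then show ?case .
next
  case (func f)
  then show ?case by (rule assms(3))
next
  case (sec q X c)
  then show ?case using gen_at_step[OF _ a] by blast
qed

lemma D_of_fun: "f \<in> Cinf A \<Longrightarrow> D (of_fun f) = 0"
  using multivectors_deg_neg[OF D_deg[OF of_fun_deg]] by simp

text \<open>After reduction of b to a function, \<open>D\<close> and the bracket only produce
  elements of degree -1, so both sides vanish.\<close>

lemma gen_at_fun:
  assumes f: "f \<in> Cinf A" and b: "b \<in> multivectors_deg A E q"
  shows "gen_at x 0 (of_fun f) b"
proof (rule gen_at_induct[OF of_fun_deg[OF f] b])
  fix h assume h: "h \<in> Cinf A"
  have "of_fun f \<and>\<^sub>\<A> of_fun h = (of_fun (f * h) :: 'm \<Rightarrow> ('v \<Rightarrow> real) list \<Rightarrow> real)"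
    by (intro ext) (simp add: wedge_sec_eq of_fun_eq, simp add: scalar_form_def)
  moreover have "br (of_fun f) (of_fun h) = 0"
    using multivectors_deg_neg[OF br_deg[OF of_fun_deg[OF f] of_fun_deg[OF h]]] by simp
  moreover have "f * h \<in> Cinf A" by (rule Cinf_ring(2)[OF f h])
  ultimately show "gen_at x 0 (of_fun f) (of_fun h)"
    using f h by (simp add: gen_at_def D_of_fun del: mem_Collect_eq)
qed

text \<open>For b a function f, the arguments are exchanged: f commutes with a, and skew symmetry
  gives (-1)^p [a, f] = [f, a], which is the bracket term of \<open>gen_at_fun\<close> for the pair
  (f, a).\<close>

lemma gen_at_all:
  assumes a: "a \<in> multivectors_deg A E p" and b: "b \<in> multivectors_deg A E q"
  shows "gen_at x p a b"
proof (rule gen_at_induct[OF a b])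
  fix f assume f: "f \<in> Cinf A"
  define \<sigma> :: real where "\<sigma> = (-1) powi p"
  have \<sigma>: "\<sigma> * \<sigma> = 1" by (simp add: \<sigma>_def flip: power_int_mult_distrib)
  have s: "(-1) powi (1 - p) = - \<sigma>" by (simp add: \<sigma>_def power_int_diff power_int_minus_one_minus field_simps)
  have w: "a \<and>\<^sub>\<A> of_fun f = of_fun f \<and>\<^sub>\<A> a" by (intro ext) (simp add: wedge_sec_eq of_fun_eq)
  have "br a (of_fun f) x = \<sigma> *\<^sub>R br (of_fun f) a x"
    using br_skew[OF a of_fun_deg[OF f]] s by simp
  then have "\<sigma> *\<^sub>R br a (of_fun f) x = br (of_fun f) a x" using \<sigma> by simp
  then show "gen_at x p a (of_fun f)"
    using gen_at_fun[OF f a, of x] D_of_fun[OF f]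
    by (simp add: gen_at_def w of_fun_eq flip: \<sigma>_def)
qed

lemma D_Gen: "D \<in> Gen A E br"
proof -
  have gen: "br a b = (-1) powi p *\<^sub>R (D (a \<and>\<^sub>\<A> b) - D a \<and>\<^sub>\<A> b - (-1) powi p *\<^sub>R (a \<and>\<^sub>\<A> D b))"
    if "a \<in> multivectors_deg A E p" "b \<in> multivectors_deg A E q" for a b p q
  proof
    fix x
    have "((-1) powi p :: real) * (-1) powi p = 1" by (simp flip: power_int_mult_distrib)
    then show "br a b x = ((-1) powi p *\<^sub>R (D (a \<and>\<^sub>\<A> b) - D a \<and>\<^sub>\<A> b - (-1) powi p *\<^sub>R (a \<and>\<^sub>\<A> D b))) x"
      using gen_at_all[OF that, of x] by (simp add: gen_at_def wedge_sec_eq)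
  qed
  show ?thesis unfolding Gen_def using D D_add D_scale D_deg gen D_D by blast
qed

end

theorem theorem3p4:
  fixes A :: "('m::{t2_space, second_countable_topology}, 'b::real_inner) atlas"
    and E :: "('m, 'v::real_vector) algebroid"
    and br :: "('m \<Rightarrow> ('v \<Rightarrow> real) list \<Rightarrow> real) \<Rightarrow> ('m \<Rightarrow> ('v \<Rightarrow> real) list \<Rightarrow> real)
      \<Rightarrow> 'm \<Rightarrow> ('v \<Rightarrow> real) list \<Rightarrow> real"
    and \<nu> :: "'m \<Rightarrow> ('v list \<Rightarrow> real) set"
  assumes "lie_algebroid A E"
    and "schouten_bracket A E br"
    and "\<nu> \<in> Sec_Vol A E"
  shows "(\<exists>!D. D \<in> multivectors A E \<rightarrow>\<^sub>E multivectors A E \<and>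
            (\<forall>a\<in>multivectors A E. \<forall>U \<mu>. local_rep A E \<nu> U \<mu> \<longrightarrow>
               (\<forall>x\<in>U. lie_diff A E a \<mu> x = - contraction_sec E (D a) \<mu> x))) \<and>
         (\<forall>D \<in> multivectors A E \<rightarrow>\<^sub>E multivectors A E.
            (\<forall>a\<in>multivectors A E. \<forall>U \<mu>. local_rep A E \<nu> U \<mu> \<longrightarrow>
               (\<forall>x\<in>U. lie_diff A E a \<mu> x = - contraction_sec E (D a) \<mu> x)) \<longrightarrow>
            D \<in> Gen A E br)"
proof -
  interpret lie_algebroid A E by (rule assms(1))
  define ok where "ok a b \<longleftrightarrow> (\<forall>U \<mu>. local_rep A E \<nu> U \<mu> \<longrightarrow>
    (\<forall>x\<in>U. lie_diff A E a \<mu> x = - contraction_sec E b \<mu> x))" for a b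
  have ex: "\<exists>b\<in>multivectors A E. ok a b" if "a \<in> multivectors A E" for a
    unfolding ok_def by (rule volume_operator_exists[OF assms(3) that])
  have un: "b = b'" if "b \<in> multivectors A E" "b' \<in> multivectors A E" "ok a b" "ok a b'" for a b b'
  proof (rule volume_operator_unique[OF assms(3) that(1,2)])
    fix U \<mu> x assume "local_rep A E \<nu> U \<mu>" "x \<in> U"
    then have "lie_diff A E a \<mu> x = - contraction_sec E b \<mu> x" "lie_diff A E a \<mu> x = - contraction_sec E b' \<mu> x"
      using that(3,4) unfolding ok_def by blast+
    then show "contraction_sec E b \<mu> x = contraction_sec E b' \<mu> x" by simp
  qed
  \<comment> \<open>The restricted abstraction gives \<open>D\<close> the default value off the
    multivector fields, as \<open>PiE\<close> requires; uniqueness as a function depends on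
    it.\<close>
  define D where "D = (\<lambda>a\<in>multivectors A E. SOME b. b \<in> multivectors A E \<and> ok a b)"
  have D: "D a \<in> multivectors A E \<and> ok a (D a)" if "a \<in> multivectors A E" for a
  proof -
    have "\<exists>b. b \<in> multivectors A E \<and> ok a b" using ex[OF that] by blast
    from someI_ex[OF this] show ?thesis using that by (simp add: D_def)
  qed
  have ex1: "\<exists>!D. D \<in> multivectors A E \<rightarrow>\<^sub>E multivectors A E \<and> (\<forall>a\<in>multivectors A E. ok a (D a))"
  proof (rule ex1I[of _ D], goal_cases)
    case 1
    have "D \<in> multivectors A E \<rightarrow>\<^sub>E multivectors A E" using D by (intro PiE_I) (auto simp: D_def)
    then show ?case using D by blast
  next
    case (2 D')
    have D': "D' a \<in> multivectors A E \<and> ok a (D' a)" if "a \<in> multivectors A E" for a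
      using PiE_mem[OF conjunct1[OF 2] that] conjunct2[OF 2] that by blast
    show ?case
    proof
      fix a show "D' a = D a"
      proof (cases "a \<in> multivectors A E")
        case True
        then show ?thesis using un[of "D' a" "D a" a] D[of a] D'[of a] by blast
      next
        case False
        then show ?thesis using PiE_arb[OF conjunct1[OF 2] False] by (simp add: D_def)
      qed
    qed
  qed
  have gen: "D' \<in> Gen A E br" if "D' \<in> multivectors A E \<rightarrow>\<^sub>E multivectors A E" "\<forall>a\<in>multivectors A E. ok a (D' a)" for D'
  proof -
    interpret volume_operator A E br \<nu> D'
    proof (unfold_locales, goal_cases)
      case 1 show ?case by (rule assms(2))
    next
      case 2 show ?case by (rule assms(3))
    next
      case 3 show ?case by (rule that(1))
    next
      case (4 a U \<mu> x)
      then show ?case using that(2) unfolding ok_def by blast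
    qed
    show ?thesis by (rule D_Gen)
  qed
  show ?thesis
    by (intro conjI ballI impI ex1[unfolded ok_def] gen[unfolded ok_def], assumption, erule (1) bspec)
qed

end
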